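(* Let $G$ be a group acting geometrically on a $\mathrm{CAT}(0)$ space $X$, let $X_D$ be the curtain model of $X$, and let $G_X$ and $G_{X_D}$ be the coarse kernels of the action of $G$ on $X$ and of the induced action of $G$ on $X_D$. Then exactly one of the following holds. (1) $X_D$ is unbounded and hence $G_X=G_{X_D}$; (2) $X_D$ is bounded, $|G:Z(G)|<\infty$, and $G_X=G=G_{X_D}$; (3) $X_D$ is bounded, $Z(G)$ has infinite index in $G$, and $G_X\neq G_{X_D}$. Here $Z(G)$ is the center of $G$.
   Context: All actions are by isometries. An action of $G$ on a $\mathrm{CAT}(0)$ space $(X,d)$ is geometric if it is properly discontinuous (for every $x\in X$, $r>0$ only finitely many $g\in G$ satisfy $d(g\cdot x,x)\le r$) and co-compact. Coarse kernel: for $G$ acting on a metric space $(Z,d_Z)$, $G_Z := \{g\in G \mid \exists C>0 \text{ with } d_Z(g\cdot z,z)\le C\ \forall z\in Z\}$. Curtain model. Let $X$ be a $\mathrm{CAT}(0)$ space. For a geodesic $\alpha:I\to X$ ($I\subseteq\mathbb{R}$ a closed interval) with closest-point projection $\pi_\alpha$ onto $\alpha$, and $r$ with $[r-1/2,r+1/2]$ in the interior of $I$, the curtain dual to $\alpha$ at $r$ is $h=h_{\alpha,r}=\pi_\alpha^{-1}(\alpha[r-1/2,r+1/2])$. Its halfspaces are $h^-=\pi_\alpha^{-1}\alpha(I\cap(-\infty,r-1/2))$ and $h^+=\pi_\alpha^{-1}\alpha(I\cap(r+1/2,\infty))$. The curtain $h$ separates subsets $A,B\subseteq X$ if one lies in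 $h^-$ and the other in $h^+$. A set $\{h_i\}$ of curtains (indexed by consecutive integers) is a chain if $h_i$ separates $h_{i-1}$ from $h_{i+1}$ for all $i$; a chain separates $A$ from $B$ if each $h_i$ does. For $L\in\mathbb{N}$, $L\geq 1$, disjoint curtains $h,h'$ are $L$-separated if every chain all of whose members meet both $h$ and $h'$ has cardinality at most $L$. An $L$-chain is a chain of curtains in which each pair is $L$-separated. Set $d_L(x,x)=0$ and, for $x\ne y$, $d_L(x,y)=1+\max\{|c| : c \text{ is an } L\text{-chain separating } x \text{ from } y\}$. Fix a sequence $\lambda_L\in(0,1)$ with $\sum_{L\ge1}\lambda_L<\sum_{L\ge1}L\lambda_L<\sum_{L\ge1}L^2\lambda_L=\Lambda<\infty$. The curtain model is $X_D:=(X,D)$ with $D(x,y)=\sum_{L=1}^\infty\lambda_L d_L(x,y)$. Every isometry of $X$ is an isometry of $X_D$, so an action of $G$ on $X$ induces an action of $G$ on $X_D$. *)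

theory Defs
  imports "HOL-Analysis.Analysis" "HOL-Algebra.Group_Action"
begin

text \<open>A metric space is given, as in the locale \<^locale>\<open>Metric_space\<close>, by a carrier \<open>X\<close> and a
  distance \<open>d\<close>. This allows the two metrics of the curtain model to live on the same carrier.\<close>

text \<open>Geodesics are total functions of which only the values on the parameter interval matter;
  the interval may be bounded, a ray or the whole line.\<close>

definition geodesic :: "'a set \<Rightarrow> ('a \<Rightarrow> 'a \<Rightarrow> real) \<Rightarrow> real set \<Rightarrow> (real \<Rightarrow> 'a) \<Rightarrow> bool" where
  "geodesic X d I \<alpha> \<longleftrightarrow> is_interval I \<and> closed I \<and> \<alpha> ` I \<subseteq> X \<and>
     (\<forall>s\<in>I. \<forall>t\<in>I. d (\<alpha> s) (\<alpha> t) = \<bar>s - t\<bar>)"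

definition geodesic_segment ::
    "'a set \<Rightarrow> ('a \<Rightarrow> 'a \<Rightarrow> real) \<Rightarrow> 'a \<Rightarrow> 'a \<Rightarrow> 'a set \<Rightarrow> bool" where
  "geodesic_segment X d x y S \<longleftrightarrow>
     (\<exists>\<alpha>. geodesic X d {0..d x y} \<alpha> \<and> \<alpha> 0 = x \<and> \<alpha> (d x y) = y \<and> S = \<alpha> ` {0..d x y})"

text \<open>Geodesic triangles are no fatter than their Euclidean comparison triangles. It suffices to
  compare points on the two sides \<open>S\<close>, \<open>T\<close> issuing from the vertex \<open>p\<close>, since the vertices are
  arbitrary (and on a single side the inequality is an equality). CAT(0) spaces are taken to be
  nonempty.\<close>

definition CAT0_space :: "'a set \<Rightarrow> ('a \<Rightarrow> 'a \<Rightarrow> real) \<Rightarrow> bool" where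
  "CAT0_space X d \<longleftrightarrow> Metric_space X d \<and> X \<noteq> {} \<and>
     (\<forall>x\<in>X. \<forall>y\<in>X. \<exists>S. geodesic_segment X d x y S) \<and>
     (\<forall>p\<in>X. \<forall>q\<in>X. \<forall>r\<in>X. \<forall>S T. geodesic_segment X d p q S \<and> geodesic_segment X d p r T \<longrightarrow>
       (\<forall>p' q' r' :: real^2. dist p' q' = d p q \<and> dist p' r' = d p r \<and> dist q' r' = d q r \<longrightarrow>
         (\<forall>x\<in>S. \<forall>y\<in>T. \<forall>x'\<in>closed_segment p' q'. \<forall>y'\<in>closed_segment p' r'.
            dist p' x' = d p x \<and> dist p' y' = d p y \<longrightarrow> d x y \<le> dist x' y')))"

definition isometric_action ::
    "('g, 'm) monoid_scheme \<Rightarrow> 'a set \<Rightarrow> ('a \<Rightarrow> 'a \<Rightarrow> real) \<Rightarrow> ('g \<Rightarrow> 'a \<Rightarrow> 'a) \<Rightarrow> bool" where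
  "isometric_action G X d \<phi> \<longleftrightarrow> group_action G X \<phi> \<and>
     (\<forall>g\<in>carrier G. \<forall>x\<in>X. \<forall>y\<in>X. d (\<phi> g x) (\<phi> g y) = d x y)"

definition properly_discontinuous ::
    "('g, 'm) monoid_scheme \<Rightarrow> 'a set \<Rightarrow> ('a \<Rightarrow> 'a \<Rightarrow> real) \<Rightarrow> ('g \<Rightarrow> 'a \<Rightarrow> 'a) \<Rightarrow> bool" where
  "properly_discontinuous G X d \<phi> \<longleftrightarrow>
     (\<forall>x\<in>X. \<forall>r>0. finite {g \<in> carrier G. d (\<phi> g x) x \<le> r})"

definition cocompact_action ::
    "('g, 'm) monoid_scheme \<Rightarrow> 'a set \<Rightarrow> ('a \<Rightarrow> 'a \<Rightarrow> real) \<Rightarrow> ('g \<Rightarrow> 'a \<Rightarrow> 'a) \<Rightarrow> bool" where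
  "cocompact_action G X d \<phi> \<longleftrightarrow>
     (\<exists>K. compactin (Metric_space.mtopology X d) K \<and> (\<Union>g\<in>carrier G. \<phi> g ` K) = X)"

definition geometric_action ::
    "('g, 'm) monoid_scheme \<Rightarrow> 'a set \<Rightarrow> ('a \<Rightarrow> 'a \<Rightarrow> real) \<Rightarrow> ('g \<Rightarrow> 'a \<Rightarrow> 'a) \<Rightarrow> bool" where
  "geometric_action G X d \<phi> \<longleftrightarrow>
     isometric_action G X d \<phi> \<and> properly_discontinuous G X d \<phi> \<and> cocompact_action G X d \<phi>"

definition coarse_kernel ::
    "('g, 'm) monoid_scheme \<Rightarrow> 'a set \<Rightarrow> ('a \<Rightarrow> 'a \<Rightarrow> real) \<Rightarrow> ('g \<Rightarrow> 'a \<Rightarrow> 'a) \<Rightarrow> 'g set" where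
  "coarse_kernel G Z d \<phi> = {g \<in> carrier G. \<exists>C>0. \<forall>z\<in>Z. d (\<phi> g z) z \<le> C}"

definition group_center :: "('g, 'm) monoid_scheme \<Rightarrow> 'g set" where
  "group_center G = {z \<in> carrier G. \<forall>g\<in>carrier G. z \<otimes>\<^bsub>G\<^esub> g = g \<otimes>\<^bsub>G\<^esub> z}"

definition finite_index :: "('g, 'm) monoid_scheme \<Rightarrow> 'g set \<Rightarrow> bool" where
  "finite_index G H \<longleftrightarrow> finite (rcosets\<^bsub>G\<^esub> H)"

text \<open>In a CAT(0) space the nearest point of a geodesic exists and is unique, because the geodesic
  is parametrised by a closed interval and hence has complete convex image.\<close>

definition geodesic_projection ::
    "('a \<Rightarrow> 'a \<Rightarrow> real) \<Rightarrow> real set \<Rightarrow> (real \<Rightarrow> 'a) \<Rightarrow> 'a \<Rightarrow> 'a" where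
  "geodesic_projection d I \<alpha> x = (THE p. p \<in> \<alpha> ` I \<and> (\<forall>q\<in>\<alpha> ` I. d x p \<le> d x q))"

definition projection_preimage ::
    "'a set \<Rightarrow> ('a \<Rightarrow> 'a \<Rightarrow> real) \<Rightarrow> real set \<Rightarrow> (real \<Rightarrow> 'a) \<Rightarrow> real set \<Rightarrow> 'a set" where
  "projection_preimage X d I \<alpha> J = {x \<in> X. geodesic_projection d I \<alpha> x \<in> \<alpha> ` J}"

definition dual_curtain ::
    "'a set \<Rightarrow> ('a \<Rightarrow> 'a \<Rightarrow> real) \<Rightarrow> real set \<Rightarrow> (real \<Rightarrow> 'a) \<Rightarrow> real \<Rightarrow> 'a set" where
  "dual_curtain X d I \<alpha> r = projection_preimage X d I \<alpha> {r - 1/2..r + 1/2}"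

definition neg_halfspace ::
    "'a set \<Rightarrow> ('a \<Rightarrow> 'a \<Rightarrow> real) \<Rightarrow> real set \<Rightarrow> (real \<Rightarrow> 'a) \<Rightarrow> real \<Rightarrow> 'a set" where
  "neg_halfspace X d I \<alpha> r = projection_preimage X d I \<alpha> (I \<inter> {..<r - 1/2})"

definition pos_halfspace ::
    "'a set \<Rightarrow> ('a \<Rightarrow> 'a \<Rightarrow> real) \<Rightarrow> real set \<Rightarrow> (real \<Rightarrow> 'a) \<Rightarrow> real \<Rightarrow> 'a set" where
  "pos_halfspace X d I \<alpha> r = projection_preimage X d I \<alpha> (I \<inter> {r + 1/2<..})"

definition is_dual_curtain ::
    "'a set \<Rightarrow> ('a \<Rightarrow> 'a \<Rightarrow> real) \<Rightarrow> real set \<Rightarrow> (real \<Rightarrow> 'a) \<Rightarrow> real \<Rightarrow> 'a set \<Rightarrow> bool" where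
  "is_dual_curtain X d I \<alpha> r h \<longleftrightarrow>
     geodesic X d I \<alpha> \<and> {r - 1/2..r + 1/2} \<subseteq> interior I \<and> h = dual_curtain X d I \<alpha> r"

definition curtain :: "'a set \<Rightarrow> ('a \<Rightarrow> 'a \<Rightarrow> real) \<Rightarrow> 'a set \<Rightarrow> bool" where
  "curtain X d h \<longleftrightarrow> (\<exists>I \<alpha> r. is_dual_curtain X d I \<alpha> r h)"

text \<open>A curtain is a subset of \<open>X\<close>, so that cardinalities of chains count subsets. This is harmless
  for separation: the two halfspaces are the path components of the complement of \<open>h\<close>, so up to
  exchanging them they do not depend on the pair \<open>(\<alpha>, r)\<close> to which \<open>h\<close> is dual.\<close>

definition separates ::
    "'a set \<Rightarrow> ('a \<Rightarrow> 'a \<Rightarrow> real) \<Rightarrow> 'a set \<Rightarrow> 'a set \<Rightarrow> 'a set \<Rightarrow> bool" where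
  "separates X d h A B \<longleftrightarrow> (\<exists>I \<alpha> r. is_dual_curtain X d I \<alpha> r h \<and>
     (A \<subseteq> neg_halfspace X d I \<alpha> r \<and> B \<subseteq> pos_halfspace X d I \<alpha> r \<or>
      B \<subseteq> neg_halfspace X d I \<alpha> r \<and> A \<subseteq> pos_halfspace X d I \<alpha> r))"

text \<open>The set \<open>J\<close> of consecutive integers may be empty, finite or infinite; the separation
  condition is imposed at those indices both of whose neighbours are indices.\<close>

definition curtain_chain :: "'a set \<Rightarrow> ('a \<Rightarrow> 'a \<Rightarrow> real) \<Rightarrow> 'a set set \<Rightarrow> bool" where
  "curtain_chain X d c \<longleftrightarrow> (\<forall>h\<in>c. curtain X d h) \<and>
     (\<exists>(J :: int set) h. (\<forall>i\<in>J. \<forall>k\<in>J. {i..k} \<subseteq> J) \<and> bij_betw h J c \<and>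
        (\<forall>i. i - 1 \<in> J \<and> i \<in> J \<and> i + 1 \<in> J \<longrightarrow> separates X d (h i) (h (i - 1)) (h (i + 1))))"

definition chain_separates ::
    "'a set \<Rightarrow> ('a \<Rightarrow> 'a \<Rightarrow> real) \<Rightarrow> 'a set set \<Rightarrow> 'a set \<Rightarrow> 'a set \<Rightarrow> bool" where
  "chain_separates X d c A B \<longleftrightarrow> (\<forall>h\<in>c. separates X d h A B)"

definition L_separated ::
    "'a set \<Rightarrow> ('a \<Rightarrow> 'a \<Rightarrow> real) \<Rightarrow> nat \<Rightarrow> 'a set \<Rightarrow> 'a set \<Rightarrow> bool" where
  "L_separated X d L h h' \<longleftrightarrow> curtain X d h \<and> curtain X d h' \<and> h \<inter> h' = {} \<and>
     (\<forall>c. curtain_chain X d c \<and> (\<forall>k\<in>c. k \<inter> h \<noteq> {} \<and> k \<inter> h' \<noteq> {}) \<longrightarrow> finite c \<and> card c \<le> L)"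

definition L_chain :: "'a set \<Rightarrow> ('a \<Rightarrow> 'a \<Rightarrow> real) \<Rightarrow> nat \<Rightarrow> 'a set set \<Rightarrow> bool" where
  "L_chain X d L c \<longleftrightarrow> curtain_chain X d c \<and> pairwise (L_separated X d L) c"

text \<open>The maximum exists: the empty chain is admissible, and the members of an \<open>L\<close>-chain separating
  \<open>x\<close> from \<open>y\<close> are disjoint and each take up length at least 1 on a geodesic from \<open>x\<close> to \<open>y\<close>, so that
  these chains are finite and of bounded cardinality.\<close>

definition curtain_dist ::
    "'a set \<Rightarrow> ('a \<Rightarrow> 'a \<Rightarrow> real) \<Rightarrow> nat \<Rightarrow> 'a \<Rightarrow> 'a \<Rightarrow> nat" where
  "curtain_dist X d L x y =
     (if x = y then 0
      else 1 + Max {card c | c. L_chain X d L c \<and> chain_separates X d c {x} {y}})"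

text \<open>Sequences indexed by \<open>L \<ge> 1\<close> are functions on \<open>nat\<close> whose value at 0 is ignored. Summability
  of the last series implies that of the other two.\<close>

definition admissible_weights :: "(nat \<Rightarrow> real) \<Rightarrow> bool" where
  "admissible_weights w \<longleftrightarrow> (\<forall>L\<ge>1. 0 < w L \<and> w L < 1) \<and>
     summable (\<lambda>n. real (Suc n) ^ 2 * w (Suc n)) \<and>
     (\<Sum>n. w (Suc n)) < (\<Sum>n. real (Suc n) * w (Suc n)) \<and>
     (\<Sum>n. real (Suc n) * w (Suc n)) < (\<Sum>n. real (Suc n) ^ 2 * w (Suc n))"

definition curtain_model_dist ::
    "'a set \<Rightarrow> ('a \<Rightarrow> 'a \<Rightarrow> real) \<Rightarrow> (nat \<Rightarrow> real) \<Rightarrow> 'a \<Rightarrow> 'a \<Rightarrow> real" where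
  "curtain_model_dist X d w x y = (\<Sum>n. w (Suc n) * real (curtain_dist X d (Suc n) x y))"

end

theory Submission
  imports Defs
begin

text \<open>Why the theorem holds. If \<open>X\<^sub>D\<close> is bounded then every element of \<open>G\<close> displaces all points
  by a bounded \<open>D\<close>-distance, so \<open>G\<close> is its own coarse kernel on \<open>X\<^sub>D\<close>, and it remains to see that
  the coarse kernel on \<open>X\<close> is all of \<open>G\<close> exactly when the center has finite index. For a geometric
  action, an element lies in the coarse kernel on \<open>X\<close> iff it has finitely many conjugates: its
  displacement at \<open>a x\<close> is the displacement of its conjugate by \<open>a\<close> at \<open>x\<close>. A center of finite
  index makes all conjugacy classes finite (\<open>finite_index_center_imp_kernel\<close>). Conversely, \<open>G\<close> is
  generated by the finite set of elements of small displacement at a base point, and if each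
  of these has finitely many conjugates, the intersection of their centralizers, which is the center,
  has finite index (\<open>kernel_imp_finite_index_center\<close>).

  Now let \<open>X\<^sub>D\<close> be unbounded. As \<open>D\<close> is bounded above by an affine function of \<open>d\<close>, the coarse
  kernel on \<open>X\<close> is contained in the one on \<open>X\<^sub>D\<close>. For the other inclusion, the main tool is the
  \<open>bottleneck\<close> lemma: if \<open>h\<^sub>1, h\<^sub>2, h\<^sub>3\<close> are consecutive curtains of an \<open>L\<close>-chain, then two geodesics
  crossing all three come within distance \<open>2 L + 2\<close> of each other near \<open>h\<^sub>2\<close>. Otherwise a
  shortest segment from a point of one geodesic in \<open>h\<^sub>2\<close> to the other geodesic would carry more than
  \<open>L\<close> dual curtains, and each of them would separate points of \<open>h\<^sub>2\<close>, and points of \<open>h\<^sub>1\<close> or of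
  \<open>h\<^sub>3\<close>, hence meet two \<open>L\<close>-separated curtains.

  Suppose first that for some fixed \<open>L\<close> there are arbitrarily long \<open>L\<close>-chains, and let \<open>g\<close> displace
  all points by at most \<open>C\<close> with respect to \<open>D\<close>. Then \<open>g\<close> moves the ends of a segment \<open>[x,y]\<close> across
  at most \<open>C / \<lambda>\<^sub>L\<close> members of an \<open>L\<close>-chain separating \<open>x\<close> from \<open>y\<close>. If that chain is long enough,
  the bottleneck lemma, applied on both sides of a midpoint \<open>p\<close>, pins \<open>g p\<close> down up to
  a distance that depends only on the chain (\<open>displacement_bound\<close>). All conjugates of \<open>g\<close>
  satisfy the same hypothesis, so all of them move \<open>p\<close> by a bounded distance, and since
  the orbit of \<open>p\<close> is coarsely dense, \<open>g\<close> has bounded displacement on \<open>X\<close>.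

  It remains to find that \<open>L\<close> (\<open>unbounded_imp_long_chains\<close>). As \<open>\<Sum> L\<^sup>2 \<lambda>\<^sub>L\<close> converges and \<open>D\<close> is
  unbounded, \<open>d\<^sub>L\<close> is not bounded by a constant multiple of \<open>L\<^sup>2\<close>. So there is a single block: an
  \<open>L\<close>-chain, separating \<open>x\<close> from \<open>y\<close>, which is long compared both with the bottleneck
  width \<open>2 L + 2\<close> and with the density \<open>K\<close> of orbits. Blocks can be concatenated without
  end (\<open>block_growth\<close>): at the tip of a block put the midpoint \<open>g p\<close> of a translate \<open>g [x,y]\<close>. One of
  the two halves of the translate leaves \<open>g p\<close> at an angle of at least \<open>\<pi>/2\<close> with the block so far
  (\<open>straight_angle\<close>), and this half is the next block. Perpendicular geodesics diverge
  linearly, so bottlenecks on the two sides of the corner cannot be threaded by one geodesic from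
  the corner (\<open>right_angle_divergence\<close>); so curtains chosen from consecutive blocks are nested, and one
  curtain from every block gives an \<open>L\<close>-chain of any length (\<open>concatenation\<close>).

  The CAT(0) geometry enters only through the comparison of a point with a point on the opposite side
  of a triangle (\<open>stewart\<close>), from which all facts on projections and angles are derived.\<close>

section \<open>Segments in CAT(0) spaces\<close>

text \<open>One vertex of the comparison triangle is the origin and a second one lies on the first axis;
  the law of cosines determines the third.\<close>

lemma comparison_triangle:
  fixes a b c :: real
  assumes "0 < b" "a \<le> b + c" "b \<le> a + c" "c \<le> a + b"
  shows "\<exists>p' z' :: real^2. norm p' = a \<and> norm z' = b \<and> dist p' z' = c"
proof -
  define u where "u = (a\<^sup>2 + b\<^sup>2 - c\<^sup>2) / (2 * b)"
  have a0: "0 \<le> a" and c0: "0 \<le> c" using assms by linarith+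
  have "c\<^sup>2 \<le> (a + b)\<^sup>2" using assms c0 by (intro power_mono) auto
  moreover have "(a - b)\<^sup>2 \<le> c\<^sup>2" using assms c0 by (intro power2_le_iff_abs_le[THEN iffD2]) auto
  ultimately have "\<bar>a\<^sup>2 + b\<^sup>2 - c\<^sup>2\<bar> \<le> 2 * b * a"
    by (auto simp: power2_eq_square algebra_simps abs_le_iff)
  hence "\<bar>u\<bar> \<le> a" using assms(1) by (simp add: u_def abs_divide pos_divide_le_eq mult.commute)
  hence u2: "u\<^sup>2 \<le> a\<^sup>2" using a0 by (metis power2_le_iff_abs_le)
  have ub: "2 * u * b = a\<^sup>2 + b\<^sup>2 - c\<^sup>2" using assms(1) by (simp add: u_def)
  let ?p = "vector [u, sqrt (a\<^sup>2 - u\<^sup>2)] :: real^2" and ?z = "vector [b, 0] :: real^2"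
  have "norm ?p = a" using u2 a0
    by (simp add: norm_eq_sqrt_inner inner_vec_def sum_2 power2_eq_square[symmetric])
  moreover have "norm ?z = b" using assms(1)
    by (simp add: norm_eq_sqrt_inner inner_vec_def sum_2 power2_eq_square[symmetric])
  moreover have "dist ?p ?z = c"
  proof -
    have "(u - b)\<^sup>2 + (a\<^sup>2 - u\<^sup>2) = c\<^sup>2" using ub by (simp add: power2_eq_square algebra_simps)
    thus ?thesis using u2 c0
      by (simp add: dist_norm norm_eq_sqrt_inner inner_vec_def sum_2 power2_eq_square[symmetric])
  qed
  ultimately show ?thesis by blast
qed

text \<open>Stewart's formula for a cevian, one endpoint of the divided side being the origin.\<close>

lemma stewart_inner:
  fixes p z :: "'v::real_inner"
  shows "(norm (p - k *\<^sub>R z))\<^sup>2 = (1 - k) * (norm p)\<^sup>2 + k * (norm (p - z))\<^sup>2 - k * (1 - k) * (norm z)\<^sup>2"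
  by (simp add: power2_norm_eq_inner inner_diff_left inner_diff_right algebra_simps inner_commute)

locale cat0_space = Metric_space X d for X :: "'a set" and d +
  assumes cat0: "CAT0_space X d"
begin

text \<open>Segments are described by betweenness, so that statements about them need no parametrisation;
  by uniqueness of geodesics they are the images of geodesics (\<open>seg_geodesic\<close>).\<close>

definition seg :: "'a \<Rightarrow> 'a \<Rightarrow> 'a set" where
  "seg x y = {p \<in> X. d x p + d p y = d x y}"

lemma seg_in: "p \<in> seg x y \<Longrightarrow> p \<in> X" by (simp add: seg_def)

lemma seg_commute: "seg x y = seg y x" by (auto simp: seg_def commute add.commute)

lemma ends_in_seg: "x \<in> X \<Longrightarrow> y \<in> X \<Longrightarrow> x \<in> seg x y \<and> y \<in> seg x y"
  by (simp add: seg_def)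

lemma seg_trans:
  assumes "x \<in> X" "y \<in> X" "p \<in> seg x y" "q \<in> seg x p"
  shows "q \<in> seg x y" "p \<in> seg q y"
proof -
  have "p \<in> X" "q \<in> X" "d x p + d p y = d x y" "d x q + d q p = d x p"
    using assms by (auto simp: seg_def)
  moreover have "d q y \<le> d q p + d p y" "d x y \<le> d x q + d q y"
    using calculation assms triangle by blast+
  ultimately show "q \<in> seg x y" "p \<in> seg q y" by (auto simp: seg_def)
qed

lemma seg_trans':
  assumes "x \<in> X" "y \<in> X" "p \<in> seg x y" "q \<in> seg p y"
  shows "q \<in> seg x y" "p \<in> seg x q"
  using seg_trans[of y x p q] assms by (simp_all add: seg_commute)

lemma seg_dist_le: assumes "p \<in> seg x y" shows "d x p \<le> d x y" "d p y \<le> d x y"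
proof -
  have "d x p + d p y = d x y" using assms by (simp add: seg_def)
  thus "d x p \<le> d x y" "d p y \<le> d x y" using nonneg[of x p] nonneg[of p y] by linarith+
qed

lemma geodesic_exists:
  assumes "x \<in> X" "y \<in> X"
  obtains \<gamma> where "geodesic X d {0..d x y} \<gamma>" "\<gamma> 0 = x" "\<gamma> (d x y) = y"
  using cat0 assms unfolding CAT0_space_def geodesic_segment_def by meson

lemma geodesic_dist:
  "geodesic X d I \<alpha> \<Longrightarrow> s \<in> I \<Longrightarrow> t \<in> I \<Longrightarrow> d (\<alpha> s) (\<alpha> t) = \<bar>s - t\<bar>"
  by (simp add: geodesic_def)

lemma geodesic_in: "geodesic X d I \<alpha> \<Longrightarrow> s \<in> I \<Longrightarrow> \<alpha> s \<in> X"
  by (auto simp: geodesic_def)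

lemma geodesic_interval:
  assumes "geodesic X d I \<alpha>" "s \<in> I" "u \<in> I" shows "{s..u} \<subseteq> I"
proof
  fix t assume "t \<in> {s..u}"
  moreover have "is_interval I" using assms by (simp add: geodesic_def)
  ultimately show "t \<in> I" using mem_is_interval_1_I[of I s u t] assms by simp
qed

text \<open>Stewart's formula as an inequality: the CAT(0) condition for the triangle with vertices
  \<open>\<alpha> s\<close>, \<open>p\<close>, \<open>\<alpha> u\<close>, comparing its vertex
  \<open>p\<close> with the point \<open>\<alpha> t\<close> of the opposite side.\<close>

lemma geodesic_comparison:
  assumes \<alpha>: "geodesic X d I \<alpha>" and I: "s \<in> I" "u \<in> I" and st: "s \<le> t" "t \<le> u" and p: "p \<in> X"
  shows "(u - s) * (d p (\<alpha> t))\<^sup>2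
    \<le> (u - t) * (d p (\<alpha> s))\<^sup>2 + (t - s) * (d p (\<alpha> u))\<^sup>2 - (t - s) * (u - t) * (u - s)"
proof (cases "s = u")
  case True
  then show ?thesis using st by simp
next
  case False
  hence su: "0 < u - s" using st by simp
  note sub = geodesic_interval[OF \<alpha> I]
  have tI: "t \<in> I" using sub st by auto
  have dsu: "d (\<alpha> s) (\<alpha> u) = u - s" and dst: "d (\<alpha> s) (\<alpha> t) = t - s"
    using geodesic_dist[OF \<alpha>] I tI st by auto
  let ?o = "\<alpha> s" and ?z = "\<alpha> u"
  have oz: "?o \<in> X" "?z \<in> X" "\<alpha> t \<in> X" using geodesic_in[OF \<alpha>] I tI by auto
  obtain S where S: "geodesic_segment X d ?o p S"
    using cat0 oz p unfolding CAT0_space_def by blast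
  have pS: "p \<in> S"
  proof -
    obtain \<delta> where "\<delta> (d ?o p) = p" "S = \<delta> ` {0..d ?o p}" using S unfolding geodesic_segment_def by blast
    moreover have "d ?o p \<in> {0..d ?o p}" by simp
    ultimately show ?thesis by (metis image_eqI)
  qed
  define \<beta> where "\<beta> v = \<alpha> (s + v)" for v
  have T: "geodesic_segment X d ?o ?z (\<beta> ` {0..u - s})"
    unfolding geodesic_segment_def
  proof (intro exI conjI)
    have shift: "s + v \<in> I" if "v \<in> {0..u - s}" for v using sub that by auto
    show "geodesic X d {0..d ?o ?z} \<beta>"
      unfolding geodesic_def dsu \<beta>_def using shift geodesic_in[OF \<alpha>] geodesic_dist[OF \<alpha>]
      by (auto simp: is_interval_cc)
  qed (auto simp: \<beta>_def dsu)
  have tT: "\<alpha> t \<in> \<beta> ` {0..u - s}" using st by (auto simp: \<beta>_def intro!: image_eqI[of _ _ "t - s"])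
  obtain p' z' :: "real^2" where pz: "norm p' = d ?o p" "norm z' = u - s" "dist p' z' = d p ?z"
    using comparison_triangle[of "u - s" "d ?o p" "d p ?z"] su
      triangle[OF oz(1,2) p] triangle[OF oz(1) p oz(2)] triangle[OF p oz(1,2)] dsu commute
    by (smt (verit) oz p triangle)
  define k where "k = (t - s) / (u - s)"
  have k: "0 \<le> k" "k \<le> 1" using su st by (auto simp: k_def)
  have yseg: "k *\<^sub>R z' \<in> closed_segment 0 z'"
    using k by (auto simp: closed_segment_def)
  have ny: "dist 0 (k *\<^sub>R z') = d ?o (\<alpha> t)" using su st pz by (simp add: dst k_def)
  have "\<forall>p'' q' r' :: real^2. dist p'' q' = d ?o p \<and> dist p'' r' = d ?o ?z \<and> dist q' r' = d p ?z \<longrightarrow>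
         (\<forall>x\<in>S. \<forall>y\<in>\<beta> ` {0..u - s}. \<forall>x'\<in>closed_segment p'' q'. \<forall>y'\<in>closed_segment p'' r'.
            dist p'' x' = d ?o x \<and> dist p'' y' = d ?o y \<longrightarrow> d x y \<le> dist x' y')"
    using cat0 S T oz p unfolding CAT0_space_def by blast
  from this[rule_format, of 0 p' z' p "\<alpha> t" p' "k *\<^sub>R z'"]
  have "d p (\<alpha> t) \<le> dist p' (k *\<^sub>R z')" using pz pS tT yseg ny dsu by simp
  hence "(d p (\<alpha> t))\<^sup>2 \<le> (dist p' (k *\<^sub>R z'))\<^sup>2" by (intro power_mono) auto
  also have "\<dots> = (1 - k) * (d p ?o)\<^sup>2 + k * (d p ?z)\<^sup>2 - k * (1 - k) * (u - s)\<^sup>2"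
    unfolding dist_norm stewart_inner using pz by (simp add: dist_norm commute)
  finally have "(u - s) * (d p (\<alpha> t))\<^sup>2
     \<le> (u - s) * ((1 - k) * (d p ?o)\<^sup>2 + k * (d p ?z)\<^sup>2 - k * (1 - k) * (u - s)\<^sup>2)"
    using su by (intro mult_left_mono) auto
  also have "\<dots> = ((u - s) * (1 - k)) * (d p ?o)\<^sup>2 + ((u - s) * k) * (d p ?z)\<^sup>2
      - ((u - s) * k) * ((u - s) * (1 - k)) * (u - s)"
    by (simp add: algebra_simps power2_eq_square)
  also have "(u - s) * k = t - s" using su by (simp add: k_def)
  also have "(u - s) * (1 - k) = u - t" using su by (simp add: k_def field_simps)
  finally show ?thesis .
qed

text \<open>Uniqueness of geodesics: comparing a point of the segment, taken as \<open>p\<close>, with the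
  point of the geodesic at the same distance from \<open>\<alpha> s\<close> makes the right-hand side of
  the comparison vanish.\<close>

lemma seg_geodesic:
  assumes \<alpha>: "geodesic X d I \<alpha>" and I: "s \<in> I" "u \<in> I" and su: "s \<le> u"
  shows "seg (\<alpha> s) (\<alpha> u) = \<alpha> ` {s..u}"
proof
  note sub = geodesic_interval[OF \<alpha> I]
  show "\<alpha> ` {s..u} \<subseteq> seg (\<alpha> s) (\<alpha> u)"
    using sub su I geodesic_in[OF \<alpha>] geodesic_dist[OF \<alpha>] by (auto simp: seg_def subset_iff)
  show "seg (\<alpha> s) (\<alpha> u) \<subseteq> \<alpha> ` {s..u}"
  proof
    fix q assume q: "q \<in> seg (\<alpha> s) (\<alpha> u)"
    have dsu: "d (\<alpha> s) (\<alpha> u) = u - s" using geodesic_dist[OF \<alpha>] I su by auto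
    define t where "t = s + d (\<alpha> s) q"
    have "d (\<alpha> s) q + d q (\<alpha> u) = u - s" using q dsu by (simp add: seg_def)
    hence t: "s \<le> t" "t \<le> u" "d q (\<alpha> s) = t - s" "d q (\<alpha> u) = u - t"
      using nonneg[of q "\<alpha> u"] nonneg[of "\<alpha> s" q] commute[of q "\<alpha> s"] unfolding t_def by linarith+
    have "q = \<alpha> t"
    proof (cases "s = u")
      case True
      hence "t = s" using t by simp
      hence "d q (\<alpha> s) = 0" using t by simp
      thus ?thesis using seg_in[OF q] geodesic_in[OF \<alpha> I(1)] \<open>t = s\<close> by simp
    next
      case False
      have "(u - s) * (d q (\<alpha> t))\<^sup>2 \<le> 0"
        using geodesic_comparison[OF \<alpha> I t(1,2) seg_in[OF q]] t(3,4)
        by (simp add: power2_eq_square algebra_simps)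
      hence "(d q (\<alpha> t))\<^sup>2 \<le> 0" using False su by (simp add: mult_le_0_iff)
      hence "d q (\<alpha> t) = 0" by simp
      thus ?thesis using seg_in[OF q] geodesic_in[OF \<alpha>] sub t by auto
    qed
    thus "q \<in> \<alpha> ` {s..u}" using t by auto
  qed
qed

lemma seg_param:
  assumes "x \<in> X" "y \<in> X"
  obtains \<gamma> where "geodesic X d {0..d x y} \<gamma>" "\<gamma> 0 = x" "\<gamma> (d x y) = y" "seg x y = \<gamma> ` {0..d x y}"
    "\<And>t. t \<in> {0..d x y} \<Longrightarrow> d x (\<gamma> t) = t \<and> d (\<gamma> t) y = d x y - t"
proof -
  obtain \<gamma> where \<gamma>: "geodesic X d {0..d x y} \<gamma>" "\<gamma> 0 = x" "\<gamma> (d x y) = y"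
    using geodesic_exists[OF assms] .
  show ?thesis
  proof (rule that[OF \<gamma>])
    show "seg x y = \<gamma> ` {0..d x y}" using seg_geodesic[OF \<gamma>(1), of 0 "d x y"] \<gamma> by auto
    show "d x (\<gamma> t) = t \<and> d (\<gamma> t) y = d x y - t" if "t \<in> {0..d x y}" for t
      using geodesic_dist[OF \<gamma>(1), of 0 t] geodesic_dist[OF \<gamma>(1), of t "d x y"] \<gamma> that by auto
  qed
qed

text \<open>Divided by \<open>d x y\<close>, this says that the square of the distance from
  \<open>p\<close> is as convex along a segment as it is in Euclidean space.\<close>

lemma stewart:
  assumes "x \<in> X" "y \<in> X" "p \<in> X" "q \<in> seg x y"
  shows "d x y * (d p q)\<^sup>2 \<le> d q y * (d p x)\<^sup>2 + d x q * (d p y)\<^sup>2 - d x q * d q y * d x y"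
proof -
  obtain \<gamma> where \<gamma>: "geodesic X d {0..d x y} \<gamma>" "\<gamma> 0 = x" "\<gamma> (d x y) = y" "seg x y = \<gamma> ` {0..d x y}"
    "\<And>t. t \<in> {0..d x y} \<Longrightarrow> d x (\<gamma> t) = t \<and> d (\<gamma> t) y = d x y - t"
    using seg_param[OF assms(1,2)] by metis
  obtain t where t: "t \<in> {0..d x y}" "q = \<gamma> t" using assms(4) \<gamma>(4) by auto
  show ?thesis using geodesic_comparison[OF \<gamma>(1), of 0 "d x y" t p] t \<gamma>(2,3) assms(3) \<gamma>(5)[OF t(1)]
    by simp
qed

lemma seg_linear:
  assumes "x \<in> X" "y \<in> X" "p \<in> seg x y" "q \<in> seg x y" "d x p \<le> d x q"
  shows "p \<in> seg x q"
proof -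
  obtain \<gamma> where \<gamma>: "geodesic X d {0..d x y} \<gamma>" "\<gamma> 0 = x" "\<gamma> (d x y) = y" "seg x y = \<gamma> ` {0..d x y}"
    "\<And>t. t \<in> {0..d x y} \<Longrightarrow> d x (\<gamma> t) = t \<and> d (\<gamma> t) y = d x y - t"
    using seg_param[OF assms(1,2)] by metis
  obtain s t where st: "s \<in> {0..d x y}" "p = \<gamma> s" "t \<in> {0..d x y}" "q = \<gamma> t" using assms \<gamma>(4) by auto
  show ?thesis using geodesic_dist[OF \<gamma>(1) st(1,3)] \<gamma>(5)[OF st(1)] \<gamma>(5)[OF st(3)] st assms
      seg_in[OF assms(3)] by (simp add: seg_def)
qed

lemma seg_point:
  assumes "x \<in> X" "y \<in> X" "0 \<le> t" "t \<le> d x y"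
  obtains q where "q \<in> seg x y" "d x q = t"
  using seg_param[OF assms(1,2)] assms(3,4) by (metis atLeastAtMost_iff image_eqI)

text \<open>Similar triangles with common vertex \<open>x\<close>, obtained by applying
  \<open>stewart\<close> on both sides.\<close>

lemma fan_comparison:
  assumes X: "x \<in> X" "y \<in> X" "z \<in> X" and q: "q \<in> seg x y" "q' \<in> seg x z"
    and k: "0 \<le> k" "k \<le> 1" "d x q = k * d x y" "d x q' = k * d x z"
  shows "d q q' \<le> k * d y z"
proof -
  have norm_stewart: "(d p q)\<^sup>2 \<le> (1 - k) * (d p x)\<^sup>2 + k * (d p y)\<^sup>2 - k * (1 - k) * (d x y)\<^sup>2"
    if "y \<in> X" "p \<in> X" "q \<in> seg x y" "d x q = k * d x y" for p q y
  proof (cases "d x y = 0")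
    case True
    hence "x = y" "x = q" using that X seg_in by auto
    thus ?thesis using X by (simp add: algebra_simps)
  next
    case False
    have dq: "d q y = (1 - k) * d x y" using that by (simp add: seg_def algebra_simps)
    have "d x y * (d p q)\<^sup>2 \<le> d x y * ((1 - k) * (d p x)\<^sup>2 + k * (d p y)\<^sup>2 - k * (1 - k) * (d x y)\<^sup>2)"
      using stewart[OF X(1) that(1,2,3)] unfolding dq that(4) by (simp add: algebra_simps power2_eq_square)
    thus ?thesis using False nonneg[of x y] by (simp add: mult_le_cancel_left)
  qed
  have qX: "q \<in> X" "q' \<in> X" using q seg_in by auto
  have "(d q q')\<^sup>2 \<le> (1 - k) * (d q x)\<^sup>2 + k * (d q z)\<^sup>2 - k * (1 - k) * (d x z)\<^sup>2"
    using norm_stewart X qX q k by blast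
  also have "(d q x)\<^sup>2 = k\<^sup>2 * (d x y)\<^sup>2" using k by (simp add: commute power_mult_distrib)
  finally have "(d q q')\<^sup>2 \<le> (1 - k) * (k\<^sup>2 * (d x y)\<^sup>2) + k * (d q z)\<^sup>2 - k * (1 - k) * (d x z)\<^sup>2" .
  moreover have "(d q z)\<^sup>2 \<le> (1 - k) * (d x z)\<^sup>2 + k * (d y z)\<^sup>2 - k * (1 - k) * (d x y)\<^sup>2"
    using norm_stewart[OF X(2) X(3) q(1) k(3)] by (simp add: commute)
  hence "k * (d q z)\<^sup>2 \<le> k * ((1 - k) * (d x z)\<^sup>2 + k * (d y z)\<^sup>2 - k * (1 - k) * (d x y)\<^sup>2)"
    using k(1) by (rule mult_left_mono)
  ultimately have "(d q q')\<^sup>2 \<le> (1 - k) * (k\<^sup>2 * (d x y)\<^sup>2)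
      + k * ((1 - k) * (d x z)\<^sup>2 + k * (d y z)\<^sup>2 - k * (1 - k) * (d x y)\<^sup>2) - k * (1 - k) * (d x z)\<^sup>2"
    by simp
  hence "(d q q')\<^sup>2 \<le> (k * d y z)\<^sup>2" by (simp add: algebra_simps power2_eq_square)
  thus ?thesis using k nonneg power2_le_imp_le by simp
qed

lemma strictly_closer:
  assumes "x \<in> X" "y \<in> X" "p \<in> X" "q \<in> seg x y" "q \<noteq> x" "d p y < d p x"
  shows "d p q < d p x"
proof -
  have q: "q \<in> X" "0 < d x q" "0 \<le> d q y" "d x y = d x q + d q y" "0 < d x y"
    using assms seg_in[OF assms(4)] nonneg[of q y] nonneg[of x q] by (auto simp: seg_def less_le)
  have "(d p y)\<^sup>2 < (d p x)\<^sup>2" using assms(6) nonneg by (intro power_strict_mono) auto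
  hence "d x q * (d p y)\<^sup>2 < d x q * (d p x)\<^sup>2" using q by simp
  moreover have "0 \<le> d x q * d q y * d x y" using q by simp
  ultimately have "d x y * (d p q)\<^sup>2 < d q y * (d p x)\<^sup>2 + d x q * (d p x)\<^sup>2"
    using stewart[OF assms(1-4)] by linarith
  also have "\<dots> = d x y * (d p x)\<^sup>2" using q by (simp add: algebra_simps)
  finally have "(d p q)\<^sup>2 < (d p x)\<^sup>2" using q(5) by simp
  thus ?thesis using nonneg power2_less_imp_less by blast
qed

text \<open>The foot of the perpendicular from \<open>z\<close> to \<open>[v,w]\<close> is
  \<open>v\<close>. For three distinct points this says that the angle at \<open>v\<close> is at least
  \<open>\<pi>/2\<close>; stating it by distances avoids angles altogether.\<close>

definition obtuse :: "'a \<Rightarrow> 'a \<Rightarrow> 'a \<Rightarrow> bool" where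
  "obtuse z v w \<longleftrightarrow> (\<forall>s\<in>seg v w. d z v \<le> d z s)"

text \<open>Compare \<open>z\<close> with a point of \<open>[v,w]\<close> at distance \<open>t\<close>
  from \<open>v\<close>, divide \<open>stewart\<close> by \<open>t\<close>, and let \<open>t\<close> tend
  to 0.\<close>

lemma pythagoras:
  assumes X: "z \<in> X" "v \<in> X" "w \<in> X" and ob: "obtuse z v w"
  shows "(d z v)\<^sup>2 + (d v w)\<^sup>2 \<le> (d z w)\<^sup>2"
proof (cases "d v w = 0")
  case True
  then show ?thesis using X by simp
next
  case False
  define l where "l = d v w"
  have l: "0 < l" using False by (simp add: l_def less_le)
  \<comment> \<open>The error term \<open>l * t\<close> disappears in the limit.\<close>
  have step: "(d z v)\<^sup>2 + l * l \<le> (d z w)\<^sup>2 + l * t" if t: "0 < t" "t \<le> l" for t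
  proof -
    obtain s where s: "s \<in> seg v w" "d v s = t" using seg_point[OF X(2,3), of t] t by (auto simp: l_def)
    have sw: "d s w = l - t" using s by (simp add: seg_def l_def)
    have "(d z v)\<^sup>2 \<le> (d z s)\<^sup>2" using ob s nonneg by (auto simp: obtuse_def intro: power_mono)
    hence "l * (d z v)\<^sup>2 \<le> l * (d z s)\<^sup>2" using l by simp
    also have "\<dots> \<le> (l - t) * (d z v)\<^sup>2 + t * (d z w)\<^sup>2 - t * (l - t) * l"
      using stewart[OF X(2,3,1) s(1)] s(2) sw l_def by simp
    finally have "t * ((d z v)\<^sup>2 + l * l) \<le> t * ((d z w)\<^sup>2 + l * t)"
      by (simp add: algebra_simps)
    thus ?thesis using t by simp
  qed
  have "(d z v)\<^sup>2 + l * l \<le> (d z w)\<^sup>2"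
  proof (rule field_le_epsilon)
    fix e :: real assume "0 < e"
    define t where "t = min l (e / l)"
    have "0 < t" "t \<le> l" "l * t \<le> e" using l \<open>0 < e\<close>
      by (auto simp: t_def min_def field_simps)
    thus "(d z v)\<^sup>2 + l * l \<le> (d z w)\<^sup>2 + e" using step[of t] by linarith
  qed
  thus ?thesis by (simp add: l_def power2_eq_square)
qed

lemma obtuse_seg:
  assumes X: "z \<in> X" "v \<in> X" "w \<in> X" and ob: "obtuse z v w" and z': "z' \<in> seg z v"
  shows "obtuse z' v w"
  unfolding obtuse_def
proof
  fix s assume s: "s \<in> seg v w"
  have "d z s \<le> d z z' + d z' s" using X seg_in[OF s] seg_in[OF z'] by (simp add: triangle)
  moreover have "d z v \<le> d z s" using ob s by (simp add: obtuse_def)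
  moreover have "d z z' + d z' v = d z v" using z' by (simp add: seg_def)
  ultimately show "d z' v \<le> d z' s" by linarith
qed

lemma obtuse_mono:
  assumes "v \<in> X" "w \<in> X" "obtuse z v w" "w' \<in> seg v w"
  shows "obtuse z v w'"
  using assms seg_trans(1) unfolding obtuse_def by blast

lemma obtuse_commute:
  assumes X: "z \<in> X" "v \<in> X" "w \<in> X" and ob: "obtuse z v w"
  shows "obtuse w v z"
  unfolding obtuse_def
proof
  fix s assume s: "s \<in> seg v z"
  hence sX: "s \<in> X" by (rule seg_in)
  have "obtuse s v w" using obtuse_seg[OF X ob] s by (simp add: seg_commute)
  from pythagoras[OF sX X(2,3) this]
  have "(d v w)\<^sup>2 \<le> (d s w)\<^sup>2" by (smt (verit) zero_le_power2)
  thus "d w v \<le> d w s" using nonneg[of s w] power2_le_imp_le by (simp add: commute)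
qed

lemma obtuse_fan:
  assumes X: "z \<in> X" "v \<in> X" "w \<in> X" and ob: "obtuse z v w"
    and z': "z' \<in> seg v z" and w': "w' \<in> seg v w"
  shows "d v z' \<le> d z' w'" "d v w' \<le> d z' w'"
proof -
  have X': "z' \<in> X" "w' \<in> X" using z' w' seg_in by auto
  have "obtuse z' v w'" using obtuse_mono[OF X(2,3) obtuse_seg[OF X ob]] z' w' by (simp add: seg_commute)
  hence "(d z' v)\<^sup>2 + (d v w')\<^sup>2 \<le> (d z' w')\<^sup>2" using pythagoras X' X by blast
  hence "(d z' v)\<^sup>2 \<le> (d z' w')\<^sup>2" "(d v w')\<^sup>2 \<le> (d z' w')\<^sup>2"
    by (smt (verit) zero_le_power2)+
  thus "d v z' \<le> d z' w'" "d v w' \<le> d z' w'" using power2_le_imp_le nonneg by (auto simp: commute)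
qed

text \<open>One of the two angles at an interior point of a geodesic is at least \<open>\<pi>/2\<close>.
  Otherwise, by convexity, some point \<open>u\<close> of \<open>[p,a]\<close> near \<open>p\<close> would
  be closer than \<open>p\<close> both to \<open>x\<close> and to \<open>y\<close>, against the triangle
  inequality.\<close>

lemma straight_angle:
  assumes X: "x \<in> X" "y \<in> X" "a \<in> X" and p: "p \<in> seg x y"
  shows "obtuse x p a \<or> obtuse y p a"
proof (rule ccontr)
  assume "\<not> ?thesis"
  then obtain s t where st: "s \<in> seg p a" "d x s < d x p" "t \<in> seg p a" "d y t < d y p"
    by (auto simp: obtuse_def not_le)
  have pX: "p \<in> X" using p seg_in by auto
  have X': "s \<in> X" "t \<in> X" using st seg_in by auto
  obtain u where u: "u \<in> X" "u \<in> seg p s" "u \<in> seg p t" "u \<noteq> p"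
  proof (cases "d p s \<le> d p t")
    case True
    then show ?thesis using that[of s] seg_linear[OF pX X(3) st(1,3)] X' st ends_in_seg[OF pX] by auto
  next
    case False
    then show ?thesis using that[of t] seg_linear[OF pX X(3) st(3,1)] X' st ends_in_seg[OF pX] by auto
  qed
  have "d x u < d x p" "d y u < d y p"
    using strictly_closer[OF pX X'(1) X(1) u(2) u(4)] strictly_closer[OF pX X'(2) X(2) u(3) u(4)] st
    by (auto simp: commute)
  moreover have "d x y \<le> d x u + d u y" using X u triangle by blast
  ultimately show False using p by (simp add: seg_def commute)
qed

text \<open>Bound the diagonal \<open>[y,a]\<close> by the path through the midpoint of the other
  diagonal, whose distances to \<open>y\<close> and \<open>a\<close> are bounded by the median inequality.
  This is what makes projections 1-Lipschitz.\<close>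

lemma quadrilateral:
  assumes X: "a \<in> X" "b \<in> X" "x \<in> X" "y \<in> X"
  shows "(d x b)\<^sup>2 + (d y a)\<^sup>2 \<le> (d x a)\<^sup>2 + (d y b)\<^sup>2 + (d a b)\<^sup>2 + (d x y)\<^sup>2"
proof (cases "d x b = 0")
  case True
  hence "x = b" using X by simp
  have "d y a \<le> d y b + d b a" using X triangle by blast
  hence "(d y a)\<^sup>2 \<le> (d y b + d b a)\<^sup>2" using nonneg by (intro power_mono) auto
  also have "\<dots> \<le> 2 * (d y b)\<^sup>2 + 2 * (d b a)\<^sup>2" by (smt (verit) sum_squares_bound power2_sum)
  finally show ?thesis using \<open>x = b\<close> X by (simp add: commute)
next
  case False
  hence l: "0 < d x b" by (simp add: less_le)
  obtain m where m: "m \<in> seg x b" "d x m = d x b / 2" using seg_point[OF X(3,2), of "d x b / 2"] l by auto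
  have mb: "d m b = d x b / 2" using m by (simp add: seg_def)
  have med: "2 * (d p m)\<^sup>2 \<le> (d p x)\<^sup>2 + (d p b)\<^sup>2 - (d x b)\<^sup>2 / 2" if "p \<in> X" for p
  proof -
    have "d x b * (2 * (d p m)\<^sup>2) \<le> d x b * ((d p x)\<^sup>2 + (d p b)\<^sup>2 - (d x b)\<^sup>2 / 2)"
      using stewart[OF X(3,2) that m(1)] unfolding m(2) mb by (simp add: algebra_simps power2_eq_square)
    thus ?thesis using l by simp
  qed
  have "d y a \<le> d y m + d m a" using X m seg_in triangle by blast
  hence "(d y a)\<^sup>2 \<le> (d y m + d m a)\<^sup>2" using nonneg by (intro power_mono) auto
  also have "\<dots> \<le> 2 * (d y m)\<^sup>2 + 2 * (d a m)\<^sup>2" by (smt (verit) sum_squares_bound power2_sum commute)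
  finally show ?thesis using med[OF X(4)] med[OF X(1)] by (simp add: commute)
qed

section \<open>Curtains and their sides\<close>

text \<open>The parameter of the nearest point on the geodesic \<open>\<alpha>\<close>. A curtain dual to
  \<open>\<alpha>\<close> and its halfspaces are the preimages of intervals under this 1-Lipschitz
  function (\<open>dual_curtain_coord\<close>).\<close>

definition coord :: "real set \<Rightarrow> (real \<Rightarrow> 'a) \<Rightarrow> 'a \<Rightarrow> real" where
  "coord I \<alpha> x = (THE t. t \<in> I \<and> (\<forall>u\<in>I. d x (\<alpha> t) \<le> d x (\<alpha> u)))"

lemma nearest_pythagoras:
  assumes \<alpha>: "geodesic X d I \<alpha>" and t: "t \<in> I" "\<forall>u\<in>I. d x (\<alpha> t) \<le> d x (\<alpha> u)"
    and u: "u \<in> I" and x: "x \<in> X"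
  shows "(d x (\<alpha> t))\<^sup>2 + (t - u)\<^sup>2 \<le> (d x (\<alpha> u))\<^sup>2"
proof -
  have "seg (\<alpha> t) (\<alpha> u) \<subseteq> \<alpha> ` I"
  proof (cases "t \<le> u")
    case True
    thus ?thesis using seg_geodesic[OF \<alpha> t(1) u] geodesic_interval[OF \<alpha> t(1) u] by auto
  next
    case False
    thus ?thesis using seg_geodesic[OF \<alpha> u t(1)] geodesic_interval[OF \<alpha> u t(1)] by (auto simp: seg_commute)
  qed
  hence "obtuse x (\<alpha> t) (\<alpha> u)" using t(2) by (auto simp: obtuse_def)
  from pythagoras[OF x _ _ this] show ?thesis
    using geodesic_in[OF \<alpha>] geodesic_dist[OF \<alpha> t(1) u] t u by simp
qed

lemma nearest_exists:
  assumes \<alpha>: "geodesic X d I \<alpha>" and ne: "I \<noteq> {}" and x: "x \<in> X"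
  shows "\<exists>t\<in>I. \<forall>u\<in>I. d x (\<alpha> t) \<le> d x (\<alpha> u)"
proof -
  obtain t0 where t0: "t0 \<in> I" using ne by auto
  \<comment> \<open>Points of \<open>\<alpha>\<close> at distance more than \<open>R\<close> from \<open>\<alpha> t0\<close> are farther from \<open>x\<close> than \<open>\<alpha> t0\<close> is.\<close>
  define R where "R = 2 * d x (\<alpha> t0)"
  define S where "S = I \<inter> cball t0 R"
  have "compact S" unfolding S_def using \<alpha> by (auto simp: geodesic_def intro: closed_Int_compact)
  moreover have "S \<noteq> {}" using t0 by (auto simp: S_def R_def)
  moreover have "continuous_on S (\<lambda>t. d x (\<alpha> t))"
  proof (rule continuous_on_iff[THEN iffD2], intro ballI allI impI)
    fix s and e :: real assume s: "s \<in> S" "0 < e"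
    have "dist (d x (\<alpha> s')) (d x (\<alpha> s)) < e" if "s' \<in> S" "dist s' s < e" for s'
    proof -
      have I: "s \<in> I" "s' \<in> I" using s that by (auto simp: S_def)
      have "d x (\<alpha> s) \<le> d x (\<alpha> s') + d (\<alpha> s') (\<alpha> s)" "d x (\<alpha> s') \<le> d x (\<alpha> s) + d (\<alpha> s) (\<alpha> s')"
        using geodesic_in[OF \<alpha>] I x triangle by blast+
      thus ?thesis using geodesic_dist[OF \<alpha>] I that(2) by (auto simp: dist_real_def)
    qed
    thus "\<exists>k>0. \<forall>s'\<in>S. dist s' s < k \<longrightarrow> dist (d x (\<alpha> s')) (d x (\<alpha> s)) < e" using s by blast
  qed
  ultimately obtain t where t: "t \<in> S" "\<forall>u\<in>S. d x (\<alpha> t) \<le> d x (\<alpha> u)"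
    using continuous_attains_inf by blast
  have t0S: "t0 \<in> S" using t0 by (auto simp: S_def R_def)
  have "d x (\<alpha> t) \<le> d x (\<alpha> u)" if u: "u \<in> I" for u
  proof (cases "u \<in> S")
    case False
    hence "R < \<bar>t0 - u\<bar>" using u by (auto simp: S_def dist_real_def)
    also have "\<dots> = d (\<alpha> t0) (\<alpha> u)" using geodesic_dist[OF \<alpha> t0 u] by simp
    also have "\<dots> \<le> d (\<alpha> t0) x + d x (\<alpha> u)" using geodesic_in[OF \<alpha>] t0 u x triangle by blast
    finally show ?thesis using t(2) t0S by (auto simp: R_def commute)
  qed (use t in auto)
  thus ?thesis using t by (auto simp: S_def)
qed

lemma coord_eqI:
  assumes \<alpha>: "geodesic X d I \<alpha>" and t: "t \<in> I" "\<And>u. u \<in> I \<Longrightarrow> d x (\<alpha> t) \<le> d x (\<alpha> u)" and x: "x \<in> X"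
  shows "coord I \<alpha> x = t"
  unfolding coord_def
proof (rule the_equality)
  fix s assume s: "s \<in> I \<and> (\<forall>u\<in>I. d x (\<alpha> s) \<le> d x (\<alpha> u))"
  hence "d x (\<alpha> s) = d x (\<alpha> t)" using t by (auto intro: antisym)
  moreover have "(d x (\<alpha> t))\<^sup>2 + (t - s)\<^sup>2 \<le> (d x (\<alpha> s))\<^sup>2"
    using nearest_pythagoras[OF \<alpha> t(1) _ _ x] t s by blast
  ultimately show "s = t" by simp
qed (use t in auto)

lemma coord_nearest:
  assumes "geodesic X d I \<alpha>" "I \<noteq> {}" "x \<in> X"
  shows "coord I \<alpha> x \<in> I" "u \<in> I \<Longrightarrow> d x (\<alpha> (coord I \<alpha> x)) \<le> d x (\<alpha> u)"
proof -
  obtain t where t: "t \<in> I" "\<forall>u\<in>I. d x (\<alpha> t) \<le> d x (\<alpha> u)" using nearest_exists[OF assms] by blast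
  hence "coord I \<alpha> x = t" using coord_eqI[OF assms(1)] assms(3) by blast
  thus "coord I \<alpha> x \<in> I" "u \<in> I \<Longrightarrow> d x (\<alpha> (coord I \<alpha> x)) \<le> d x (\<alpha> u)" using t by auto
qed

lemma coord_geodesic:
  assumes "geodesic X d I \<alpha>" "t \<in> I" shows "coord I \<alpha> (\<alpha> t) = t"
  using coord_eqI[OF assms] geodesic_in[OF assms] by simp

lemma coord_seg:
  assumes \<alpha>: "geodesic X d I \<alpha>" "I \<noteq> {}" and x: "x \<in> X" and q: "q \<in> seg x (\<alpha> (coord I \<alpha> x))"
  shows "coord I \<alpha> q = coord I \<alpha> x"
proof (rule coord_eqI[OF \<alpha>(1) coord_nearest(1)[OF \<alpha> x]])
  show qX: "q \<in> X" using q seg_in by blast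
  fix u assume u: "u \<in> I"
  have "d x (\<alpha> u) \<le> d x q + d q (\<alpha> u)" using x qX geodesic_in[OF \<alpha>(1) u] triangle by blast
  moreover have "d x q + d q (\<alpha> (coord I \<alpha> x)) = d x (\<alpha> (coord I \<alpha> x))" using q by (simp add: seg_def)
  ultimately show "d q (\<alpha> (coord I \<alpha> x)) \<le> d q (\<alpha> u)"
    using coord_nearest(2)[OF \<alpha> x u] by linarith
qed

text \<open>In the quadrilateral formed by two points and their projections,
  \<open>nearest_pythagoras\<close> bounds both diagonals from below and \<open>quadrilateral\<close>
  bounds them from above.\<close>

lemma coord_lipschitz:
  assumes \<alpha>: "geodesic X d I \<alpha>" "I \<noteq> {}" and X: "x \<in> X" "y \<in> X"
  shows "\<bar>coord I \<alpha> x - coord I \<alpha> y\<bar> \<le> d x y"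
proof -
  let ?s = "coord I \<alpha> x" and ?t = "coord I \<alpha> y"
  have st: "?s \<in> I" "?t \<in> I" using coord_nearest[OF \<alpha>] X by auto
  hence ab: "\<alpha> ?s \<in> X" "\<alpha> ?t \<in> X" "d (\<alpha> ?s) (\<alpha> ?t) = \<bar>?s - ?t\<bar>"
    using geodesic_in[OF \<alpha>(1)] geodesic_dist[OF \<alpha>(1)] by auto
  have "(d x (\<alpha> ?s))\<^sup>2 + (?s - ?t)\<^sup>2 \<le> (d x (\<alpha> ?t))\<^sup>2"
    using nearest_pythagoras[OF \<alpha>(1) st(1) _ st(2) X(1)] coord_nearest(2)[OF \<alpha> X(1)] by blast
  moreover have "(d y (\<alpha> ?t))\<^sup>2 + (?t - ?s)\<^sup>2 \<le> (d y (\<alpha> ?s))\<^sup>2"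
    using nearest_pythagoras[OF \<alpha>(1) st(2) _ st(1) X(2)] coord_nearest(2)[OF \<alpha> X(2)] by blast
  moreover have "(d (\<alpha> ?s) (\<alpha> ?t))\<^sup>2 = (?s - ?t)\<^sup>2" "(?t - ?s)\<^sup>2 = (?s - ?t)\<^sup>2"
    using ab by (simp_all add: power2_commute)
  ultimately have "\<bar>?s - ?t\<bar>\<^sup>2 \<le> (d x y)\<^sup>2"
    using quadrilateral[OF ab(1,2) X] by simp
  thus ?thesis using power2_le_imp_le nonneg by blast
qed

lemma coord_intermediate:
  assumes \<alpha>: "geodesic X d I \<alpha>" "I \<noteq> {}" and X: "x \<in> X" "y \<in> X"
    and v: "coord I \<alpha> x \<le> v" "v \<le> coord I \<alpha> y"
  obtains q where "q \<in> seg x y" "coord I \<alpha> q = v"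
proof -
  obtain \<gamma> where \<gamma>: "geodesic X d {0..d x y} \<gamma>" "\<gamma> 0 = x" "\<gamma> (d x y) = y" "seg x y = \<gamma> ` {0..d x y}"
    "\<And>t. t \<in> {0..d x y} \<Longrightarrow> d x (\<gamma> t) = t \<and> d (\<gamma> t) y = d x y - t"
    using seg_param[OF X] by metis
  have "continuous_on {0..d x y} (\<lambda>t. coord I \<alpha> (\<gamma> t))"
  proof (rule continuous_on_iff[THEN iffD2], intro ballI allI impI)
    fix s and e :: real assume s: "s \<in> {0..d x y}" "0 < e"
    have "dist (coord I \<alpha> (\<gamma> s')) (coord I \<alpha> (\<gamma> s)) < e" if "s' \<in> {0..d x y}" "dist s' s < e" for s'
      using coord_lipschitz[OF \<alpha> geodesic_in[OF \<gamma>(1) that(1)] geodesic_in[OF \<gamma>(1) s(1)]]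
        geodesic_dist[OF \<gamma>(1) that(1) s(1)] that(2) unfolding dist_real_def by linarith
    thus "\<exists>k>0. \<forall>s'\<in>{0..d x y}. dist s' s < k \<longrightarrow> dist (coord I \<alpha> (\<gamma> s')) (coord I \<alpha> (\<gamma> s)) < e"
      using s by blast
  qed
  from IVT'[of "\<lambda>t. coord I \<alpha> (\<gamma> t)" 0 v "d x y", OF _ _ _ this]
  obtain t where "0 \<le> t" "t \<le> d x y" "coord I \<alpha> (\<gamma> t) = v" using v \<gamma>(2,3) by auto
  thus thesis using that[of "\<gamma> t"] \<gamma>(4) by auto
qed

lemma projection_eq:
  assumes \<alpha>: "geodesic X d I \<alpha>" "I \<noteq> {}" and x: "x \<in> X"
  shows "geodesic_projection d I \<alpha> x = \<alpha> (coord I \<alpha> x)"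
  unfolding geodesic_projection_def
proof (rule the_equality)
  show "\<alpha> (coord I \<alpha> x) \<in> \<alpha> ` I \<and> (\<forall>q\<in>\<alpha> ` I. d x (\<alpha> (coord I \<alpha> x)) \<le> d x q)"
    using coord_nearest[OF \<alpha> x] by auto
  fix p assume "p \<in> \<alpha> ` I \<and> (\<forall>q\<in>\<alpha> ` I. d x p \<le> d x q)"
  then obtain t where t: "t \<in> I" "p = \<alpha> t" "\<And>u. u \<in> I \<Longrightarrow> d x (\<alpha> t) \<le> d x (\<alpha> u)" by auto
  thus "p = \<alpha> (coord I \<alpha> x)" using coord_eqI[OF \<alpha>(1) t(1,3) x] by simp
qed

lemma projection_preimage_eq:
  assumes \<alpha>: "geodesic X d I \<alpha>" "I \<noteq> {}" and J: "J \<subseteq> I"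
  shows "projection_preimage X d I \<alpha> J = {x \<in> X. coord I \<alpha> x \<in> J}"
proof -
  have "coord I \<alpha> x \<in> J" if "x \<in> X" "\<alpha> (coord I \<alpha> x) = \<alpha> s" "s \<in> J" for x s
    using that coord_geodesic[OF \<alpha>(1)] coord_nearest(1)[OF \<alpha>] J by (metis subsetD)
  thus ?thesis unfolding projection_preimage_def using projection_eq[OF \<alpha>] by auto
qed

lemma dual_curtain_coord:
  assumes "is_dual_curtain X d I \<alpha> r h"
  shows "geodesic X d I \<alpha>" "I \<noteq> {}"
    "h = {x \<in> X. r - 1/2 \<le> coord I \<alpha> x \<and> coord I \<alpha> x \<le> r + 1/2}"
    "neg_halfspace X d I \<alpha> r = {x \<in> X. coord I \<alpha> x < r - 1/2}"
    "pos_halfspace X d I \<alpha> r = {x \<in> X. r + 1/2 < coord I \<alpha> x}"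
    "{r - 1/2..r + 1/2} \<subseteq> I"
proof -
  show \<alpha>: "geodesic X d I \<alpha>" using assms by (simp add: is_dual_curtain_def)
  show sub: "{r - 1/2..r + 1/2} \<subseteq> I" using assms interior_subset by (auto simp: is_dual_curtain_def)
  have "r \<in> I" using sub by auto
  thus ne: "I \<noteq> {}" by auto
  show "h = {x \<in> X. r - 1/2 \<le> coord I \<alpha> x \<and> coord I \<alpha> x \<le> r + 1/2}"
    using assms projection_preimage_eq[OF \<alpha> ne sub] by (auto simp: is_dual_curtain_def dual_curtain_def)
  show "neg_halfspace X d I \<alpha> r = {x \<in> X. coord I \<alpha> x < r - 1/2}"
    using projection_preimage_eq[OF \<alpha> ne] coord_nearest(1)[OF \<alpha> ne] by (auto simp: neg_halfspace_def)
  show "pos_halfspace X d I \<alpha> r = {x \<in> X. r + 1/2 < coord I \<alpha> x}"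
    using projection_preimage_eq[OF \<alpha> ne] coord_nearest(1)[OF \<alpha> ne] by (auto simp: pos_halfspace_def)
qed

text \<open>Preimages of intervals under \<open>coord\<close> are connected: from \<open>x\<close> one can
  go to its projection along a segment on which \<open>coord\<close> is constant, then along
  \<open>\<beta>\<close>, and from there to \<open>y\<close>. If the endpoints are on different sides of
  \<open>h\<close>, this path meets \<open>h\<close>. Applied to halfspaces this gives their independence
  of the dual geodesic, applied to curtains it gives their connectedness.\<close>

lemma coord_level_connected:
  assumes \<beta>: "geodesic X d J \<beta>" "J \<noteq> {}" and h: "is_dual_curtain X d I \<alpha> r h"
    and x: "x \<in> neg_halfspace X d I \<alpha> r" and y: "y \<in> pos_halfspace X d I \<alpha> r"
  obtains q where "q \<in> h" "min (coord J \<beta> x) (coord J \<beta> y) \<le> coord J \<beta> q"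
    "coord J \<beta> q \<le> max (coord J \<beta> x) (coord J \<beta> y)"
proof -
  note h' = dual_curtain_coord[OF h]
  have X: "x \<in> X" "y \<in> X" and fx: "coord I \<alpha> x < r - 1/2" and fy: "r + 1/2 < coord I \<alpha> y"
    using x y h' by auto
  define a where "a = \<beta> (coord J \<beta> x)"
  define b where "b = \<beta> (coord J \<beta> y)"
  have J: "coord J \<beta> x \<in> J" "coord J \<beta> y \<in> J" using coord_nearest[OF \<beta>] X by auto
  have ab: "a \<in> X" "b \<in> X" using geodesic_in[OF \<beta>(1)] J by (auto simp: a_def b_def)
  have cross: "\<exists>q\<in>seg u v. q \<in> h"
    if uv: "u \<in> X" "v \<in> X" "coord I \<alpha> u < r - 1/2" "\<not> coord I \<alpha> v < r - 1/2" for u v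
  proof -
    obtain q where "q \<in> seg u v" "coord I \<alpha> q = r - 1/2"
      using coord_intermediate[OF h'(1,2) uv(1,2), of "r - 1/2"] uv by auto
    thus ?thesis using seg_in h'(3) by auto
  qed
  consider q where "q \<in> seg x a" "q \<in> h" | q where "q \<in> seg a b" "q \<in> h" | q where "q \<in> seg b y" "q \<in> h"
    using cross[of x a] cross[of a b] cross[of b y] X ab fx fy by fastforce
  thus thesis
  proof cases
    case 1
    hence "coord J \<beta> q = coord J \<beta> x" using coord_seg[OF \<beta> X(1)] by (simp add: a_def)
    thus thesis using that[of q] 1 by simp
  next
    case 2
    have "\<exists>t. min (coord J \<beta> x) (coord J \<beta> y) \<le> t \<and> t \<le> max (coord J \<beta> x) (coord J \<beta> y) \<and> t \<in> J \<and> q = \<beta> t"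
    proof (cases "coord J \<beta> x \<le> coord J \<beta> y")
      case True
      thus ?thesis using seg_geodesic[OF \<beta>(1) J] geodesic_interval[OF \<beta>(1) J] 2(1)
        by (auto simp: a_def b_def)
    next
      case False
      thus ?thesis using seg_geodesic[OF \<beta>(1) J(2,1)] geodesic_interval[OF \<beta>(1) J(2,1)] 2(1)
        by (auto simp: a_def b_def seg_commute)
    qed
    thus thesis using that[of q] 2 coord_geodesic[OF \<beta>(1)] by auto
  next
    case 3
    hence "coord J \<beta> q = coord J \<beta> y" using coord_seg[OF \<beta> X(2)] by (simp add: b_def seg_commute)
    thus thesis using that[of q] 3 by simp
  qed
qed

abbreviation sep :: "'a set \<Rightarrow> 'a \<Rightarrow> 'a \<Rightarrow> bool" where
  "sep h x y \<equiv> separates X d h {x} {y}"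

text \<open>The component of \<open>X - h\<close> that contains \<open>x\<close>, for \<open>x\<close>
  outside the curtain \<open>h\<close>. Unlike the two halfspaces it does not refer to a dual geodesic or
  its orientation.\<close>

definition side :: "'a set \<Rightarrow> 'a \<Rightarrow> 'a set" where
  "side h x = {z \<in> X. z \<notin> h \<and> \<not> sep h x z}"

lemma separates_commute: "separates X d h A B \<longleftrightarrow> separates X d h B A"
  unfolding separates_def by blast

text \<open>Halfspaces are connected, so a halfspace of one description of \<open>h\<close> cannot contain
  points of both halfspaces of another description.\<close>

lemma halfspaces_unique:
  assumes h: "is_dual_curtain X d I \<alpha> r h" and h': "is_dual_curtain X d J \<beta> s h"
    and x: "x \<in> neg_halfspace X d I \<alpha> r" and y: "y \<in> pos_halfspace X d I \<alpha> r"
  shows "x \<in> neg_halfspace X d J \<beta> s \<longleftrightarrow> y \<in> pos_halfspace X d J \<beta> s"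
    "x \<in> pos_halfspace X d J \<beta> s \<longleftrightarrow> y \<in> neg_halfspace X d J \<beta> s"
proof -
  note c = dual_curtain_coord[OF h] and c' = dual_curtain_coord[OF h']
  have "\<not> (coord J \<beta> x < s - 1/2 \<and> coord J \<beta> y < s - 1/2)"
    "\<not> (s + 1/2 < coord J \<beta> x \<and> s + 1/2 < coord J \<beta> y)"
    using coord_level_connected[OF c'(1,2) h x y] c'(3) by (fastforce simp: min_def max_def split: if_splits)+
  moreover have "x \<notin> h" "y \<notin> h" "x \<in> X" "y \<in> X" using x y c by auto
  ultimately show "x \<in> neg_halfspace X d J \<beta> s \<longleftrightarrow> y \<in> pos_halfspace X d J \<beta> s"
    "x \<in> pos_halfspace X d J \<beta> s \<longleftrightarrow> y \<in> neg_halfspace X d J \<beta> s"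
    using c'(3) unfolding c'(4,5) by auto
qed

lemma sep_iff:
  assumes h: "is_dual_curtain X d I \<alpha> r h"
  shows "sep h x y \<longleftrightarrow> x \<in> neg_halfspace X d I \<alpha> r \<and> y \<in> pos_halfspace X d I \<alpha> r
    \<or> x \<in> pos_halfspace X d I \<alpha> r \<and> y \<in> neg_halfspace X d I \<alpha> r"
proof
  assume "sep h x y"
  then obtain J \<beta> s where J: "is_dual_curtain X d J \<beta> s h"
    "x \<in> neg_halfspace X d J \<beta> s \<and> y \<in> pos_halfspace X d J \<beta> s \<or>
     y \<in> neg_halfspace X d J \<beta> s \<and> x \<in> pos_halfspace X d J \<beta> s"
    unfolding separates_def by auto
  note c = dual_curtain_coord[OF h] and c' = dual_curtain_coord[OF J(1)]
  have "x \<in> X - h" "y \<in> X - h" using J(2) c'(3-5) by auto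
  hence "x \<in> neg_halfspace X d I \<alpha> r \<or> x \<in> pos_halfspace X d I \<alpha> r"
    "y \<in> neg_halfspace X d I \<alpha> r \<or> y \<in> pos_halfspace X d I \<alpha> r"
    using c(3-5) by auto
  thus "x \<in> neg_halfspace X d I \<alpha> r \<and> y \<in> pos_halfspace X d I \<alpha> r
    \<or> x \<in> pos_halfspace X d I \<alpha> r \<and> y \<in> neg_halfspace X d I \<alpha> r"
    using J(2) halfspaces_unique[OF J(1) h] by blast
qed (use h in \<open>auto simp: separates_def\<close>)

lemma side_halfspace:
  assumes h: "is_dual_curtain X d I \<alpha> r h"
  shows "x \<in> neg_halfspace X d I \<alpha> r \<Longrightarrow> side h x = neg_halfspace X d I \<alpha> r"
    "x \<in> pos_halfspace X d I \<alpha> r \<Longrightarrow> side h x = pos_halfspace X d I \<alpha> r"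
  unfolding side_def sep_iff[OF h] using dual_curtain_coord(3)[OF h]
  unfolding dual_curtain_coord(4,5)[OF h] by auto

text \<open>Separation is defined with an existential description of \<open>h\<close>; up to exchanging
  the halfspaces the sides of the two points are those of that description.\<close>

lemma sepE:
  assumes "sep h x y"
  obtains I \<alpha> r where "is_dual_curtain X d I \<alpha> r h" "x \<in> neg_halfspace X d I \<alpha> r" "y \<in> pos_halfspace X d I \<alpha> r"
    "side h x = neg_halfspace X d I \<alpha> r" "side h y = pos_halfspace X d I \<alpha> r"
  | I \<alpha> r where "is_dual_curtain X d I \<alpha> r h" "x \<in> pos_halfspace X d I \<alpha> r" "y \<in> neg_halfspace X d I \<alpha> r"
    "side h x = pos_halfspace X d I \<alpha> r" "side h y = neg_halfspace X d I \<alpha> r"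
proof -
  obtain I \<alpha> r where h: "is_dual_curtain X d I \<alpha> r h" using assms by (auto simp: separates_def)
  show thesis
    using assms[unfolded sep_iff[OF h]] side_halfspace[OF h] that[OF h] by blast
qed

lemma sep_curtain: "sep h x y \<Longrightarrow> curtain X d h"
  by (auto simp: separates_def curtain_def)

lemma sep_commute: "sep h x y \<longleftrightarrow> sep h y x" by (rule separates_commute)

lemma sep_sides:
  assumes "sep h x y"
  shows "x \<in> X" "y \<in> X" "x \<in> side h x" "y \<in> side h y" "side h x \<inter> side h y = {}"
    "X = side h x \<union> h \<union> side h y" "side h x \<inter> h = {}" "side h y \<inter> h = {}"
proof -
  have "x \<in> X \<and> y \<in> X \<and> x \<in> side h x \<and> y \<in> side h y \<and> side h x \<inter> side h y = {} \<and>
    X = side h x \<union> h \<union> side h y \<and> side h x \<inter> h = {} \<and> side h y \<inter> h = {}"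
    using assms
  proof (cases rule: sepE)
    case (1 I \<alpha> r)
    have hx: "z \<in> h \<longleftrightarrow> z \<in> X \<and> r - 1/2 \<le> coord I \<alpha> z \<and> coord I \<alpha> z \<le> r + 1/2" for z
      using dual_curtain_coord(3)[OF 1(1)] by blast
    show ?thesis using 1(2,3) unfolding 1(4,5) dual_curtain_coord(4,5)[OF 1(1)]
      by (auto simp: hx set_eq_iff)
  next
    case (2 I \<alpha> r)
    have hx: "z \<in> h \<longleftrightarrow> z \<in> X \<and> r - 1/2 \<le> coord I \<alpha> z \<and> coord I \<alpha> z \<le> r + 1/2" for z
      using dual_curtain_coord(3)[OF 2(1)] by blast
    show ?thesis using 2(2,3) unfolding 2(4,5) dual_curtain_coord(4,5)[OF 2(1)]
      by (auto simp: hx set_eq_iff)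
  qed
  thus "x \<in> X" "y \<in> X" "x \<in> side h x" "y \<in> side h y" "side h x \<inter> side h y = {}"
    "X = side h x \<union> h \<union> side h y" "side h x \<inter> h = {}" "side h y \<inter> h = {}" by blast+
qed

lemma side_subset: "side h x \<subseteq> X" by (auto simp: side_def)

lemma sep_transfer:
  assumes "sep h x y" "z \<in> side h x" "w \<in> side h y"
  shows "sep h z w" "side h z = side h x" "side h w = side h y"
proof -
  have "sep h z w \<and> side h z = side h x \<and> side h w = side h y"
    using assms(1)
  proof (cases rule: sepE)
    case (1 I \<alpha> r)
    thus ?thesis using assms(2,3) side_halfspace[OF 1(1)] sep_iff[OF 1(1)] by auto
  next
    case (2 I \<alpha> r)
    thus ?thesis using assms(2,3) side_halfspace[OF 2(1)] sep_iff[OF 2(1)] by auto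
  qed
  thus "sep h z w" "side h z = side h x" "side h w = side h y" by auto
qed

lemma separates_sides:
  assumes "sep h x y" "A \<subseteq> side h x" "B \<subseteq> side h y"
  shows "separates X d h A B"
  using assms(1)
proof (cases rule: sepE)
  case (1 I \<alpha> r)
  thus ?thesis using assms(2,3) unfolding separates_def by metis
next
  case (2 I \<alpha> r)
  thus ?thesis using assms(2,3) unfolding separates_def by metis
qed

lemma curtain_connected:
  assumes k: "curtain X d k" and s: "sep h x y" and "k \<inter> side h x \<noteq> {}" "k \<inter> side h y \<noteq> {}"
  shows "k \<inter> h \<noteq> {}"
proof -
  obtain J \<beta> s where J: "is_dual_curtain X d J \<beta> s k" using k by (auto simp: curtain_def)
  note c = dual_curtain_coord[OF J]
  obtain u v where uv: "u \<in> k" "u \<in> side h x" "v \<in> k" "v \<in> side h y" using assms by blast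
  have "\<exists>q\<in>h. min (coord J \<beta> u) (coord J \<beta> v) \<le> coord J \<beta> q \<and> coord J \<beta> q \<le> max (coord J \<beta> u) (coord J \<beta> v)"
    using s
  proof (cases rule: sepE)
    case (1 I \<alpha> r)
    thus ?thesis using coord_level_connected[OF c(1,2) 1(1), of u v] uv by metis
  next
    case (2 I \<alpha> r)
    thus ?thesis using coord_level_connected[OF c(1,2) 2(1), of v u] uv by (metis min.commute max.commute)
  qed
  then obtain q where "q \<in> h" "s - 1/2 \<le> coord J \<beta> q" "coord J \<beta> q \<le> s + 1/2"
    using uv c(3) by (auto simp: min_def max_def split: if_splits)
  moreover have "h \<subseteq> X" using sep_sides(6)[OF s] by auto
  ultimately show ?thesis using c(3) by auto
qed

text \<open>A geodesic spends at least unit time inside a curtain that it crosses, so it is there at some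
  integer time. This turns the count of disjoint curtains between two points into a count of
  integers.\<close>

lemma sep_crossing:
  assumes s: "sep h x y"
  obtains q and n :: nat where "q \<in> seg x y" "q \<in> h" "d x q = real n"
proof -
  obtain I \<alpha> r where h: "is_dual_curtain X d I \<alpha> r h" using s by (auto simp: separates_def)
  note c = dual_curtain_coord[OF h]
  have X: "x \<in> X" "y \<in> X" using sep_sides[OF s] by auto
  have "\<exists>m\<in>seg x y. coord I \<alpha> m = r \<and> 1/2 < \<bar>coord I \<alpha> x - r\<bar> \<and> 1/2 < \<bar>coord I \<alpha> y - r\<bar>"
  proof -
    consider "coord I \<alpha> x < r - 1/2" "r + 1/2 < coord I \<alpha> y" | "coord I \<alpha> y < r - 1/2" "r + 1/2 < coord I \<alpha> x"
      using s sep_iff[OF h] c(4,5) by auto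
    thus ?thesis
    proof cases
      case 1
      then obtain m where "m \<in> seg x y" "coord I \<alpha> m = r"
        using coord_intermediate[OF c(1,2) X, of r] by auto
      thus ?thesis using 1 by auto
    next
      case 2
      then obtain m where "m \<in> seg y x" "coord I \<alpha> m = r"
        using coord_intermediate[OF c(1,2) X(2,1), of r] by auto
      thus ?thesis using 2 by (auto simp: seg_commute)
    qed
  qed
  then obtain m where m: "m \<in> seg x y" "coord I \<alpha> m = r" "1/2 < \<bar>coord I \<alpha> x - r\<bar>" "1/2 < \<bar>coord I \<alpha> y - r\<bar>"
    by blast
  have mX: "m \<in> X" using m seg_in by auto
  have xm: "1/2 < d x m" and my: "1/2 < d m y"
    using coord_lipschitz[OF c(1,2) X(1) mX] coord_lipschitz[OF c(1,2) mX X(2)] m by linarith+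
  \<comment> \<open>The curtain contains every point of the segment within distance 1/2 of \<open>m\<close>, and some integer time is that
    close to the time of \<open>m\<close>.\<close>
  obtain \<gamma> where \<gamma>: "geodesic X d {0..d x y} \<gamma>" "\<gamma> 0 = x" "\<gamma> (d x y) = y" "seg x y = \<gamma> ` {0..d x y}"
    "\<And>t. t \<in> {0..d x y} \<Longrightarrow> d x (\<gamma> t) = t \<and> d (\<gamma> t) y = d x y - t"
    using seg_param[OF X] by metis
  obtain t where t: "t \<in> {0..d x y}" "m = \<gamma> t" using m \<gamma>(4) by auto
  have "1/2 < t" "t < d x y - 1/2" using xm my \<gamma>(5)[OF t(1)] t by auto
  define n where "n = nat \<lfloor>t + 1/2\<rfloor>"
  have n: "real n \<le> t + 1/2" "t - 1/2 < real n" using \<open>1/2 < t\<close> unfolding n_def by linarith+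
  have nI: "real n \<in> {0..d x y}" using n \<open>t < d x y - 1/2\<close> by auto
  have "d (\<gamma> n) m \<le> 1/2" unfolding t(2) geodesic_dist[OF \<gamma>(1) nI t(1)] using n by linarith
  hence "\<bar>coord I \<alpha> (\<gamma> n) - r\<bar> \<le> 1/2"
    using coord_lipschitz[OF c(1,2) geodesic_in[OF \<gamma>(1) nI] mX] m by auto
  hence "\<gamma> n \<in> h" using c(3) geodesic_in[OF \<gamma>(1) nI] by (auto simp: abs_le_iff)
  thus thesis using that[of "\<gamma> n" n] \<gamma>(4,5) nI by auto
qed

section \<open>Families of disjoint curtains separating two points\<close>

lemma sep_crossing_coord:
  assumes h: "is_dual_curtain X d I \<alpha> r h" and k: "sep k u v"
  obtains q where "q \<in> k" "q \<in> X" "min (coord I \<alpha> u) (coord I \<alpha> v) \<le> coord I \<alpha> q"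
    "coord I \<alpha> q \<le> max (coord I \<alpha> u) (coord I \<alpha> v)"
proof -
  note c = dual_curtain_coord[OF h]
  have "k \<subseteq> X" using sep_sides(6)[OF k] by auto
  show thesis using k
  proof (cases rule: sepE)
    case (1 J \<beta> s)
    show thesis by (rule coord_level_connected[OF c(1,2) 1(1-3)]) (use that \<open>k \<subseteq> X\<close> in auto)
  next
    case (2 J \<beta> s)
    show thesis by (rule coord_level_connected[OF c(1,2) 2(1,3,2)])
        (use that \<open>k \<subseteq> X\<close> in \<open>auto simp: min.commute max.commute\<close>)
  qed
qed

text \<open>The union of a curtain with one of its halfspaces is again the preimage of an interval, hence
  connected.\<close>

lemma far_half_connected:
  assumes h: "sep h x y" and k: "sep k u v" and u: "u \<in> h \<union> side h y" and v: "v \<in> h \<union> side h y"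
  shows "k \<inter> (h \<union> side h y) \<noteq> {}"
  using h
proof (cases rule: sepE)
  case (1 I \<alpha> r)
  note c = dual_curtain_coord[OF 1(1)]
  obtain q where "q \<in> k" "q \<in> X" "min (coord I \<alpha> u) (coord I \<alpha> v) \<le> coord I \<alpha> q"
    using sep_crossing_coord[OF 1(1) k] by metis
  moreover have bnd: "r - 1/2 \<le> coord I \<alpha> w" if "w \<in> h \<union> side h y" for w
    using that c(3) unfolding 1(5) c(5) by auto
  ultimately have "r - 1/2 \<le> coord I \<alpha> q" using bnd[OF u] bnd[OF v] by linarith
  hence "q \<in> h \<union> side h y" using \<open>q \<in> X\<close> c(3) unfolding 1(5) c(5) by auto
  thus ?thesis using \<open>q \<in> k\<close> by auto
next
  case (2 I \<alpha> r)
  note c = dual_curtain_coord[OF 2(1)]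
  obtain q where "q \<in> k" "q \<in> X" "coord I \<alpha> q \<le> max (coord I \<alpha> u) (coord I \<alpha> v)"
    using sep_crossing_coord[OF 2(1) k] by metis
  moreover have bnd: "coord I \<alpha> w \<le> r + 1/2" if "w \<in> h \<union> side h y" for w
    using that c(3) unfolding 2(5) c(4) by auto
  ultimately have "coord I \<alpha> q \<le> r + 1/2" using bnd[OF u] bnd[OF v] by linarith
  hence "q \<in> h \<union> side h y" using \<open>q \<in> X\<close> c(3) unfolding 2(5) c(4) by auto
  thus ?thesis using \<open>q \<in> k\<close> by auto
qed

lemma curtain_on_side:
  assumes "curtain X d k" "sep h x y" "k \<inter> h = {}" "k \<subseteq> X"
  shows "k \<subseteq> side h x \<or> k \<subseteq> side h y"
  using curtain_connected[OF assms(1,2)] sep_sides(6)[OF assms(2)] assms(3,4) by blast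

lemma curtain_nonempty_subset:
  assumes "curtain X d h" shows "h \<noteq> {}" "h \<subseteq> X"
proof -
  obtain I \<alpha> r where h: "is_dual_curtain X d I \<alpha> r h" using assms by (auto simp: curtain_def)
  note c = dual_curtain_coord[OF h]
  have "r \<in> I" using c(6) by auto
  hence "\<alpha> r \<in> h" using c(3) geodesic_in[OF c(1)] coord_geodesic[OF c(1)] by auto
  thus "h \<noteq> {}" by auto
  show "h \<subseteq> X" using c(3) by auto
qed

text \<open>On the way from \<open>x\<close> to \<open>y\<close>, the curtain \<open>h\<close> comes
  before \<open>k\<close>.\<close>

definition precedes :: "'a \<Rightarrow> 'a \<Rightarrow> 'a set \<Rightarrow> 'a set \<Rightarrow> bool" where
  "precedes x y h k \<longleftrightarrow> h \<subseteq> side k x \<and> k \<subseteq> side h y"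

text \<open>Each of the two curtains is connected and so lies on one side of the other. The two
  arrangements to exclude are those in which both curtains lie on the \<open>x\<close>-side, or both on
  the \<open>y\<close>-side, of each other. In the first of them, the union of \<open>h\<close> with its
  \<open>y\<close>-side is a connected set that avoids \<open>k\<close> but has points on both sides of
  it.\<close>

lemma disjoint_curtains_nested:
  assumes h: "sep h x y" and k: "sep k x y" and disj: "h \<inter> k = {}"
  shows "precedes x y h k \<or> precedes x y k h"
proof -
  have hk: "h \<noteq> {}" "k \<noteq> {}" "h \<subseteq> X" "k \<subseteq> X"
    using curtain_nonempty_subset sep_curtain h k by auto
  have bad: False if hyps: "sep h x y" "sep k x y" "h \<subseteq> side k x" "k \<subseteq> side h x" "h \<noteq> {}" for h k x y
  proof -
    obtain u where u: "u \<in> h" using hyps(5) by auto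
    have "sep k u y" using sep_transfer(1)[OF hyps(2)] u hyps(3) sep_sides(4)[OF hyps(2)] by auto
    hence "k \<inter> (h \<union> side h y) \<noteq> {}"
      using far_half_connected[OF hyps(1)] u sep_sides(4)[OF hyps(1)] by blast
    thus False using hyps(4) sep_sides(5,7)[OF hyps(1)] by blast
  qed
  have "h \<subseteq> side k x \<or> h \<subseteq> side k y"
    using curtain_on_side[OF sep_curtain[OF h] k] disj hk by blast
  moreover have "k \<subseteq> side h x \<or> k \<subseteq> side h y"
    using curtain_on_side[OF sep_curtain[OF k] h] disj hk by blast
  moreover have "\<not> (h \<subseteq> side k x \<and> k \<subseteq> side h x)" using bad[OF h k] hk by blast
  moreover have "\<not> (h \<subseteq> side k y \<and> k \<subseteq> side h y)" using bad[of h y x k] h k hk by (metis sep_commute)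
  ultimately show ?thesis by (auto simp: precedes_def)
qed

definition wall_family :: "'a set set \<Rightarrow> 'a \<Rightarrow> 'a \<Rightarrow> bool" where
  "wall_family c x y \<longleftrightarrow> (\<forall>h\<in>c. sep h x y) \<and> pairwise disjnt c"

text \<open>The first integer time at which a geodesic from \<open>x\<close> to \<open>y\<close> is in
  \<open>h\<close>. Curtains are not convex, so a geodesic can return to \<open>h\<close> after meeting
  later curtains; only first times reflect the order of the curtains.\<close>

definition entry :: "'a \<Rightarrow> 'a \<Rightarrow> 'a set \<Rightarrow> nat" where
  "entry x y h = (LEAST n. \<exists>q\<in>seg x y. q \<in> h \<and> d x q = real n)"

lemma entry_attained:
  assumes "sep h x y"
  obtains q where "q \<in> seg x y" "q \<in> h" "d x q = real (entry x y h)"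
proof -
  have "\<exists>n. \<exists>q\<in>seg x y. q \<in> h \<and> d x q = real n" using sep_crossing[OF assms] by metis
  hence "\<exists>q\<in>seg x y. q \<in> h \<and> d x q = real (entry x y h)" unfolding entry_def by (rule LeastI_ex)
  thus thesis using that by blast
qed

lemma seg_eqI:
  assumes "x \<in> X" "y \<in> X" "p \<in> seg x y" "q \<in> seg x y" "d x p = d x q"
  shows "p = q"
proof -
  have "p \<in> seg x q" using seg_linear[OF assms(1-4)] assms(5) by simp
  hence "d p q = 0" using assms(5) by (simp add: seg_def)
  thus ?thesis using assms(3,4) seg_in by simp
qed

lemma precedes_entry:
  assumes h: "sep h x y" and k: "sep k x y" and hk: "precedes x y h k" "h \<inter> k = {}"
  shows "entry x y h < entry x y k"
proof -
  have X: "x \<in> X" "y \<in> X" using sep_sides[OF h] by auto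
  obtain q where q: "q \<in> seg x y" "q \<in> k" "d x q = real (entry x y k)" using entry_attained[OF k] .
  have "sep h x q" using sep_transfer(1)[OF h sep_sides(3)[OF h]] q hk by (auto simp: precedes_def)
  then obtain p n where p: "p \<in> seg x q" "p \<in> h" "d x p = real n" using sep_crossing by metis
  have pxy: "p \<in> seg x y" using seg_trans(1)[OF X q(1) p(1)] .
  have "p \<noteq> q" using p q hk(2) by auto
  hence "d x p < d x q" using seg_dist_le(1)[OF p(1)] seg_eqI[OF X pxy q(1)] by linarith
  hence "n < entry x y k" using p q by simp
  moreover have "entry x y h \<le> n" unfolding entry_def using pxy p by (auto intro: Least_le)
  ultimately show ?thesis by simp
qed

lemma wall_family_order:
  assumes c: "wall_family c x y" and h: "h \<in> c" and k: "k \<in> c" and hk: "h \<noteq> k"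
  shows "entry x y h < entry x y k \<and> precedes x y h k \<or> entry x y k < entry x y h \<and> precedes x y k h"
proof -
  have "sep h x y" "sep k x y" "h \<inter> k = {}" "k \<inter> h = {}"
    using c h k hk by (auto simp: wall_family_def pairwise_def disjnt_def)
  thus ?thesis using disjoint_curtains_nested precedes_entry by blast
qed

lemma wall_family_finite:
  assumes c: "wall_family c x y"
  shows "finite c" "real (card c) \<le> d x y + 1"
proof -
  have inj: "inj_on (entry x y) c"
    using wall_family_order[OF c] by (intro inj_onI) (metis less_irrefl)
  have sub: "entry x y ` c \<subseteq> {..nat \<lfloor>d x y\<rfloor>}"
  proof
    fix n assume "n \<in> entry x y ` c"
    then obtain h where h: "sep h x y" "n = entry x y h" using c by (auto simp: wall_family_def)
    obtain q where "q \<in> seg x y" "d x q = real n" using entry_attained[OF h(1)] h(2) by metis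
    hence "real n \<le> d x y" using seg_dist_le(1) by metis
    thus "n \<in> {..nat \<lfloor>d x y\<rfloor>}" by (simp add: le_nat_floor)
  qed
  show "finite c" using finite_imageD[OF finite_subset[OF sub] inj] by simp
  have "card c = card (entry x y ` c)" using card_image[OF inj] by simp
  also have "\<dots> \<le> card {..nat \<lfloor>d x y\<rfloor>}" using sub by (intro card_mono) auto
  finally have "card c \<le> nat \<lfloor>d x y\<rfloor> + 1" by simp
  thus "real (card c) \<le> d x y + 1" using nonneg[of x y] by linarith
qed

text \<open>Pairwise disjoint curtains that separate the same two points are linearly ordered, by their
  entry times.\<close>

lemma wall_family_enum:
  assumes c: "wall_family c x y"
  obtains h where "bij_betw h {..<card c} c" "\<And>i j. i < j \<Longrightarrow> j < card c \<Longrightarrow> precedes x y (h i) (h j)"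
proof -
  have inj: "inj_on (entry x y) c"
    using wall_family_order[OF c] by (intro inj_onI) (metis less_irrefl)
  define T where "T = entry x y ` c"
  have T: "finite T" "card T = card c" using wall_family_finite(1)[OF c] card_image[OF inj] by (auto simp: T_def)
  define l where "l = sorted_list_of_set T"
  have l: "set l = T" "length l = card c" "distinct l" "sorted_wrt (<) l"
    using T by (auto simp: l_def)
  have bl: "bij_betw ((!) l) {..<card c} T" using bij_betw_nth[OF l(3)] l by auto
  have bT: "bij_betw (inv_into c (entry x y)) T c"
    using inj by (auto simp: T_def intro!: bij_betw_inv_into bij_betw_imageI)
  define h where "h i = inv_into c (entry x y) (l ! i)" for i
  show thesis
  proof (rule that[of h])
    show b: "bij_betw h {..<card c} c"
      using bij_betw_trans[OF bl bT] by (simp add: h_def[abs_def] comp_def)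
    fix i j assume ij: "i < j" "j < card c"
    have hin: "h i \<in> c" "h j \<in> c" using b ij by (auto simp: bij_betw_def)
    have e: "entry x y (h k) = l ! k" if "k < card c" for k
    proof -
      have "l ! k \<in> T" using that l(1,2) nth_mem by metis
      thus ?thesis unfolding h_def T_def by (rule f_inv_into_f)
    qed
    have lt: "entry x y (h i) < entry x y (h j)"
      using e ij sorted_wrt_nth_less[OF l(4), of i j] l(2) by simp
    hence "h i \<noteq> h j" by auto
    from wall_family_order[OF c hin this] lt show "precedes x y (h i) (h j)" by auto
  qed
qed

text \<open>Hence the order in a chain need never be tracked: disjoint curtains separating two points
  automatically form a chain, and so does every subset of them.\<close>

lemma wall_family_chain:
  assumes c: "wall_family c x y"
  shows "curtain_chain X d c"
proof -
  obtain h where h: "bij_betw h {..<card c} c" "\<And>i j. i < j \<Longrightarrow> j < card c \<Longrightarrow> precedes x y (h i) (h j)"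
    using wall_family_enum[OF c] by blast
  define J where "J = {0..<int (card c)}"
  have "bij_betw nat J {..<card c}"
    unfolding J_def by (rule bij_betwI[where g = int]) auto
  hence b: "bij_betw (\<lambda>i. h (nat i)) J c" using bij_betw_trans[OF _ h(1)] by (simp add: comp_def)
  have "separates X d (h (nat i)) (h (nat (i - 1))) (h (nat (i + 1)))"
    if "i - 1 \<in> J \<and> i \<in> J \<and> i + 1 \<in> J" for i
  proof -
    have lt: "nat (i - 1) < nat i" "nat i < nat (i + 1)" "nat (i + 1) < card c" using that by (auto simp: J_def)
    have "h (nat i) \<in> c" using b that by (auto simp: bij_betw_def)
    hence s: "sep (h (nat i)) x y" using c by (simp add: wall_family_def)
    show ?thesis using separates_sides[OF s] h(2)[OF lt(1)] h(2)[OF lt(2,3)] lt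
      by (auto simp: precedes_def)
  qed
  moreover have "\<forall>i\<in>J. \<forall>k\<in>J. {i..k} \<subseteq> J" by (auto simp: J_def)
  moreover have "\<forall>h\<in>c. curtain X d h" using c sep_curtain by (auto simp: wall_family_def)
  ultimately show ?thesis unfolding curtain_chain_def using b by blast
qed

text \<open>The \<open>L\<close>-chains that separate \<open>x\<close> from \<open>y\<close>, described
  without an order (\<open>L_family_iff\<close>).\<close>

definition L_family :: "nat \<Rightarrow> 'a set set \<Rightarrow> 'a \<Rightarrow> 'a \<Rightarrow> bool" where
  "L_family L c x y \<longleftrightarrow> pairwise (L_separated X d L) c \<and> (\<forall>h\<in>c. sep h x y)"

lemma L_family_walls: "L_family L c x y \<Longrightarrow> wall_family c x y"
  by (auto simp: L_family_def wall_family_def pairwise_def L_separated_def disjnt_def)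

lemma L_family_iff: "L_family L c x y \<longleftrightarrow> L_chain X d L c \<and> chain_separates X d c {x} {y}"
  using wall_family_chain[OF L_family_walls] by (auto simp: L_family_def L_chain_def chain_separates_def)

lemma L_family_subset: "L_family L c x y \<Longrightarrow> c' \<subseteq> c \<Longrightarrow> L_family L c' x y"
  by (auto simp: L_family_def pairwise_def)

lemma L_family_card: "L_family L c x y \<Longrightarrow> finite c" "L_family L c x y \<Longrightarrow> real (card c) \<le> d x y + 1"
  using wall_family_finite L_family_walls by blast+

lemma L_separated_commute: "L_separated X d L h k \<longleftrightarrow> L_separated X d L k h"
  unfolding L_separated_def by (auto simp: Int_commute[of h])

lemma curtain_dist_alt:
  "curtain_dist X d L x y = (if x = y then 0 else 1 + Max {card c | c. L_family L c x y})"
  by (simp add: curtain_dist_def L_family_iff)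

lemma L_family_cards: "finite {card c | c. L_family L c x y}" "{card c | c. L_family L c x y} \<noteq> {}"
proof -
  have "n \<le> nat \<lfloor>d x y + 1\<rfloor>" if n: "n \<in> {card c | c. L_family L c x y}" for n
  proof -
    obtain c where "L_family L c x y" "n = card c" using n by auto
    thus ?thesis using L_family_card(2) by (metis le_nat_floor)
  qed
  thus "finite {card c | c. L_family L c x y}" using finite_nat_set_iff_bounded_le by blast
  have "L_family L {} x y" by (simp add: L_family_def)
  thus "{card c | c. L_family L c x y} \<noteq> {}" by blast
qed

lemma L_family_card_le_dist:
  assumes "L_family L c x y" shows "card c \<le> curtain_dist X d L x y"
proof (cases "x = y")
  case True
  hence "c = {}" using assms sep_sides(3,5) by (fastforce simp: L_family_def)
  thus ?thesis by simp
next
  case False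
  have "card c \<le> Max {card c | c. L_family L c x y}" using assms L_family_cards by (intro Max_ge) auto
  thus ?thesis using False by (simp add: curtain_dist_alt)
qed

lemma L_family_attained:
  obtains c where "L_family L c x y" "curtain_dist X d L x y = (if x = y then 0 else 1 + card c)"
proof -
  have "Max {card c | c. L_family L c x y} \<in> {card c | c. L_family L c x y}"
    using L_family_cards by (intro Max_in) auto
  thus thesis using that by (auto simp: curtain_dist_alt)
qed

lemma curtain_dist_bound: "real (curtain_dist X d L x y) \<le> d x y + 2"
proof -
  obtain c where "L_family L c x y" "curtain_dist X d L x y = (if x = y then 0 else 1 + card c)"
    using L_family_attained .
  thus ?thesis using L_family_card(2)[of L c x y] nonneg[of x y] by (auto split: if_splits)
qed

lemma L_family_commute: "L_family L c x y \<longleftrightarrow> L_family L c y x"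
  by (auto simp: L_family_def sep_commute)

lemma curtain_dist_commute: "curtain_dist X d L x y = curtain_dist X d L y x"
  by (simp add: curtain_dist_alt L_family_commute[of L _ x y] eq_commute[of x])

text \<open>A curtain between \<open>x\<close> and \<open>y\<close> separates \<open>z\<close> from one of
  them unless it contains \<open>z\<close>, and disjoint curtains do so at most once. The summand 1 in the
  definition of \<open>d\<^sub>L\<close> absorbs this exception.\<close>

lemma L_family_split:
  assumes c: "L_family L c x y" and z: "z \<in> X"
  shows "card c \<le> card {h \<in> c. sep h x z} + card {h \<in> c. sep h z y} + 1"
proof -
  have fin: "finite c" using L_family_card(1)[OF c] .
  have "h = k" if "h \<in> c" "z \<in> h" "k \<in> c" "z \<in> k" for h k
    using that L_family_walls[OF c] unfolding wall_family_def pairwise_def disjnt_def by blast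
  hence one: "card {h \<in> c. z \<in> h} \<le> 1"
    using card_le_Suc0_iff_eq[of "{h \<in> c. z \<in> h}"] fin by simp
  have "c \<subseteq> {h \<in> c. sep h x z} \<union> {h \<in> c. sep h z y} \<union> {h \<in> c. z \<in> h}"
  proof
    fix h assume h: "h \<in> c"
    hence s: "sep h x y" using c by (simp add: L_family_def)
    note ss = sep_sides[OF s]
    consider "z \<in> side h x" | "z \<in> h" | "z \<in> side h y" using z ss(6) by blast
    thus "h \<in> {h \<in> c. sep h x z} \<union> {h \<in> c. sep h z y} \<union> {h \<in> c. z \<in> h}"
      using h sep_transfer(1)[OF s] ss(3,4) by cases auto
  qed
  hence "card c \<le> card ({h \<in> c. sep h x z} \<union> {h \<in> c. sep h z y} \<union> {h \<in> c. z \<in> h})"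
    using fin by (intro card_mono) auto
  also have "\<dots> \<le> card {h \<in> c. sep h x z} + card {h \<in> c. sep h z y} + card {h \<in> c. z \<in> h}"
    by (meson card_Un_le add_le_mono le_trans order_refl)
  finally show ?thesis using one by linarith
qed

lemma L_family_restrict: "L_family L c x y \<Longrightarrow> L_family L {h \<in> c. sep h u v} u v"
  by (auto simp: L_family_def pairwise_def)

lemma curtain_dist_triangle:
  assumes "z \<in> X"
  shows "curtain_dist X d L x y \<le> curtain_dist X d L x z + curtain_dist X d L z y"
proof -
  obtain c where c: "L_family L c x y" "curtain_dist X d L x y = (if x = y then 0 else 1 + card c)"
    using L_family_attained .
  have *: "card {h \<in> c. sep h u v} + 1 \<le> curtain_dist X d L u v" if "u \<noteq> v" for u v
  proof -
    have "card {h \<in> c. sep h u v} \<le> Max {card c | c. L_family L c u v}"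
      using L_family_restrict[OF c(1)] L_family_cards by (intro Max_ge) auto
    thus ?thesis using that by (simp add: curtain_dist_alt)
  qed
  consider "x = y" | "x = z" | "z = y" | "x \<noteq> y" "x \<noteq> z" "z \<noteq> y" by blast
  thus ?thesis
  proof cases
    case 4
    thus ?thesis using L_family_split[OF c(1) assms] *[of x z] *[of z y] c(2) by simp
  qed (simp_all add: curtain_dist_def)
qed

section \<open>Bottlenecks\<close>

lemma seg_convex:
  assumes X: "u \<in> X" "v \<in> X" and q: "q \<in> seg u v" "q' \<in> seg u v"
  shows "seg q q' \<subseteq> seg u v"
proof (cases "d u q \<le> d u q'")
  case True
  have "q \<in> seg u q'" using seg_linear[OF X q True] .
  thus ?thesis using seg_trans'(1)[of u q' q] seg_trans(1)[OF X q(2)] X seg_in q by blast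
next
  case False
  have "q' \<in> seg u q" using seg_linear[OF X q(2,1)] False by simp
  thus ?thesis using seg_trans'(1)[of u q q'] seg_trans(1)[OF X q(1)] X seg_in q seg_commute by blast
qed

lemma closest_on_seg:
  assumes X: "u \<in> X" "v \<in> X" "p \<in> X"
  obtains w where "w \<in> seg u v" "\<And>q. q \<in> seg u v \<Longrightarrow> d p w \<le> d p q"
proof -
  obtain \<gamma> where \<gamma>: "geodesic X d {0..d u v} \<gamma>" "seg u v = \<gamma> ` {0..d u v}"
    using seg_param[OF X(1,2)] by metis
  have "{0..d u v} \<noteq> {}" by simp
  from nearest_exists[OF \<gamma>(1) this X(3)] show thesis using that \<gamma>(2) by auto
qed

text \<open>Let \<open>w\<close> be the point of \<open>[u,v]\<close> nearest to \<open>p\<close>. All of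
  \<open>[u,v]\<close> projects to the end \<open>w\<close> of the segment \<open>[w,p]\<close>, and by
  \<open>straight_angle\<close> one of \<open>[x,p]\<close> and \<open>[p,y]\<close> projects to its other
  end. So every curtain dual to \<open>[w,p]\<close> separates points of \<open>h2\<close>, and also
  points of \<open>h1\<close> or points of \<open>h3\<close>, and meets these curtains. If
  \<open>[w,p]\<close> were longer than \<open>2 L + 2\<close>, it would have \<open>L + 1\<close>
  disjoint dual curtains, against \<open>L\<close>-separation.\<close>

lemma bottleneck:
  assumes L12: "L_separated X d L h1 h2" and L23: "L_separated X d L h2 h3"
    and X: "x \<in> X" "y \<in> X" "u \<in> X" "v \<in> X"
    and p: "p \<in> seg x y" "p \<in> h2" and p1: "seg x p \<inter> h1 \<noteq> {}" and p3: "seg p y \<inter> h3 \<noteq> {}"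
    and uv: "seg u v \<inter> h1 \<noteq> {}" "seg u v \<inter> h2 \<noteq> {}" "seg u v \<inter> h3 \<noteq> {}"
  shows "\<exists>q\<in>seg u v. d p q \<le> 2 * real L + 2"
proof (rule ccontr)
  assume "\<not> ?thesis"
  hence far: "2 * real L + 2 < d p q" if "q \<in> seg u v" for q using that by (auto simp: not_le)
  have pX: "p \<in> X" using p seg_in by auto
  obtain w where w: "w \<in> seg u v" "\<And>q. q \<in> seg u v \<Longrightarrow> d p w \<le> d p q"
    using closest_on_seg[OF X(3,4) pX] by blast
  have wX: "w \<in> X" using w seg_in by auto
  obtain \<beta> where \<beta>: "geodesic X d {0..d w p} \<beta>" "\<beta> 0 = w" "\<beta> (d w p) = p" "seg w p = \<beta> ` {0..d w p}"
    using seg_param[OF wX pX] by metis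
  define l where "l = d w p"
  have l: "2 * real L + 2 < l" using far[OF w(1)] by (simp add: l_def commute)
  have ne: "{0..l} \<noteq> {}" using l by auto
  have \<beta>g: "geodesic X d {0..l} \<beta>" using \<beta> by (simp add: l_def)
  have near: "coord {0..l} \<beta> z = 0" if "z \<in> seg u v" for z
  proof -
    have zX: "z \<in> X" using that seg_in by auto
    have "obtuse p w z" using w(2) seg_convex[OF X(3,4) w(1) that] by (auto simp: obtuse_def)
    hence ob: "obtuse z w p" using obtuse_commute[OF pX wX zX] by blast
    show ?thesis
      by (rule coord_eqI[OF \<beta>g _ _ zX]) (use ob \<beta> l in \<open>auto simp: obtuse_def l_def\<close>)
  qed
  have turn: "coord {0..l} \<beta> z = l" if "obtuse z0 p w" "z \<in> seg z0 p" "z0 \<in> X" for z z0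
  proof -
    have zX: "z \<in> X" using that seg_in by auto
    have "obtuse z p w" using obtuse_seg[OF that(3) pX wX that(1,2)] .
    hence "\<forall>t\<in>{0..l}. d z p \<le> d z (\<beta> t)" using \<beta>(4) by (auto simp: obtuse_def seg_commute[of p w] l_def)
    thus ?thesis using \<beta>(3) l by (intro coord_eqI[OF \<beta>g _ _ zX]) (auto simp: l_def)
  qed
  \<comment> \<open>Spacing 2 makes the curtains disjoint; the last one reaches up to \<open>2 L + 3/2\<close>, which is less than \<open>l\<close>.\<close>
  define k where "k i = dual_curtain X d {0..l} \<beta> (2 * real i + 1)" for i :: nat
  have k: "is_dual_curtain X d {0..l} \<beta> (2 * real i + 1) (k i)" if "i \<le> L" for i
    using \<beta>g l that by (auto simp: is_dual_curtain_def k_def)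
  have sepk: "sep (k i) a b" if i: "i \<le> L" and ab: "coord {0..l} \<beta> a = 0" "coord {0..l} \<beta> b = l" "a \<in> X" "b \<in> X" for i a b
    unfolding sep_iff[OF k[OF i]] dual_curtain_coord(4,5)[OF k[OF i]] using ab l i by auto
  define c where "c = k ` {..L}"
  have disj: "k i \<inter> k j = {}" if "i \<le> L" "j \<le> L" "i \<noteq> j" for i j
  proof -
    have "real i + 1 \<le> real j \<or> real j + 1 \<le> real i" using that by linarith
    thus ?thesis
      using dual_curtain_coord(3)[OF k[OF that(1)]] dual_curtain_coord(3)[OF k[OF that(2)]] by force
  qed
  have kne: "k i \<noteq> {}" if "i \<le> L" for i using k[OF that] curtain_nonempty_subset(1) by (auto simp: curtain_def)
  have "inj_on k {..L}" using disj kne by (intro inj_onI) (metis Int_absorb atMost_iff)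
  hence card: "card c = L + 1" by (simp add: c_def card_image)
  have "coord {0..l} \<beta> p = l" using coord_geodesic[OF \<beta>g, of l] \<beta>(3) l by (simp add: l_def)
  hence "wall_family c w p"
    using sepk near[OF w(1)] wX pX disj by (fastforce simp: wall_family_def c_def pairwise_def disjnt_def)
  hence chain: "curtain_chain X d c" by (rule wall_family_chain)
  have meets: "\<kappa> \<inter> h \<noteq> {}" if hyps: "\<kappa> \<in> c" "curtain X d h" "seg u v \<inter> h \<noteq> {}" "b \<in> h" "coord {0..l} \<beta> b = l" for \<kappa> h b
  proof -
    obtain i where i: "i \<le> L" "\<kappa> = k i" using hyps(1) by (auto simp: c_def)
    obtain a where a: "a \<in> seg u v" "a \<in> h" using hyps(3) by auto
    have "a \<in> X" "b \<in> X" using curtain_nonempty_subset(2)[OF hyps(2)] a hyps by auto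
    hence s: "sep (k i) a b" using sepk[OF i(1) near[OF a(1)] hyps(5)] by blast
    have "h \<inter> k i \<noteq> {}"
      using curtain_connected[OF hyps(2) s] sep_sides(3,4)[OF s] a hyps(4) by blast
    thus ?thesis using i by auto
  qed
  have cur: "curtain X d h1" "curtain X d h2" "curtain X d h3" using L12 L23 by (auto simp: L_separated_def)
  have pl: "coord {0..l} \<beta> p = l" by fact
  consider "obtuse x p w" | "obtuse y p w" using straight_angle[OF X(1,2) wX p(1)] by blast
  thus False
  proof cases
    case 1
    obtain b where "b \<in> seg x p" "b \<in> h1" using p1 by auto
    hence "\<kappa> \<inter> h1 \<noteq> {} \<and> \<kappa> \<inter> h2 \<noteq> {}" if "\<kappa> \<in> c" for \<kappa>
      using meets[OF that cur(1) uv(1)] meets[OF that cur(2) uv(2) p(2) pl] turn[OF 1 _ X(1)] by blast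
    hence "card c \<le> L" using L12 chain unfolding L_separated_def by blast
    thus False using card by simp
  next
    case 2
    obtain b where "b \<in> seg y p" "b \<in> h3" using p3 by (auto simp: seg_commute)
    hence "\<kappa> \<inter> h2 \<noteq> {} \<and> \<kappa> \<inter> h3 \<noteq> {}" if "\<kappa> \<in> c" for \<kappa>
      using meets[OF that cur(3) uv(3)] meets[OF that cur(2) uv(2) p(2) pl] turn[OF 2 _ X(2)] by blast
    hence "card c \<le> L" using L23 chain unfolding L_separated_def by blast
    thus False using card by simp
  qed
qed

text \<open>Three successive members of an \<open>L\<close>-chain, the pattern to which the bottleneck
  lemma applies.\<close>

definition gate :: "nat \<Rightarrow> 'a \<Rightarrow> 'a \<Rightarrow> 'a set \<Rightarrow> 'a set \<Rightarrow> 'a set \<Rightarrow> bool" where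
  "gate L x y h1 h2 h3 \<longleftrightarrow> sep h1 x y \<and> sep h2 x y \<and> sep h3 x y
     \<and> precedes x y h1 h2 \<and> precedes x y h2 h3 \<and> L_separated X d L h1 h2 \<and> L_separated X d L h2 h3"

lemma gate_commute: "gate L x y h1 h2 h3 \<Longrightarrow> gate L y x h3 h2 h1"
  by (auto simp: gate_def sep_commute precedes_def L_separated_commute)

lemma gate_bottleneck:
  assumes g: "gate L x y h1 h2 h3" and X: "u \<in> X" "v \<in> X"
    and uv: "seg u v \<inter> h1 \<noteq> {}" "seg u v \<inter> h2 \<noteq> {}" "seg u v \<inter> h3 \<noteq> {}"
    and p: "p \<in> seg x y" "p \<in> h2"
  obtains q where "q \<in> seg u v" "d p q \<le> 2 * real L + 2"
proof -
  have s: "sep h1 x y" "sep h2 x y" "sep h3 x y" "h2 \<subseteq> side h1 y" "h2 \<subseteq> side h3 x"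
    "L_separated X d L h1 h2" "L_separated X d L h2 h3"
    using g by (auto simp: gate_def precedes_def)
  have XY: "x \<in> X" "y \<in> X" using sep_sides[OF s(1)] by auto
  have "sep h1 x p" using sep_transfer(1)[OF s(1) sep_sides(3)[OF s(1)]] s(4) p by blast
  hence p1: "seg x p \<inter> h1 \<noteq> {}" using sep_crossing by blast
  have "sep h3 p y" using sep_transfer(1)[OF s(3) _ sep_sides(4)[OF s(3)]] s(5) p by blast
  hence p3: "seg p y \<inter> h3 \<noteq> {}" using sep_crossing by blast
  show thesis using bottleneck[OF s(6,7) XY X p p1 p3 uv] that by blast
qed

text \<open>A geodesic that passes \<open>h3\<close> has passed \<open>h2\<close> and \<open>h1\<close>
  before.\<close>

lemma gate_crossed:
  assumes g: "gate L x y h1 h2 h3" and z: "z \<in> X" "z \<notin> side h3 x"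
  shows "seg x z \<inter> h1 \<noteq> {}" "seg x z \<inter> h2 \<noteq> {}" "seg x z \<inter> h3 \<noteq> {}"
proof -
  have s: "sep h1 x y" "sep h2 x y" "sep h3 x y" "h2 \<subseteq> side h1 y" "h3 \<subseteq> side h2 y"
    using g by (auto simp: gate_def precedes_def)
  have X: "x \<in> X" using sep_sides[OF s(1)] by auto
  have "\<exists>w\<in>seg x z. w \<in> h3"
  proof (cases "z \<in> h3")
    case True
    thus ?thesis using ends_in_seg[OF X z(1)] by blast
  next
    case False
    hence "z \<in> side h3 y" using z sep_sides(6)[OF s(3)] by blast
    hence "sep h3 x z" using sep_transfer(1)[OF s(3) sep_sides(3)[OF s(3)]] by blast
    thus ?thesis using sep_crossing by blast
  qed
  then obtain w3 where w3: "w3 \<in> seg x z" "w3 \<in> h3" by auto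
  have "sep h2 x w3" using sep_transfer(1)[OF s(2) sep_sides(3)[OF s(2)]] w3 s(5) by blast
  then obtain w2 where w2: "w2 \<in> seg x w3" "w2 \<in> h2" using sep_crossing by blast
  have w2z: "w2 \<in> seg x z" using seg_trans(1)[OF X z(1) w3(1) w2(1)] .
  have "sep h1 x w2" using sep_transfer(1)[OF s(1) sep_sides(3)[OF s(1)]] w2 s(4) by blast
  then obtain w1 where w1: "w1 \<in> seg x w2" "w1 \<in> h1" using sep_crossing by blast
  have "w1 \<in> seg x z" using seg_trans(1)[OF X z(1) w2z w1(1)] .
  thus "seg x z \<inter> h1 \<noteq> {}" "seg x z \<inter> h2 \<noteq> {}" "seg x z \<inter> h3 \<noteq> {}" using w1 w2 w2z w3 by auto
qed

lemma fan_shift: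
  assumes X: "x \<in> X" "z \<in> X" and p: "p \<in> X"
    and q: "q \<in> seg x z" "q' \<in> seg x z" and le: "d x q \<le> d x q'"
  obtains p' where "p' \<in> seg x p" "d q p' \<le> d q' p"
proof (cases "d x q' = 0")
  case True
  have "q \<in> X" "q' \<in> X" using q seg_in by auto
  moreover have "d x q = 0" using True le nonneg[of x q] by linarith
  ultimately have "q = x" "q' = x" using True X by auto
  thus thesis using that[of x] ends_in_seg[OF X(1) p] X p by simp
next
  case False
  have X': "q \<in> X" "q' \<in> X" using q seg_in by auto
  define k where "k = d x q / d x q'"
  have pos: "0 < d x q'" using False by (simp add: less_le)
  have k: "0 \<le> k" "k \<le> 1" "d x q = k * d x q'" using pos le by (auto simp: k_def)
  have "k * d x p \<le> d x p" using k(2) mult_right_mono[of k 1 "d x p"] by simp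
  then obtain p' where p': "p' \<in> seg x p" "d x p' = k * d x p"
    using seg_point[OF X(1) p, of "k * d x p"] k by auto
  have "d q p' \<le> k * d q' p"
    using fan_comparison[OF X(1) X'(2) p seg_linear[OF X q le] p'(1) k p'(2)] .
  also have "\<dots> \<le> d q' p" using k(2) mult_right_mono[of k 1 "d q' p"] by simp
  finally show thesis using that[OF p'(1)] by blast
qed

text \<open>If \<open>z\<close> were beyond both gates, the geodesic \<open>[x,z]\<close> would pass
  within \<open>2 L + 2\<close> of a point of \<open>[x,a]\<close> in \<open>a2\<close> and of a point of
  \<open>[x,b]\<close> in \<open>b2\<close>. By convexity some points of \<open>[x,a]\<close> and of
  \<open>[x,b]\<close>, one of which is in \<open>a2\<close> or \<open>b2\<close>, would then be within
  twice that distance, whereas the right angle at \<open>x\<close> makes their distance at least their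
  distances from \<open>x\<close>.\<close>

lemma right_angle_divergence:
  assumes ga: "gate L x a a1 a2 a3" and gb: "gate L x b b1 b2 b3" and ob: "obtuse b x a"
    and far: "\<And>q. q \<in> a2 \<Longrightarrow> 2 * (2 * real L + 2) < d x q" "\<And>q. q \<in> b2 \<Longrightarrow> 2 * (2 * real L + 2) < d x q"
    and z: "z \<in> X"
  shows "z \<in> side a3 x \<or> z \<in> side b3 x"
proof (rule ccontr)
  assume "\<not> ?thesis"
  hence zn: "z \<notin> side a3 x" "z \<notin> side b3 x" by auto
  have sa: "sep a2 x a" and sb: "sep b2 x b" using ga gb by (auto simp: gate_def)
  have X: "x \<in> X" "a \<in> X" "b \<in> X" using sep_sides[OF sa] sep_sides[OF sb] by auto
  obtain p where p: "p \<in> seg x a" "p \<in> a2" using sep_crossing[OF sa] by blast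
  obtain q where q: "q \<in> seg x z" "d p q \<le> 2 * real L + 2"
    using gate_bottleneck[OF ga X(1) z gate_crossed[OF ga z zn(1)] p] by blast
  obtain p' where p': "p' \<in> seg x b" "p' \<in> b2" using sep_crossing[OF sb] by blast
  obtain q' where q': "q' \<in> seg x z" "d p' q' \<le> 2 * real L + 2"
    using gate_bottleneck[OF gb X(1) z gate_crossed[OF gb z zn(2)] p'] by blast
  have XX: "p \<in> X" "p' \<in> X" "q \<in> X" "q' \<in> X" using p p' q q' seg_in by auto
  show False
  proof (cases "d x q \<le> d x q'")
    case True
    obtain r where r: "r \<in> seg x p'" "d q r \<le> d q' p'" using fan_shift[OF X(1) z XX(2) q(1) q'(1) True] .
    have rX: "r \<in> X" and rb: "r \<in> seg x b" using r seg_in seg_trans(1)[OF X(1,3) p'(1)] by auto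
    have "d x p \<le> d r p" using obtuse_fan(2)[OF X(3,1,2) ob rb p(1)] .
    also have "\<dots> \<le> d r q + d q p" using triangle rX XX by blast
    finally have "d x p \<le> d r q + d q p" .
    moreover have "d r q \<le> 2 * real L + 2" using r(2) q'(2) by (simp add: commute)
    moreover have "d q p \<le> 2 * real L + 2" using q(2) by (simp add: commute)
    ultimately show False using far(1)[OF p(2)] by argo
  next
    case False
    hence le: "d x q' \<le> d x q" by simp
    obtain r where r: "r \<in> seg x p" "d q' r \<le> d q p" using fan_shift[OF X(1) z XX(1) q'(1) q(1) le] .
    have rX: "r \<in> X" and ra: "r \<in> seg x a" using r seg_in seg_trans(1)[OF X(1,2) p(1)] by auto
    have "d x p' \<le> d p' r" using obtuse_fan(1)[OF X(3,1,2) ob p'(1) ra] .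
    also have "\<dots> \<le> d p' q' + d q' r" using triangle rX XX by blast
    finally have "d x p' \<le> d p' q' + d q' r" .
    moreover have "d q' r \<le> 2 * real L + 2" using r(2) q(2) by (simp add: commute)
    ultimately show False using far(2)[OF p'(2)] q'(2) by argo
  qed
qed

text \<open>Not only the curtain \<open>h\<close> but everything on its near side lies before
  \<open>k\<close>.\<close>

lemma precedes_nested:
  assumes h: "sep h x y" and k: "sep k x y" and hk: "precedes x y h k" and z: "z \<in> X" "z \<notin> side h y"
  shows "z \<in> side k x"
proof (rule ccontr)
  assume n: "z \<notin> side k x"
  have hz: "z \<in> h \<union> side h x" using z sep_sides(6)[OF h] by blast
  hence "z \<in> side h x" using n hk by (auto simp: precedes_def)
  moreover have "z \<notin> k" using hk calculation sep_sides(5)[OF h] by (auto simp: precedes_def)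
  hence "z \<in> side k y" using n z(1) sep_sides(6)[OF k] by blast
  hence "sep k x z" using sep_transfer(1)[OF k sep_sides(3)[OF k]] by blast
  moreover have "sep h y x" using h by (simp add: sep_commute)
  ultimately have "k \<inter> (h \<union> side h x) \<noteq> {}"
    using far_half_connected[of h y x k x z] sep_sides(3)[OF h] by blast
  thus False using hk sep_sides(5,8)[OF h] by (auto simp: precedes_def)
qed

text \<open>An \<open>L\<close>-chain of \<open>M\<close> curtains separating \<open>x\<close> from
  \<open>y\<close>, enumerated from \<open>x\<close> to \<open>y\<close>.\<close>

definition arm :: "nat \<Rightarrow> nat \<Rightarrow> 'a \<Rightarrow> 'a \<Rightarrow> (nat \<Rightarrow> 'a set) \<Rightarrow> bool" where
  "arm L M x y e \<longleftrightarrow> (\<forall>i<M. sep (e i) x y) \<and>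
     (\<forall>i j. i < j \<longrightarrow> j < M \<longrightarrow> precedes x y (e i) (e j) \<and> L_separated X d L (e i) (e j))"

lemma L_family_arm:
  assumes c: "L_family L c x y" and M: "M \<le> card c"
  obtains e where "arm L M x y e" "e ` {..<M} \<subseteq> c"
proof -
  obtain h where h: "bij_betw h {..<card c} c" "\<And>i j. i < j \<Longrightarrow> j < card c \<Longrightarrow> precedes x y (h i) (h j)"
    using wall_family_enum[OF L_family_walls[OF c]] by blast
  have hc: "h i \<in> c" if "i < card c" for i using h(1) that by (auto simp: bij_betw_def)
  have "h i \<noteq> h j" if "i < j" "j < card c" for i j
    using h(1) that inj_onD[of h "{..<card c}" i j] by (auto simp: bij_betw_def)
  hence "L_separated X d L (h i) (h j)" if "i < j" "j < card c" for i j
    using c that hc[of i] hc[of j] by (auto simp: L_family_def pairwise_def)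
  hence "arm L M x y h" unfolding arm_def using h(2) M hc c by (auto simp: L_family_def)
  moreover have "h ` {..<M} \<subseteq> c" using hc M by fastforce
  ultimately show thesis using that by blast
qed

lemma arm_sub_family:
  assumes e: "arm L M x y e" and S: "S \<subseteq> {..<M}" and s: "\<And>i. i \<in> S \<Longrightarrow> sep (e i) u v"
  shows "real (card S) \<le> d u v + 1" "L_family L (e ` S) u v" "card (e ` S) = card S"
proof -
  have ls: "L_separated X d L (e i) (e j)" if "i \<in> S" "j \<in> S" "i \<noteq> j" for i j
    using e S that L_separated_commute by (metis arm_def lessThan_iff linorder_neqE_nat subsetD)
  have "e i \<noteq> {}" if "i \<in> S" for i
    using s[OF that] sep_curtain curtain_nonempty_subset(1) by blast
  hence inj: "inj_on e S" using ls by (intro inj_onI) (metis Int_absorb L_separated_def)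
  show fam: "L_family L (e ` S) u v" using ls s by (auto simp: L_family_def pairwise_def)
  show "card (e ` S) = card S" using inj by (rule card_image)
  thus "real (card S) \<le> d u v + 1" using L_family_card(2)[OF fam] by simp
qed

lemma arm_gate:
  assumes e: "arm L M x y e" and i: "i < j" "j < k" "k < M"
  shows "gate L x y (e i) (e j) (e k)"
  using assms by (auto simp: gate_def arm_def)

lemma arm_far:
  assumes e: "arm L M x y e" and i: "i < M" and q: "q \<in> e i"
  shows "real i \<le> d x q + 1"
proof -
  have "sep (e j) x q" if "j < i" for j
  proof -
    have "sep (e j) x y" "e i \<subseteq> side (e j) y" using e that i by (auto simp: arm_def precedes_def)
    thus ?thesis using sep_transfer(1) sep_sides(3) q by blast
  qed
  hence "real (card {..<i}) \<le> d x q + 1" using i by (intro arm_sub_family(1)[OF e]) auto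
  thus ?thesis by simp
qed

text \<open>Each curtain of the arm that comes after \<open>e i\<close> would separate \<open>y'\<close>
  from \<open>y\<close> if \<open>y'\<close> were not beyond \<open>e i\<close>, and there are at most
  \<open>K + 1\<close> such curtains.\<close>

lemma arm_end:
  assumes e: "arm L M x y e" and y': "y' \<in> X" "d y' y \<le> real K" and i: "i + K + 2 < M"
  shows "y' \<in> side (e i) y"
proof (rule ccontr)
  assume n: "y' \<notin> side (e i) y"
  have "sep (e j) y' y" if j: "j \<in> {i<..<M}" for j
  proof -
    have s: "sep (e i) x y" "sep (e j) x y" "precedes x y (e i) (e j)" using e j by (auto simp: arm_def)
    have "y' \<in> side (e j) x" using precedes_nested[OF s y'(1) n] .
    thus ?thesis using sep_transfer(1)[OF s(2) _ sep_sides(4)[OF s(2)]] by blast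
  qed
  hence "real (card {i<..<M}) \<le> d y' y + 1" by (intro arm_sub_family(1)[OF e]) auto
  thus False using y'(2) i by simp
qed

text \<open>An arm can also be traversed backwards, starting from a point that is only close to its
  tip.\<close>

lemma arm_reverse_gate:
  assumes e: "arm L M x y e" and y': "y' \<in> X" "d y' y \<le> real K" and i: "i + K + 4 < M"
  shows "gate L y' x (e (i + 2)) (e (i + 1)) (e i)"
proof -
  have g: "gate L x y (e i) (e (i + 1)) (e (i + 2))" using arm_gate[OF e] i by auto
  have s: "sep (e j) x y' \<and> side (e j) y' = side (e j) y" if "j \<in> {i, i + 1, i + 2}" for j
  proof -
    have s: "sep (e j) x y" using e i that by (auto simp: arm_def)
    have "y' \<in> side (e j) y" using arm_end[OF e y'] i that by auto
    thus ?thesis using sep_transfer(1,3)[OF s sep_sides(3)[OF s]] by blast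
  qed
  have "gate L x y' (e i) (e (i + 1)) (e (i + 2))"
    using g s unfolding gate_def precedes_def by auto
  thus ?thesis by (rule gate_commute)
qed

lemma arm_far_end:
  assumes e: "arm L M x y e" and y': "y' \<in> X" "d y' y \<le> real K" and i: "i < M" and q: "q \<in> e i"
  shows "real M \<le> d y' q + real (i + K + 4)"
proof -
  have "sep (e j) y' q" if j: "j \<in> {i<..<M - (K + 2)}" for j
  proof -
    have "i < j" "j < M" using j by auto
    hence s: "sep (e j) x y" "e i \<subseteq> side (e j) x"
      using e unfolding arm_def precedes_def by blast+
    moreover have "y' \<in> side (e j) y" using arm_end[OF e y', of j] j by auto
    ultimately show ?thesis using sep_transfer(1) q sep_commute by blast
  qed
  hence "real (card {i<..<M - (K + 2)}) \<le> d y' q + 1" by (intro arm_sub_family(1)[OF e]) auto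
  thus ?thesis by (simp add: of_nat_diff)
qed

section \<open>Isometries\<close>

definition isometry :: "('a \<Rightarrow> 'a) \<Rightarrow> bool" where
  "isometry \<psi> \<longleftrightarrow> bij_betw \<psi> X X \<and> (\<forall>x\<in>X. \<forall>y\<in>X. d (\<psi> x) (\<psi> y) = d x y)"

lemma isometry_dist: "isometry \<psi> \<Longrightarrow> x \<in> X \<Longrightarrow> y \<in> X \<Longrightarrow> d (\<psi> x) (\<psi> y) = d x y"
  by (simp add: isometry_def)

lemma isometry_in: "isometry \<psi> \<Longrightarrow> x \<in> X \<Longrightarrow> \<psi> x \<in> X"
  by (auto simp: isometry_def bij_betw_def)

lemma isometry_surj:
  assumes "isometry \<psi>" "y \<in> X" obtains x where "x \<in> X" "y = \<psi> x"
proof -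
  have "y \<in> \<psi> ` X" using assms by (simp add: isometry_def bij_betw_def)
  thus thesis using that by auto
qed

lemma isometry_seg: "isometry \<psi> \<Longrightarrow> x \<in> X \<Longrightarrow> y \<in> X \<Longrightarrow> p \<in> seg x y \<Longrightarrow> \<psi> p \<in> seg (\<psi> x) (\<psi> y)"
  by (simp add: seg_def isometry_dist isometry_in)

lemma isometry_inverse:
  assumes "isometry \<psi>"
  shows "isometry (inv_into X \<psi>)" "x \<in> X \<Longrightarrow> inv_into X \<psi> (\<psi> x) = x"
proof -
  have b: "bij_betw \<psi> X X" using assms by (simp add: isometry_def)
  show i: "inv_into X \<psi> (\<psi> x) = x" if "x \<in> X" for x using b that by (simp add: bij_betw_inv_into_left)
  show "isometry (inv_into X \<psi>)" unfolding isometry_def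
  proof (intro conjI ballI)
    show "bij_betw (inv_into X \<psi>) X X" using bij_betw_inv_into[OF b] .
    fix x y assume "x \<in> X" "y \<in> X"
    then obtain u v where "u \<in> X" "x = \<psi> u" "v \<in> X" "y = \<psi> v" using isometry_surj[OF assms] by metis
    thus "d (inv_into X \<psi> x) (inv_into X \<psi> y) = d x y" using i isometry_dist[OF assms] by simp
  qed
qed

lemma isometry_dual_curtain:
  assumes \<psi>: "isometry \<psi>" and h: "is_dual_curtain X d I \<alpha> r h"
  shows "is_dual_curtain X d I (\<psi> \<circ> \<alpha>) r (\<psi> ` h)"
    "neg_halfspace X d I (\<psi> \<circ> \<alpha>) r = \<psi> ` neg_halfspace X d I \<alpha> r"
    "pos_halfspace X d I (\<psi> \<circ> \<alpha>) r = \<psi> ` pos_halfspace X d I \<alpha> r"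
proof -
  note c = dual_curtain_coord[OF h]
  have g: "geodesic X d I (\<psi> \<circ> \<alpha>)"
    using c(1) isometry_dist[OF \<psi>] isometry_in[OF \<psi>] by (auto simp: geodesic_def image_subset_iff)
  have coord: "coord I (\<psi> \<circ> \<alpha>) (\<psi> x) = coord I \<alpha> x" if "x \<in> X" for x
    using coord_nearest[OF c(1,2) that] isometry_dist[OF \<psi> that] geodesic_in[OF c(1)]
    by (intro coord_eqI[OF g _ _ isometry_in[OF \<psi> that]]) auto
  have pre: "projection_preimage X d I (\<psi> \<circ> \<alpha>) J = \<psi> ` projection_preimage X d I \<alpha> J" if J: "J \<subseteq> I" for J
  proof -
    have "{x \<in> X. coord I (\<psi> \<circ> \<alpha>) x \<in> J} = \<psi> ` {x \<in> X. coord I \<alpha> x \<in> J}"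
    proof
      show "{x \<in> X. coord I (\<psi> \<circ> \<alpha>) x \<in> J} \<subseteq> \<psi> ` {x \<in> X. coord I \<alpha> x \<in> J}"
      proof
        fix y assume y: "y \<in> {x \<in> X. coord I (\<psi> \<circ> \<alpha>) x \<in> J}"
        then obtain x where x: "x \<in> X" "y = \<psi> x" using isometry_surj[OF \<psi>] by blast
        thus "y \<in> \<psi> ` {x \<in> X. coord I \<alpha> x \<in> J}" using y coord[OF x(1)] by auto
      qed
    qed (use coord isometry_in[OF \<psi>] in auto)
    thus ?thesis using projection_preimage_eq[OF g c(2) J] projection_preimage_eq[OF c(1,2) J] by simp
  qed
  show "is_dual_curtain X d I (\<psi> \<circ> \<alpha>) r (\<psi> ` h)"
    using h g pre[OF c(6)] by (simp add: is_dual_curtain_def dual_curtain_def)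
  show "neg_halfspace X d I (\<psi> \<circ> \<alpha>) r = \<psi> ` neg_halfspace X d I \<alpha> r"
    "pos_halfspace X d I (\<psi> \<circ> \<alpha>) r = \<psi> ` pos_halfspace X d I \<alpha> r"
    unfolding neg_halfspace_def pos_halfspace_def by (simp_all add: pre)
qed

lemma isometry_curtain:
  assumes "isometry \<psi>" "curtain X d h" shows "curtain X d (\<psi> ` h)"
  using assms isometry_dual_curtain(1) unfolding curtain_def by blast

lemma isometry_separates:
  assumes \<psi>: "isometry \<psi>" and s: "separates X d h A B"
  shows "separates X d (\<psi> ` h) (\<psi> ` A) (\<psi> ` B)"
proof -
  obtain I \<alpha> r where h: "is_dual_curtain X d I \<alpha> r h" and
    AB: "A \<subseteq> neg_halfspace X d I \<alpha> r \<and> B \<subseteq> pos_halfspace X d I \<alpha> r \<or>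
      B \<subseteq> neg_halfspace X d I \<alpha> r \<and> A \<subseteq> pos_halfspace X d I \<alpha> r"
    using s unfolding separates_def by blast
  note i = isometry_dual_curtain[OF \<psi> h]
  have "\<psi> ` A \<subseteq> neg_halfspace X d I (\<psi> \<circ> \<alpha>) r \<and> \<psi> ` B \<subseteq> pos_halfspace X d I (\<psi> \<circ> \<alpha>) r \<or>
      \<psi> ` B \<subseteq> neg_halfspace X d I (\<psi> \<circ> \<alpha>) r \<and> \<psi> ` A \<subseteq> pos_halfspace X d I (\<psi> \<circ> \<alpha>) r"
    using AB unfolding i(2,3) by (meson image_mono)
  thus ?thesis using i(1) unfolding separates_def by blast
qed

lemma isometry_image_inj: "isometry \<psi> \<Longrightarrow> inj_on ((`) \<psi>) (Pow X)"
  by (auto simp: isometry_def bij_betw_def intro: inj_on_image_Pow)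

lemma isometry_chain:
  assumes \<psi>: "isometry \<psi>" and c: "curtain_chain X d c"
  shows "curtain_chain X d ((`) \<psi> ` c)" "card ((`) \<psi> ` c) = card c" "finite ((`) \<psi> ` c) \<longleftrightarrow> finite c"
proof -
  obtain J :: "int set" and h where J: "\<forall>i\<in>J. \<forall>k\<in>J. {i..k} \<subseteq> J" "bij_betw h J c"
    "\<forall>i. i - 1 \<in> J \<and> i \<in> J \<and> i + 1 \<in> J \<longrightarrow> separates X d (h i) (h (i - 1)) (h (i + 1))"
    and cur: "\<forall>h\<in>c. curtain X d h"
    using c unfolding curtain_chain_def by blast
  have "c \<subseteq> Pow X" using cur curtain_nonempty_subset(2) by blast
  hence inj: "inj_on ((`) \<psi>) c" using isometry_image_inj[OF \<psi>] inj_on_subset by blast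
  have "bij_betw (\<lambda>i. \<psi> ` h i) J ((`) \<psi> ` c)"
    using bij_betw_trans[OF J(2) bij_betw_imageI[OF inj refl]] by (simp add: comp_def)
  moreover have "\<forall>i. i - 1 \<in> J \<and> i \<in> J \<and> i + 1 \<in> J \<longrightarrow> separates X d (\<psi> ` h i) (\<psi> ` h (i - 1)) (\<psi> ` h (i + 1))"
    using J(3) isometry_separates[OF \<psi>] by blast
  moreover have "\<forall>h\<in>(`) \<psi> ` c. curtain X d h" using cur isometry_curtain[OF \<psi>] by blast
  ultimately show "curtain_chain X d ((`) \<psi> ` c)"
    unfolding curtain_chain_def using J(1) by (intro conjI exI[of _ J] exI[of _ "\<lambda>i. \<psi> ` h i"]) auto
  show "card ((`) \<psi> ` c) = card c" "finite ((`) \<psi> ` c) \<longleftrightarrow> finite c"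
    using inj by (simp_all add: card_image finite_image_iff)
qed

text \<open>A chain that meets the images of \<open>h\<close> and \<open>k\<close> is moved back by the
  inverse isometry.\<close>

lemma isometry_L_separated:
  assumes \<psi>: "isometry \<psi>" and s: "L_separated X d L h k"
  shows "L_separated X d L (\<psi> ` h) (\<psi> ` k)"
proof -
  have hk: "curtain X d h" "curtain X d k" "h \<inter> k = {}" and
    s': "\<And>c. curtain_chain X d c \<Longrightarrow> (\<forall>m\<in>c. m \<inter> h \<noteq> {} \<and> m \<inter> k \<noteq> {}) \<Longrightarrow> finite c \<and> card c \<le> L"
    using s unfolding L_separated_def by blast+
  have sub: "h \<subseteq> X" "k \<subseteq> X" using hk curtain_nonempty_subset by auto
  let ?i = "inv_into X \<psi>"
  note inv = isometry_inverse[OF \<psi>]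
  have "\<psi> ` h \<inter> \<psi> ` k = {}"
  proof -
    have "inj_on \<psi> X" using \<psi> by (auto simp: isometry_def bij_betw_def)
    thus ?thesis using hk(3) sub by (metis image_empty inj_on_image_Int)
  qed
  moreover have "finite c \<and> card c \<le> L"
    if c: "curtain_chain X d c" "\<forall>m\<in>c. m \<inter> \<psi> ` h \<noteq> {} \<and> m \<inter> \<psi> ` k \<noteq> {}" for c
  proof -
    have meet: "?i ` m \<inter> l \<noteq> {}" if ml: "m \<inter> \<psi> ` l \<noteq> {}" "l \<subseteq> X" for m l
    proof -
      obtain u where "u \<in> l" "\<psi> u \<in> m" using ml by auto
      moreover have "?i (\<psi> u) = u" using inv(2) calculation ml by auto
      ultimately show ?thesis by (metis IntI empty_iff imageI)
    qed
    have "\<forall>m\<in>(`) ?i ` c. m \<inter> h \<noteq> {} \<and> m \<inter> k \<noteq> {}" using c(2) meet sub by auto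
    thus ?thesis using s' isometry_chain[OF inv(1) c(1)] by metis
  qed
  ultimately show ?thesis unfolding L_separated_def using hk isometry_curtain[OF \<psi>] by blast
qed

lemma isometry_L_family:
  assumes \<psi>: "isometry \<psi>" and c: "L_family L c x y"
  shows "L_family L ((`) \<psi> ` c) (\<psi> x) (\<psi> y)" "card ((`) \<psi> ` c) = card c"
proof -
  show "card ((`) \<psi> ` c) = card c"
    using isometry_chain(2)[OF \<psi> wall_family_chain[OF L_family_walls[OF c]]] .
  have "sep (\<psi> ` h) (\<psi> x) (\<psi> y)" if "h \<in> c" for h
    using isometry_separates[OF \<psi>, of h "{x}" "{y}"] c that by (simp add: L_family_def)
  moreover have "pairwise (L_separated X d L) ((`) \<psi> ` c)"
    unfolding pairwise_image using c isometry_L_separated[OF \<psi>] by (auto simp: L_family_def pairwise_def)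
  ultimately show "L_family L ((`) \<psi> ` c) (\<psi> x) (\<psi> y)" by (auto simp: L_family_def)
qed

lemma isometry_curtain_dist:
  assumes \<psi>: "isometry \<psi>" and X: "x \<in> X" "y \<in> X"
  shows "curtain_dist X d L (\<psi> x) (\<psi> y) = curtain_dist X d L x y"
proof -
  have le: "curtain_dist X d L x y \<le> curtain_dist X d L (\<psi> x) (\<psi> y)"
    if "isometry \<psi>" "x \<in> X" "y \<in> X" for \<psi> x y
  proof (cases "x = y")
    case False
    hence ne: "\<psi> x \<noteq> \<psi> y" using that by (auto simp: isometry_def bij_betw_def inj_on_def)
    obtain c where c: "L_family L c x y" "curtain_dist X d L x y = (if x = y then 0 else 1 + card c)"
      using L_family_attained .
    have "card c \<in> {card c | c. L_family L c (\<psi> x) (\<psi> y)}"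
      using isometry_L_family[OF that(1) c(1)] by (metis (mono_tags, lifting) mem_Collect_eq)
    hence "card c \<le> Max {card c | c. L_family L c (\<psi> x) (\<psi> y)}"
      using L_family_cards(1) by (intro Max_ge)
    thus ?thesis using c(2) False ne by (simp add: curtain_dist_alt)
  qed (simp add: curtain_dist_def)
  show ?thesis
    using le[OF \<psi> X] le[OF isometry_inverse(1)[OF \<psi>] isometry_in[OF \<psi> X(1)] isometry_in[OF \<psi> X(2)]]
      isometry_inverse(2)[OF \<psi>] X by simp
qed

section \<open>Concatenation of blocks\<close>

text \<open>The arms run from bases \<open>b n\<close> to tips \<open>t n\<close>, each base being near
  the previous tip and each arm perpendicular to the previous one. Pick the curtain \<open>k n\<close>
  with a fixed index \<open>j\<close> from every arm. The curtain \<open>k' n\<close> that follows it in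
  the arm serves two purposes: everything behind \<open>k' n\<close> is on the near side of \<open>k (Suc
  n)\<close>, by \<open>right_angle_divergence\<close>, so that the curtains \<open>k n\<close> are
  nested; and a curtain that meets \<open>k n\<close> and a later \<open>k m\<close> also meets \<open>k'
  n\<close>, so that the \<open>L\<close>-separation of \<open>k n\<close> from \<open>k' n\<close> passes
  to \<open>k n\<close> and \<open>k m\<close>.\<close>

lemma concatenation:
  fixes b t :: "nat \<Rightarrow> 'a" and e :: "nat \<Rightarrow> nat \<Rightarrow> 'a set"
  assumes arm: "\<And>n. arm L (8 * L + K + 18) (b n) (t n) (e n)"
    and near: "\<And>n. d (b (Suc n)) (t n) \<le> real K"
    and ob: "\<And>n. obtuse (t (Suc n)) (b (Suc n)) (b n)"
  shows "\<exists>c. L_family L c (b 0) (t n) \<and> card c = n"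
proof -
  define M where "M = 8 * L + K + 18"
  \<comment> \<open>Both gates at a corner must be farther from it than \<open>2 (2 L + 2)\<close>. Distances are at least the number of curtains crossed
    minus 1, so \<open>j - 2\<close> has to exceed \<open>4 L + 4\<close>. Seen from the tip, up to \<open>K + 2\<close> curtains are lost because the
    corner is only near the tip.\<close>
  define j where "j = 4 * L + 7"
  note arm' = arm[folded M_def]
  have j: "j + 1 + K + 4 < M" "2 \<le> j" "j < M" "j + 1 < M" by (auto simp: M_def j_def)
  define k where "k n = e n j" for n
  define k' where "k' n = e n (j + 1)" for n
  have sk: "sep (k n) (b n) (t n)" "sep (k' n) (b n) (t n)" "precedes (b n) (t n) (k n) (k' n)"
    "L_separated X d L (k n) (k' n)" for n
    using arm'[of n] j by (auto simp: arm_def k_def k'_def)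
  have bt: "b n \<in> X" "t n \<in> X" for n using sep_sides[OF sk(1)] by auto
  define A where "A n = X - side (k' n) (t n)" for n
  \<comment> \<open>\<open>A n\<close> is the curtain \<open>k' n\<close> with everything behind it; nothing in \<open>A n\<close> reaches the next selected curtain.\<close>
  have step: "A n \<subseteq> side (k (Suc n)) (b (Suc n))" for n
  proof
    fix z assume z: "z \<in> A n"
    have "gate L (b (Suc n)) (b n) (e n (j + 1 + 2)) (e n (j + 1 + 1)) (e n (j + 1))"
      using arm_reverse_gate[OF arm' bt(1) near j(1)] .
    moreover have "gate L (b (Suc n)) (t (Suc n)) (e (Suc n) (j - 2)) (e (Suc n) (j - 1)) (e (Suc n) j)"
      using arm_gate[OF arm'] j by auto
    moreover have "2 * (2 * real L + 2) < d (b (Suc n)) q" if "q \<in> e n (j + 1 + 1)" for q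
    proof -
      have "j + 1 + 1 < M" using j by simp
      from arm_far_end[OF arm' bt(1) near this that] show ?thesis by (simp add: M_def j_def)
    qed
    moreover have "2 * (2 * real L + 2) < d (b (Suc n)) q" if "q \<in> e (Suc n) (j - 1)" for q
    proof -
      have "j - 1 < M" using j by simp
      from arm_far[OF arm' this that] show ?thesis by (simp add: j_def)
    qed
    ultimately have "z \<in> side (e n (j + 1)) (b (Suc n)) \<or> z \<in> side (e (Suc n) j) (b (Suc n))"
      using right_angle_divergence[OF _ _ ob] z by (simp add: A_def)
    moreover have "b (Suc n) \<in> side (k' n) (t n)"
      using arm_end[OF arm' bt(1) near] j by (simp add: k'_def)
    hence "side (k' n) (b (Suc n)) = side (k' n) (t n)"
      using sep_transfer(3)[OF sk(2) sep_sides(3)[OF sk(2)]] by blast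
    ultimately show "z \<in> side (k (Suc n)) (b (Suc n))" using z by (simp add: A_def k_def k'_def)
  qed
  have behind: "z \<in> A n" if "z \<in> X" "z \<notin> side (k n) (t n)" for z n
    using precedes_nested[OF sk(1-3) that] sep_sides(5)[OF sk(2)] that(1) by (auto simp: A_def)
  have mono: "A n \<subseteq> A (Suc n)" for n
    using step[of n] behind sep_sides(5)[OF sk(1)[of "Suc n"]] side_subset by blast
  have incr: "A i \<subseteq> side (k m) (b m)" if im: "i < m" for i m
  proof -
    obtain m' where m': "m = Suc m'" using im by (cases m) auto
    hence "A i \<subseteq> A m'" using lift_Suc_mono_le[of A, OF mono] im by simp
    thus ?thesis using step[of m'] m' by blast
  qed
  have b0: "b 0 \<in> side (k m) (b m)" for m
  proof (cases m)
    case 0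
    thus ?thesis using sep_sides(3)[OF sk(1)] by simp
  next
    case (Suc m')
    have "b 0 \<in> A 0" using bt sep_sides(3,5)[OF sk(2)[of 0]] by (auto simp: A_def)
    thus ?thesis using incr[of 0 m] Suc by auto
  qed
  have beyond: "z \<notin> A i" if "i < m" "z \<notin> side (k m) (b m)" for z i m using incr that by blast
  have tn: "t m \<in> side (k i) (t i)" if "i \<le> m" for i m
  proof (cases "i = m")
    case True
    thus ?thesis using sep_sides(4)[OF sk(1)] by simp
  next
    case False
    hence "t m \<notin> A i" using beyond[of i m "t m"] that sep_sides(4,5)[OF sk(1)[of m]] by auto
    thus ?thesis using behind bt by blast
  qed
  have sepk: "sep (k i) (b 0) (t n)" if "i \<le> n" for i using sep_transfer(1)[OF sk(1) b0 tn[OF that]] .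
  have kA: "k i \<subseteq> A i" for i
    using behind sep_sides(8)[OF sk(1)[of i]] curtain_nonempty_subset(2)[OF sep_curtain[OF sk(1)]] by blast
  have knA: "k m \<inter> A i = {}" if "i < m" for i m
    using beyond[OF that] sep_sides(7)[OF sk(1)[of m]] by blast
  have Lsep: "L_separated X d L (k i) (k m)" if im: "i < m" for i m
    unfolding L_separated_def
  proof (intro conjI allI impI)
    show "curtain X d (k i)" "curtain X d (k m)" using sep_curtain sk by blast+
    show "k i \<inter> k m = {}" using kA[of i] knA[OF im] by blast
    fix c assume c: "curtain_chain X d c \<and> (\<forall>m'\<in>c. m' \<inter> k i \<noteq> {} \<and> m' \<inter> k m \<noteq> {})"
    have "m' \<inter> k' i \<noteq> {}" if m': "m' \<in> c" for m'
    proof (rule curtain_connected[OF _ sk(2)])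
      show "curtain X d m'" using c m' by (simp add: curtain_chain_def)
      show "m' \<inter> side (k' i) (b i) \<noteq> {}" using c m' sk(3)[of i] by (auto simp: precedes_def)
      have "k m \<subseteq> side (k' i) (t i)"
        using knA[OF im] curtain_nonempty_subset(2)[OF sep_curtain[OF sk(1)[of m]]] by (auto simp: A_def)
      thus "m' \<inter> side (k' i) (t i) \<noteq> {}" using c m' by blast
    qed
    thus "finite c" "card c \<le> L" using sk(4)[of i] c unfolding L_separated_def by blast+
  qed
  have ne: "k i \<noteq> k m" if "i \<noteq> m" for i m
  proof -
    have "k i \<inter> k m = {}" using Lsep[of i m] Lsep[of m i] that by (auto simp: L_separated_def neq_iff)
    thus ?thesis using curtain_nonempty_subset(1)[OF sep_curtain[OF sk(1)[of i]]] by auto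
  qed
  have "pairwise (L_separated X d L) (k ` {..<n})"
    unfolding pairwise_def using Lsep L_separated_commute by (metis imageE neq_iff)
  hence "L_family L (k ` {..<n}) (b 0) (t n)" using sepk by (auto simp: L_family_def)
  moreover have "card (k ` {..<n}) = n" using ne by (subst card_image) (metis inj_onI, simp)
  ultimately show ?thesis by blast
qed

text \<open>The middle curtain of the family meets \<open>[x,y]\<close> in a point \<open>p\<close>, and
  the curtains before and after it become two families leaving \<open>p\<close> in opposite
  directions.\<close>

lemma split_family:
  assumes c: "L_family L c x y" and card: "2 * N + 1 \<le> card c"
  obtains p c1 c2 where "p \<in> seg x y" "L_family L c1 p x" "card c1 = N" "L_family L c2 p y" "card c2 = N"
proof -
  obtain e where e: "arm L (2 * N + 1) x y e" using L_family_arm[OF c card] by blast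
  have s: "sep (e i) x y" if "i \<le> 2 * N" for i using e that by (simp add: arm_def)
  have pr: "precedes x y (e i) (e j)" if "i < j" "j \<le> 2 * N" for i j using e that by (simp add: arm_def)
  obtain p where p: "p \<in> seg x y" "p \<in> e N" using sep_crossing[OF s[of N]] by auto
  have "sep (e i) p x" if "i \<in> {..<N}" for i
  proof -
    have "p \<in> side (e i) y" using pr[of i N] p(2) that by (auto simp: precedes_def)
    thus ?thesis using sep_transfer(1)[OF s sep_sides(3)[OF s]] that sep_commute by auto
  qed
  hence 1: "L_family L (e ` {..<N}) p x" "card (e ` {..<N}) = N"
    using arm_sub_family(2,3)[OF e, of "{..<N}" p x] by auto
  have right: "sep (e i) p y" if "i \<in> {N<..2 * N}" for i
  proof -
    have "p \<in> side (e i) x" using pr[of N i] p(2) that by (auto simp: precedes_def)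
    thus ?thesis using sep_transfer(1)[OF s _ sep_sides(4)[OF s]] that by auto
  qed
  have 2: "L_family L (e ` {N<..2 * N}) p y" "card (e ` {N<..2 * N}) = N"
    using arm_sub_family(2,3)[OF e _ right, of "{N<..2 * N}"] by (auto simp: subset_iff)
  show thesis using that[OF p(1) 1 2] .
qed

text \<open>The state of the construction is an isometry together with the choice of one of the two halves
  of the block. The next isometry brings the midpoint near the current tip, and
  \<open>straight_angle\<close> selects the half.\<close>

lemma block_growth:
  assumes iso: "\<And>\<psi>. \<psi> \<in> \<G> \<Longrightarrow> isometry \<psi>"
    and dense: "\<And>u v. u \<in> X \<Longrightarrow> v \<in> X \<Longrightarrow> \<exists>\<psi>\<in>\<G>. d (\<psi> u) v \<le> real K"
    and c: "L_family L c x y" and card: "2 * (8 * L + K + 18) + 1 \<le> card c" and X: "x \<in> X" "y \<in> X"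
  shows "\<exists>c u v. u \<in> X \<and> v \<in> X \<and> L_family L c u v \<and> card c = n"
proof -
  define M where "M = 8 * L + K + 18"
  obtain p c1 c2 where p: "p \<in> seg x y" and c1: "L_family L c1 p x" "card c1 = M"
    and c2: "L_family L c2 p y" "card c2 = M"
    using split_family[OF c card] unfolding M_def .
  have pX: "p \<in> X" using p seg_in by auto
  define tip where "tip s = (fst s) (if snd s then x else y)" for s :: "('a \<Rightarrow> 'a) \<times> bool"
  define base where "base s = (fst s) p" for s :: "('a \<Rightarrow> 'a) \<times> bool"
  obtain \<psi>0 where "\<psi>0 \<in> \<G>" using dense[OF X] by blast
  have "\<exists>s. \<forall>n. fst (s n) \<in> \<G> \<and> d (base (s (Suc n))) (tip (s n)) \<le> real K
      \<and> obtuse (tip (s (Suc n))) (base (s (Suc n))) (base (s n))"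
  proof -
    have "\<exists>s'. fst s' \<in> \<G> \<and> (d (base s') (tip s) \<le> real K \<and> obtuse (tip s') (base s') (base s))"
      if s: "fst s \<in> \<G>" for s
    proof -
      have sX: "tip s \<in> X" "base s \<in> X" using isometry_in[OF iso[OF s]] X pX by (auto simp: tip_def base_def)
      obtain \<psi> where \<psi>: "\<psi> \<in> \<G>" "d (\<psi> p) (tip s) \<le> real K" using dense[OF pX sX(1)] by blast
      note i = iso[OF \<psi>(1)]
      have "obtuse (\<psi> x) (\<psi> p) (base s) \<or> obtuse (\<psi> y) (\<psi> p) (base s)"
        using straight_angle[OF isometry_in[OF i X(1)] isometry_in[OF i X(2)] sX(2) isometry_seg[OF i X p]] .
      hence "obtuse (tip (\<psi>, True)) (\<psi> p) (base s) \<or> obtuse (tip (\<psi>, False)) (\<psi> p) (base s)"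
        by (simp add: tip_def)
      thus ?thesis using \<psi> by (auto simp: base_def)
    qed
    thus ?thesis
      using dependent_nat_choice[of "\<lambda>_ s. fst s \<in> \<G>"
          "\<lambda>_ s s'. d (base s') (tip s) \<le> real K \<and> obtuse (tip s') (base s') (base s)"] \<open>\<psi>0 \<in> \<G>\<close>
      by (metis fst_conv)
  qed
  then obtain s where s: "\<And>n. fst (s n) \<in> \<G>" "\<And>n. d (base (s (Suc n))) (tip (s n)) \<le> real K"
      "\<And>n. obtuse (tip (s (Suc n))) (base (s (Suc n))) (base (s n))" by blast
  have "\<exists>e. arm L M (base (s n)) (tip (s n)) e" for n
  proof -
    have "\<exists>c. L_family L c (base (s n)) (tip (s n)) \<and> M \<le> card c"
      using isometry_L_family[OF iso[OF s(1)[of n]] c1(1)] isometry_L_family[OF iso[OF s(1)[of n]] c2(1)] c1(2) c2(2)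
      by (cases "snd (s n)") (auto simp: base_def tip_def)
    thus ?thesis using L_family_arm by metis
  qed
  then obtain e where "\<And>n. arm L M (base (s n)) (tip (s n)) (e n)" by metis
  from concatenation[of L K "\<lambda>n. base (s n)" "\<lambda>n. tip (s n)" e, OF this[unfolded M_def] s(2,3)]
  obtain c where "L_family L c (base (s 0)) (tip (s n)) \<and> card c = n" by blast
  moreover have "base (s 0) \<in> X" "tip (s n) \<in> X"
    using isometry_in[OF iso[OF s(1)]] X pX by (auto simp: base_def tip_def)
  ultimately show ?thesis by blast
qed

text \<open>A long \<open>L\<close>-family still has three members separating the endpoints after these
  have been moved by at most \<open>T\<close> with respect to \<open>d\<^sub>L\<close>, so the moved
  segment passes the same bottleneck.\<close>

lemma shadow:
  assumes c: "L_family L c x y" and card: "2 * T + 5 \<le> card c" and X: "x' \<in> X" "y' \<in> X"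
    and le: "curtain_dist X d L x x' \<le> T" "curtain_dist X d L y' y \<le> T"
  obtains q w where "q \<in> seg x y" "w \<in> seg x' y'" "d q w \<le> 2 * real L + 2"
proof -
  define c' where "c' = {h \<in> c. sep h x' y}"
  have c': "L_family L c' x' y" unfolding c'_def by (rule L_family_restrict[OF c])
  have "card {h \<in> c. sep h x x'} \<le> T"
    using L_family_card_le_dist[OF L_family_restrict[OF c]] le(1) le_trans by blast
  hence "card c \<le> T + card c' + 1" using L_family_split[OF c X(1)] by (simp add: c'_def)
  moreover have "card {h \<in> c'. sep h y' y} \<le> T"
    using L_family_card_le_dist[OF L_family_restrict[OF c']] le(2) le_trans by blast
  hence "card c' \<le> card {h \<in> c'. sep h x' y'} + T + 1" using L_family_split[OF c' X(2)] by simp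
  ultimately have 3: "3 \<le> card {h \<in> c'. sep h x' y'}" using card by linarith
  have fam: "L_family L {h \<in> c'. sep h x' y'} x y" by (rule L_family_subset[OF c]) (auto simp: c'_def)
  obtain e where e: "arm L 3 x y e" "e ` {..<3} \<subseteq> {h \<in> c'. sep h x' y'}" using L_family_arm[OF fam 3] .
  have cross: "seg x' y' \<inter> e i \<noteq> {}" if "i < 3" for i
  proof -
    have "sep (e i) x' y'" using e(2) that by auto
    thus ?thesis using sep_crossing by blast
  qed
  have "sep (e 1) x y" using e(1) by (simp add: arm_def)
  then obtain q where q: "q \<in> seg x y" "q \<in> e 1" using sep_crossing by blast
  have g: "gate L x y (e 0) (e 1) (e 2)" using arm_gate[OF e(1), of 0 1 2] by simp
  obtain w where "w \<in> seg x' y'" "d q w \<le> 2 * real L + 2"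
    using gate_bottleneck[OF g X cross cross cross q] by auto
  thus thesis using that q by blast
qed

text \<open>On both sides of the midpoint \<open>p\<close> the geodesic from \<open>\<psi> x\<close> to
  \<open>\<psi> y\<close> comes back near \<open>[x,y]\<close>, and \<open>\<psi> p\<close> lies on it
  between these two places. The bound depends only on \<open>L\<close> and the segment
  \<open>[x,y]\<close>.\<close>

lemma displacement_bound:
  assumes c: "L_family L c x y" and card: "4 * T + 11 \<le> card c" and X: "x \<in> X" "y \<in> X"
  obtains p B where "p \<in> X"
    "\<And>\<psi>. isometry \<psi> \<Longrightarrow> (\<And>z. z \<in> X \<Longrightarrow> curtain_dist X d L (\<psi> z) z \<le> T) \<Longrightarrow> d (\<psi> p) p \<le> B"
proof -
  have "2 * (2 * T + 5) + 1 \<le> card c" using card by simp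
  then obtain p c1 c2 where p: "p \<in> seg x y" and c1: "L_family L c1 p x" "card c1 = 2 * T + 5"
    and c2: "L_family L c2 p y" "card c2 = 2 * T + 5"
    using split_family[OF c] by metis
  have pX: "p \<in> X" using p seg_in by auto
  show thesis
  proof (rule that[OF pX])
    fix \<psi> assume i: "isometry \<psi>" and T: "\<And>z. z \<in> X \<Longrightarrow> curtain_dist X d L (\<psi> z) z \<le> T"
    note \<psi>X = isometry_in[OF i]
    have T': "curtain_dist X d L z (\<psi> z) \<le> T" if "z \<in> X" for z
      using T[OF that] by (simp add: curtain_dist_commute)
    obtain q w where q: "q \<in> seg p x" "w \<in> seg (\<psi> p) (\<psi> x)" "d q w \<le> 2 * real L + 2"
      using shadow[OF c1(1) _ \<psi>X[OF pX] \<psi>X[OF X(1)] T'[OF pX] T[OF X(1)]] c1(2) by auto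
    obtain q' w' where q': "q' \<in> seg p y" "w' \<in> seg (\<psi> p) (\<psi> y)" "d q' w' \<le> 2 * real L + 2"
      using shadow[OF c2(1) _ \<psi>X[OF pX] \<psi>X[OF X(2)] T'[OF pX] T[OF X(2)]] c2(2) by auto
    have XX: "q \<in> X" "w \<in> X" "q' \<in> X" "w' \<in> X" "\<psi> p \<in> X" "\<psi> x \<in> X" "\<psi> y \<in> X"
      using q q' seg_in \<psi>X X pX by auto
    have "w \<in> seg (\<psi> x) (\<psi> p)" using q(2) by (simp add: seg_commute)
    hence "\<psi> p \<in> seg w (\<psi> y)" using seg_trans(2)[OF XX(6,7) isometry_seg[OF i X p]] by blast
    hence "\<psi> p \<in> seg w w'" using seg_trans'(2)[OF XX(2,7) _ q'(2)] by blast
    hence 1: "d w (\<psi> p) \<le> d w w'" by (rule seg_dist_le)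
    have 2: "d w w' \<le> d w q + d q w'" "d q w' \<le> d q p + d p w'" "d p w' \<le> d p q' + d q' w'"
      "d (\<psi> p) p \<le> d (\<psi> p) w + d w p" "d w p \<le> d w q + d q p"
      using XX pX triangle by blast+
    have 3: "d p q \<le> d p x" "d p q' \<le> d p y" using seg_dist_le(1) q(1) q'(1) by auto
    have "d w q \<le> 2 * real L + 2" using q(3) by (simp add: commute)
    moreover have "d (\<psi> p) w = d w (\<psi> p)" "d q p = d p q" by (simp_all add: commute)
    ultimately show "d (\<psi> p) p \<le> 2 * d p x + d p y + 3 * (2 * real L + 2)"
      using 1 2 3 q'(3) by argo
  qed
qed

end

section \<open>The metric of the curtain model\<close>

locale curtain_model = cat0_space X d for X :: "'a set" and d +
  fixes w :: "nat \<Rightarrow> real"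
  assumes weights: "admissible_weights w"
begin

abbreviation D :: "'a \<Rightarrow> 'a \<Rightarrow> real" where "D \<equiv> curtain_model_dist X d w"

lemma weight_pos: "0 < w (Suc n)"
  using weights by (simp add: admissible_weights_def)

lemma weights_summable: "summable (\<lambda>n. w (Suc n))"
proof (rule summable_comparison_test'[where N = 0])
  show "summable (\<lambda>n. real (Suc n) ^ 2 * w (Suc n))" using weights by (simp add: admissible_weights_def)
  show "norm (w (Suc n)) \<le> real (Suc n) ^ 2 * w (Suc n)" for n
    using weight_pos[of n] mult_right_mono[of 1 "real (Suc n) ^ 2" "w (Suc n)"] by simp
qed

lemma D_summable: "summable (\<lambda>n. w (Suc n) * real (curtain_dist X d (Suc n) x y))"
proof (rule summable_comparison_test'[where N = 0])
  show "summable (\<lambda>n. w (Suc n) * (d x y + 2))" using weights_summable by (rule summable_mult2)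
  show "norm (w (Suc n) * real (curtain_dist X d (Suc n) x y)) \<le> w (Suc n) * (d x y + 2)" for n
    using weight_pos[of n] curtain_dist_bound[of "Suc n" x y] by (simp add: abs_mult)
qed

lemma D_ge: "w (Suc n) * real (curtain_dist X d (Suc n) x y) \<le> D x y"
  unfolding curtain_model_dist_def
  using sum_le_suminf[OF D_summable[of x y], of "{n}"] weight_pos by (simp add: less_imp_le)

lemma D_le: "D x y \<le> (\<Sum>n. w (Suc n)) * (d x y + 2)"
proof -
  have "D x y \<le> (\<Sum>n. w (Suc n) * (d x y + 2))"
    unfolding curtain_model_dist_def
    using weight_pos curtain_dist_bound summable_mult2[OF weights_summable]
    by (intro suminf_le D_summable) (auto intro: mult_left_mono less_imp_le)
  thus ?thesis using suminf_mult2[OF weights_summable] by simp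
qed

lemma D_metric: "Metric_space X D"
proof
  show "0 \<le> D x y" for x y using order_trans[OF _ D_ge[of 0 x y]] weight_pos[of 0] by simp
  show "D x y = D y x" for x y by (simp add: curtain_model_dist_def curtain_dist_commute)
  show "D x y = 0 \<longleftrightarrow> x = y" for x y
  proof
    assume D0: "D x y = 0"
    show "x = y"
    proof (rule ccontr)
      assume "x \<noteq> y"
      hence "1 \<le> real (curtain_dist X d (Suc 0) x y)" by (simp add: curtain_dist_def)
      hence "w (Suc 0) * 1 \<le> w (Suc 0) * real (curtain_dist X d (Suc 0) x y)"
        using weight_pos[of 0] by (intro mult_left_mono) auto
      thus False using D_ge[of 0 x y] D0 weight_pos[of 0] by linarith
    qed
  qed (simp add: curtain_model_dist_def curtain_dist_def)
  show "D x z \<le> D x y + D y z" if "y \<in> X" for x y z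
    unfolding curtain_model_dist_def suminf_add[OF D_summable D_summable]
  proof (rule suminf_le[OF _ D_summable summable_add[OF D_summable D_summable]])
    show "w (Suc n) * real (curtain_dist X d (Suc n) x z)
      \<le> w (Suc n) * real (curtain_dist X d (Suc n) x y) + w (Suc n) * real (curtain_dist X d (Suc n) y z)" for n
    proof -
      have "real (curtain_dist X d (Suc n) x z)
          \<le> real (curtain_dist X d (Suc n) x y) + real (curtain_dist X d (Suc n) y z)"
        using curtain_dist_triangle[OF that, of "Suc n" x z] by linarith
      from mult_left_mono[OF this, of "w (Suc n)"] weight_pos[of n] show ?thesis
        by (simp add: distrib_left)
    qed
  qed
qed

lemma D_bounded_iff: "Metric_space.mbounded X D X \<longleftrightarrow> (\<exists>B. \<forall>x\<in>X. \<forall>y\<in>X. D x y \<le> B)"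
  using Metric_space.mbounded_alt[OF D_metric] by auto

lemma D_isometry: "isometry \<psi> \<Longrightarrow> x \<in> X \<Longrightarrow> y \<in> X \<Longrightarrow> D (\<psi> x) (\<psi> y) = D x y"
  by (simp add: curtain_model_dist_def isometry_curtain_dist)

text \<open>The summability of \<open>L\<^sup>2 \<lambda>\<^sub>L\<close> allows \<open>d\<^sub>L\<close>
  to grow quadratically in \<open>L\<close>.\<close>

lemma D_bounded:
  assumes "\<And>n x y. x \<in> X \<Longrightarrow> y \<in> X \<Longrightarrow> real (curtain_dist X d (Suc n) x y) \<le> A * real (Suc n) ^ 2"
  shows "Metric_space.mbounded X D X"
proof -
  have s: "summable (\<lambda>n. real (Suc n) ^ 2 * w (Suc n))" using weights by (simp add: admissible_weights_def)
  have "D x y \<le> (\<Sum>n. A * (real (Suc n) ^ 2 * w (Suc n)))" if "x \<in> X" "y \<in> X" for x y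
    unfolding curtain_model_dist_def
  proof (rule suminf_le[OF _ D_summable summable_mult[OF s]])
    show "w (Suc n) * real (curtain_dist X d (Suc n) x y) \<le> A * (real (Suc n) ^ 2 * w (Suc n))" for n
      using mult_left_mono[OF assms[OF that, of n], of "w (Suc n)"] weight_pos[of n]
      by (simp add: algebra_simps)
  qed
  thus ?thesis using D_bounded_iff by blast
qed

end

section \<open>Geometric actions\<close>

locale geometric_cat0 = cat0_space X d + group G
  for X :: "'a set" and d :: "'a \<Rightarrow> 'a \<Rightarrow> real" and G :: "('g, 'm) monoid_scheme" (structure) +
  fixes \<phi> :: "'g \<Rightarrow> 'a \<Rightarrow> 'a"
  assumes geometric: "geometric_action G X d \<phi>"
begin

lemma action: "group_action G X \<phi>"
  using geometric by (simp add: geometric_action_def isometric_action_def)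

lemma act_in: "g \<in> carrier G \<Longrightarrow> x \<in> X \<Longrightarrow> \<phi> g x \<in> X"
  using group_action.element_image[OF action] by blast

lemma act_mult: "g \<in> carrier G \<Longrightarrow> h \<in> carrier G \<Longrightarrow> x \<in> X \<Longrightarrow> \<phi> (g \<otimes> h) x = \<phi> g (\<phi> h x)"
  using group_action.composition_rule[OF action] by blast

lemma act_inv: "g \<in> carrier G \<Longrightarrow> x \<in> X \<Longrightarrow> \<phi> (inv g) (\<phi> g x) = x"
  using group_action.orbit_sym_aux[OF action] by blast

lemma act_dist: "g \<in> carrier G \<Longrightarrow> x \<in> X \<Longrightarrow> y \<in> X \<Longrightarrow> d (\<phi> g x) (\<phi> g y) = d x y"
  using geometric by (simp add: geometric_action_def isometric_action_def)

lemma act_isometry: "g \<in> carrier G \<Longrightarrow> isometry (\<phi> g)"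
  using group_action.inj_prop[OF action] group_action.surj_prop[OF action] act_dist
  by (simp add: isometry_def bij_betw_def)

lemma act_conj_dist:
  assumes "g \<in> carrier G" "a \<in> carrier G" "x \<in> X"
  shows "d (\<phi> (inv a \<otimes> g \<otimes> a) x) x = d (\<phi> g (\<phi> a x)) (\<phi> a x)"
proof -
  have "\<phi> (inv a \<otimes> g \<otimes> a) x = \<phi> (inv a) (\<phi> g (\<phi> a x))"
    using assms by (simp add: act_mult act_in)
  moreover have "d (\<phi> (inv a) (\<phi> g (\<phi> a x))) (\<phi> (inv a) (\<phi> a x)) = d (\<phi> g (\<phi> a x)) (\<phi> a x)"
    using assms by (intro act_dist) (auto intro: act_in)
  ultimately show ?thesis using assms by (simp add: act_inv)
qed

text \<open>\<open>K\<close> bounds the diameter of a compact set whose translates cover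
  \<open>X\<close>.\<close>

lemma coarsely_transitive:
  obtains K :: nat where "\<And>x y. x \<in> X \<Longrightarrow> y \<in> X \<Longrightarrow> \<exists>g\<in>carrier G. d (\<phi> g x) y \<le> real K"
proof -
  obtain C where C: "compactin mtopology C" "(\<Union>g\<in>carrier G. \<phi> g ` C) = X"
    using geometric unfolding geometric_action_def cocompact_action_def by blast
  have CX: "C \<subseteq> X" using compactin_subset_topspace[OF C(1)] by simp
  obtain B where B: "\<And>x y. x \<in> C \<Longrightarrow> y \<in> C \<Longrightarrow> d x y \<le> B"
    using compactin_imp_mbounded[OF C(1)] unfolding mbounded_alt by blast
  obtain K :: nat where K: "B \<le> real K" using real_arch_simple by blast
  have "\<exists>g\<in>carrier G. d (\<phi> g x) y \<le> real K" if xy: "x \<in> X" "y \<in> X" for x y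
  proof -
    obtain g u where g: "g \<in> carrier G" "u \<in> C" "x = \<phi> g u" using C(2) xy by blast
    obtain h v where h: "h \<in> carrier G" "v \<in> C" "y = \<phi> h v" using C(2) xy by blast
    have X: "u \<in> X" "v \<in> X" using g h CX by auto
    have "\<phi> (h \<otimes> inv g) x = \<phi> h u" using g(1,3) h(1) X xy by (simp add: act_mult act_inv)
    hence "d (\<phi> (h \<otimes> inv g) x) y = d u v" using h X act_dist by simp
    also have "\<dots> \<le> real K" using B[OF g(2) h(2)] K by simp
    finally show ?thesis using g(1) h(1) by blast
  qed
  thus thesis by (rule that)
qed

text \<open>The displacement of \<open>g\<close> at \<open>a p\<close> is that of a conjugate at
  \<open>p\<close>, and every point is within \<open>K\<close> of some \<open>a p\<close>.\<close>

lemma displacement_via_conjugates: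
  assumes K: "\<And>x y. x \<in> X \<Longrightarrow> y \<in> X \<Longrightarrow> \<exists>g\<in>carrier G. d (\<phi> g x) y \<le> real K"
    and p: "p \<in> X" and g: "g \<in> carrier G"
    and B: "\<And>a. a \<in> carrier G \<Longrightarrow> d (\<phi> (inv a \<otimes> g \<otimes> a) p) p \<le> B"
  shows "g \<in> coarse_kernel G X d \<phi>"
proof -
  have "d (\<phi> g z) z \<le> max 1 (2 * real K + B)" if z: "z \<in> X" for z
  proof -
    obtain a where a: "a \<in> carrier G" "d (\<phi> a p) z \<le> real K" using K[OF p z] by blast
    have X: "\<phi> a p \<in> X" "\<phi> g z \<in> X" "\<phi> g (\<phi> a p) \<in> X" using a g p z act_in by auto
    have "d (\<phi> g z) z \<le> d (\<phi> g z) (\<phi> g (\<phi> a p)) + d (\<phi> g (\<phi> a p)) z"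
      "d (\<phi> g (\<phi> a p)) z \<le> d (\<phi> g (\<phi> a p)) (\<phi> a p) + d (\<phi> a p) z"
      using X z triangle by blast+
    moreover have "d (\<phi> g z) (\<phi> g (\<phi> a p)) \<le> real K" using act_dist[OF g z X(1)] a(2) by (simp add: commute)
    moreover have "d (\<phi> g (\<phi> a p)) (\<phi> a p) \<le> B" using B[OF a(1)] act_conj_dist[OF g a(1) p] by simp
    ultimately show ?thesis using a(2) by linarith
  qed
  moreover have "0 < max 1 (2 * real K + B)" by linarith
  ultimately show ?thesis unfolding coarse_kernel_def using g by blast
qed

lemma base_point: obtains x where "x \<in> X"
  using cat0 unfolding CAT0_space_def by blast

lemma center_in: "z \<in> group_center G \<Longrightarrow> z \<in> carrier G"
  and center_commute: "z \<in> group_center G \<Longrightarrow> g \<in> carrier G \<Longrightarrow> z \<otimes> g = g \<otimes> z"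
  by (simp_all add: group_center_def)

lemma conj_eq_iff:
  assumes "s \<in> carrier G" "a \<in> carrier G" "b \<in> carrier G"
  shows "inv a \<otimes> s \<otimes> a = inv b \<otimes> s \<otimes> b \<longleftrightarrow> (a \<otimes> inv b) \<otimes> s = s \<otimes> (a \<otimes> inv b)"
proof
  assume e: "inv a \<otimes> s \<otimes> a = inv b \<otimes> s \<otimes> b"
  have "s \<otimes> (a \<otimes> inv b) = a \<otimes> (inv a \<otimes> s \<otimes> a) \<otimes> inv b"
    using assms by (simp add: m_assoc inv_solve_left' r_inv l_inv flip: m_assoc)
  also have "\<dots> = a \<otimes> (inv b \<otimes> s \<otimes> b) \<otimes> inv b" by (simp add: e)
  also have "\<dots> = (a \<otimes> inv b) \<otimes> s" using assms by (simp add: m_assoc)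
  finally show "(a \<otimes> inv b) \<otimes> s = s \<otimes> (a \<otimes> inv b)" by simp
next
  assume e: "(a \<otimes> inv b) \<otimes> s = s \<otimes> (a \<otimes> inv b)"
  have "inv b \<otimes> s \<otimes> b = inv a \<otimes> ((a \<otimes> inv b) \<otimes> s) \<otimes> b"
    using assms by (simp add: m_assoc inv_solve_left' flip: m_assoc)
  also have "\<dots> = inv a \<otimes> (s \<otimes> (a \<otimes> inv b)) \<otimes> b" by (simp add: e)
  also have "\<dots> = inv a \<otimes> s \<otimes> a" using assms by (simp add: m_assoc)
  finally show "inv a \<otimes> s \<otimes> a = inv b \<otimes> s \<otimes> b" by simp
qed

lemma center_subgroup: "subgroup (group_center G) G"
proof (rule subgroupI)
  show "group_center G \<subseteq> carrier G" using center_in by blast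
  have "\<one> \<in> group_center G" by (simp add: group_center_def)
  thus "group_center G \<noteq> {}" by blast
  fix u assume u: "u \<in> group_center G"
  note uG = center_in[OF u]
  show "inv u \<in> group_center G"
  proof -
    have "inv u \<otimes> g = g \<otimes> inv u" if g: "g \<in> carrier G" for g
    proof -
      have "inv u \<otimes> g = inv u \<otimes> (g \<otimes> u) \<otimes> inv u" using uG g by (simp add: m_assoc)
      also have "\<dots> = inv u \<otimes> (u \<otimes> g) \<otimes> inv u" by (simp add: center_commute[OF u g])
      also have "\<dots> = g \<otimes> inv u" using uG g by (simp add: m_assoc[symmetric])
      finally show ?thesis .
    qed
    thus ?thesis using uG by (simp add: group_center_def)
  qed
  fix v assume v: "v \<in> group_center G"
  note vG = center_in[OF v]
  have "u \<otimes> v \<otimes> g = g \<otimes> (u \<otimes> v)" if g: "g \<in> carrier G" for g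
  proof -
    have "u \<otimes> v \<otimes> g = u \<otimes> (v \<otimes> g)" using uG vG g by (simp add: m_assoc)
    also have "\<dots> = u \<otimes> g \<otimes> v" using uG vG g by (simp add: center_commute[OF v g] m_assoc)
    also have "\<dots> = g \<otimes> (u \<otimes> v)" using uG vG g by (simp add: center_commute[OF u g] m_assoc)
    finally show ?thesis .
  qed
  thus "u \<otimes> v \<in> group_center G" using uG vG by (simp add: group_center_def)
qed

text \<open>The conjugate of \<open>g\<close> by \<open>a\<close> depends only on the coset of
  \<open>a\<close>, so \<open>g\<close> has finitely many conjugates.\<close>

lemma finite_index_center_imp_kernel:
  assumes fin: "finite_index G (group_center G)"
  shows "coarse_kernel G X d \<phi> = carrier G"
proof
  show "carrier G \<subseteq> coarse_kernel G X d \<phi>"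
  proof
    fix g assume g: "g \<in> carrier G"
    obtain x where x: "x \<in> X" by (rule base_point)
    obtain K :: nat where K: "\<And>x y. x \<in> X \<Longrightarrow> y \<in> X \<Longrightarrow> \<exists>g\<in>carrier G. d (\<phi> g x) y \<le> real K"
      using coarsely_transitive by blast
    define f where "f c = (SOME r. r \<in> c)" for c :: "'g set"
    have conj: "\<exists>r\<in>f ` (rcosets group_center G). inv a \<otimes> g \<otimes> a = inv r \<otimes> g \<otimes> r" if a: "a \<in> carrier G" for a
    proof -
      let ?c = "group_center G #> a"
      have "\<one> \<otimes> a \<in> ?c" unfolding r_coset_def group_center_def by force
      hence "f ?c \<in> ?c" unfolding f_def by (rule someI)
      then obtain z where z: "z \<in> group_center G" "f ?c = z \<otimes> a" unfolding r_coset_def by auto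
      have "z \<otimes> a \<otimes> inv a = z" using a center_in[OF z(1)] by (simp add: m_assoc)
      hence "inv (z \<otimes> a) \<otimes> g \<otimes> (z \<otimes> a) = inv a \<otimes> g \<otimes> a"
        using conj_eq_iff[of g "z \<otimes> a" a] center_commute[OF z(1) g] center_in[OF z(1)] a g by simp
      moreover have "?c \<in> rcosets group_center G" using a unfolding RCOSETS_def by blast
      ultimately show ?thesis using z(2) by (metis imageI)
    qed
    define B where "B = Max ((\<lambda>r. d (\<phi> (inv r \<otimes> g \<otimes> r) x) x) ` f ` (rcosets group_center G))"
    have finite: "finite ((\<lambda>r. d (\<phi> (inv r \<otimes> g \<otimes> r) x) x) ` f ` (rcosets group_center G))"
      using fin by (simp add: finite_index_def)
    have "d (\<phi> (inv a \<otimes> g \<otimes> a) x) x \<le> B" if a: "a \<in> carrier G" for a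
    proof -
      obtain r where "r \<in> f ` (rcosets group_center G)" "inv a \<otimes> g \<otimes> a = inv r \<otimes> g \<otimes> r" using conj[OF a] by blast
      thus ?thesis unfolding B_def by (intro Max_ge[OF finite]) auto
    qed
    thus "g \<in> coarse_kernel G X d \<phi>" using displacement_via_conjugates[OF K x g] by blast
  qed
qed (auto simp: coarse_kernel_def)

text \<open>The elements of displacement at most \<open>2 K + 1\<close> at \<open>x\<close> generate
  \<open>G\<close> (the argument of Milnor and Schwarz): if \<open>g\<close> is not one of them, go back
  from \<open>g x\<close> towards \<open>x\<close> and pass to an element \<open>h\<close> with \<open>h
  x\<close> near the point reached.\<close>

lemma commutes_with_short_imp_central:
  assumes K: "\<And>x y. x \<in> X \<Longrightarrow> y \<in> X \<Longrightarrow> \<exists>g\<in>carrier G. d (\<phi> g x) y \<le> real K"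
    and x: "x \<in> X" and c: "c \<in> carrier G"
    and comm: "\<And>s. s \<in> carrier G \<Longrightarrow> d (\<phi> s x) x \<le> 2 * real K + 1 \<Longrightarrow> c \<otimes> s = s \<otimes> c"
  shows "c \<in> group_center G"
proof -
  have "c \<otimes> g = g \<otimes> c" if "g \<in> carrier G" "d x (\<phi> g x) \<le> real n" for n g
    using that
  proof (induction n arbitrary: g)
    case 0
    thus ?case using comm[of g] by (simp add: commute)
  next
    case (Suc n)
    show ?case
    proof (cases "d x (\<phi> g x) \<le> real K + 1")
      case True
      hence "d (\<phi> g x) x \<le> 2 * real K + 1" using commute[of "\<phi> g x" x] by simp
      thus ?thesis using comm Suc.prems(1) by blast
    next
      case False
      have gx: "\<phi> g x \<in> X" using act_in[OF Suc.prems(1) x] .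
      \<comment> \<open>Going back by \<open>K + 1\<close> leaves a gain of 1 after the error \<open>K\<close> in approximating \<open>q\<close> by an orbit point.\<close>
      obtain q where q: "q \<in> seg x (\<phi> g x)" "d x q = d x (\<phi> g x) - (real K + 1)"
        using seg_point[OF x gx, of "d x (\<phi> g x) - (real K + 1)"] False by auto
      have qX: "q \<in> X" using q seg_in by blast
      have qg: "d q (\<phi> g x) = real K + 1" using q by (simp add: seg_def)
      obtain h where h: "h \<in> carrier G" "d (\<phi> h x) q \<le> real K" using K[OF x qX] by blast
      have hx: "\<phi> h x \<in> X" using act_in[OF h(1) x] .
      have "d x (\<phi> h x) \<le> d x q + d q (\<phi> h x)" using x qX hx triangle by blast
      hence "d x (\<phi> h x) \<le> real n" using q(2) h(2) Suc.prems(2) commute[of q "\<phi> h x"] by simp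
      hence ch: "c \<otimes> h = h \<otimes> c" using Suc.IH h(1) by blast
      define s where "s = inv h \<otimes> g"
      have s: "s \<in> carrier G" using h Suc.prems by (simp add: s_def)
      have "\<phi> h (\<phi> s x) = \<phi> g x"
        using h(1) s Suc.prems(1) x by (simp add: s_def m_assoc[symmetric] flip: act_mult)
      hence "d (\<phi> s x) x = d (\<phi> g x) (\<phi> h x)" using act_dist[OF h(1) act_in[OF s x] x] by simp
      also have "\<dots> \<le> d (\<phi> g x) q + d q (\<phi> h x)" using gx qX hx triangle by blast
      finally have "d (\<phi> s x) x \<le> 2 * real K + 1"
        using qg h(2) commute[of q "\<phi> h x"] commute[of q "\<phi> g x"] by simp
      hence cs: "c \<otimes> s = s \<otimes> c" using comm s by blast
      have g: "g = h \<otimes> s" using h Suc.prems by (simp add: s_def m_assoc[symmetric])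
      have "c \<otimes> (h \<otimes> s) = (c \<otimes> h) \<otimes> s" using c h(1) s by (simp add: m_assoc)
      also have "\<dots> = h \<otimes> (c \<otimes> s)" using c h(1) s by (simp add: ch m_assoc)
      also have "\<dots> = (h \<otimes> s) \<otimes> c" using c h(1) s by (simp add: cs m_assoc)
      finally show ?thesis using g by simp
    qed
  qed
  thus ?thesis using c real_arch_simple unfolding group_center_def by blast
qed

text \<open>The coset of \<open>a\<close> modulo the center is determined by the conjugates by
  \<open>a\<close> of the finitely many generators, and each of these ranges over a finite conjugacy
  class.\<close>

lemma kernel_imp_finite_index_center:
  assumes ker: "coarse_kernel G X d \<phi> = carrier G"
  shows "finite_index G (group_center G)"
proof -
  obtain x where x: "x \<in> X" by (rule base_point)
  obtain K :: nat where K: "\<And>x y. x \<in> X \<Longrightarrow> y \<in> X \<Longrightarrow> \<exists>g\<in>carrier G. d (\<phi> g x) y \<le> real K"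
    using coarsely_transitive by blast
  have pd: "finite {g \<in> carrier G. d (\<phi> g x) x \<le> r}" if "0 < r" for r
    using geometric x that unfolding geometric_action_def properly_discontinuous_def by blast
  \<comment> \<open>a finite generating set\<close>
  define S where "S = {s \<in> carrier G. d (\<phi> s x) x \<le> 2 * real K + 1}"
  have S: "finite S" "S \<subseteq> carrier G" using pd[of "2 * real K + 1"] by (auto simp: S_def)
  define conj where "conj s = (\<lambda>a. inv a \<otimes> s \<otimes> a) ` carrier G" for s
  have conj: "finite (conj s)" if s: "s \<in> S" for s
  proof -
    have sG: "s \<in> carrier G" using s S by auto
    obtain C where C: "0 < C" "\<And>z. z \<in> X \<Longrightarrow> d (\<phi> s z) z \<le> C"
      using ker sG unfolding coarse_kernel_def by blast
    have "conj s \<subseteq> {g \<in> carrier G. d (\<phi> g x) x \<le> C}"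
      using sG act_conj_dist[OF sG _ x] C(2) act_in x by (auto simp: conj_def)
    thus ?thesis using pd[OF C(1)] finite_subset by blast
  qed
  define f where "f a = restrict (\<lambda>s. inv a \<otimes> s \<otimes> a) S" for a
  have "f ` carrier G \<subseteq> PiE S conj" by (auto simp: f_def conj_def)
  hence fin: "finite (f ` carrier G)" using finite_PiE[OF S(1), of conj] conj finite_subset by blast
  have coset: "group_center G #> a = group_center G #> b"
    if ab: "a \<in> carrier G" "b \<in> carrier G" "f a = f b" for a b
  proof -
    have "inv a \<otimes> s \<otimes> a = inv b \<otimes> s \<otimes> b" if "s \<in> S" for s
      using fun_cong[OF ab(3), of s] that by (simp add: f_def)
    hence "(a \<otimes> inv b) \<otimes> s = s \<otimes> (a \<otimes> inv b)" if "s \<in> S" for s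
      using conj_eq_iff[of s a b] that S ab by auto
    hence z: "a \<otimes> inv b \<in> group_center G"
      using commutes_with_short_imp_central[OF K x] ab by (auto simp: S_def)
    show ?thesis
      using coset_mult_inv1[OF coset_join2[OF _ center_subgroup z]] ab center_in by blast
  qed
  have "rcosets (group_center G) \<subseteq> (\<lambda>v. group_center G #> (SOME b. b \<in> carrier G \<and> f b = v)) ` f ` carrier G"
  proof
    fix c assume "c \<in> rcosets (group_center G)"
    then obtain a where a: "a \<in> carrier G" "c = group_center G #> a" unfolding RCOSETS_def by blast
    define b where "b = (SOME b. b \<in> carrier G \<and> f b = f a)"
    have "b \<in> carrier G \<and> f b = f a" unfolding b_def by (rule someI[of _ a]) (use a in auto)
    hence "c = group_center G #> b" using coset a by metis
    thus "c \<in> (\<lambda>v. group_center G #> (SOME b. b \<in> carrier G \<and> f b = v)) ` f ` carrier G"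
      using a(1) b_def by blast
  qed
  thus ?thesis unfolding finite_index_def using fin finite_subset by blast
qed

end

section \<open>The two coarse kernels\<close>

locale geometric_curtain_model = geometric_cat0 X d G \<phi> + curtain_model X d w
  for X :: "'a set" and d :: "'a \<Rightarrow> 'a \<Rightarrow> real" and G :: "('g, 'm) monoid_scheme" (structure)
    and \<phi> :: "'g \<Rightarrow> 'a \<Rightarrow> 'a" and w :: "nat \<Rightarrow> real"
begin

lemma kernel_subset: "coarse_kernel G X d \<phi> \<subseteq> coarse_kernel G X D \<phi>"
proof
  fix g assume "g \<in> coarse_kernel G X d \<phi>"
  then obtain C where g: "g \<in> carrier G" "0 < C" and C: "\<And>z. z \<in> X \<Longrightarrow> d (\<phi> g z) z \<le> C"
    unfolding coarse_kernel_def by blast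
  define W where "W = (\<Sum>n. w (Suc n))"
  have W: "0 < W" unfolding W_def using weight_pos by (intro suminf_pos weights_summable)
  have "D (\<phi> g z) z \<le> W * (C + 2)" if "z \<in> X" for z
  proof -
    have "W * (d (\<phi> g z) z + 2) \<le> W * (C + 2)" using C[OF that] W by (intro mult_left_mono) auto
    thus ?thesis using D_le[of "\<phi> g z" z] unfolding W_def by linarith
  qed
  moreover have "0 < W * (C + 2)" using W g by simp
  ultimately show "g \<in> coarse_kernel G X D \<phi>" unfolding coarse_kernel_def using g by blast
qed

text \<open>One sufficiently long block exists because \<open>D\<close> would otherwise be bounded by
  \<open>D_bounded\<close>; \<open>block_growth\<close> then extends it at the same
  \<open>L\<close>.\<close>

lemma unbounded_imp_long_chains:
  assumes unb: "\<not> Metric_space.mbounded X D X"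
  obtains L where "\<And>n. \<exists>c x y. x \<in> X \<and> y \<in> X \<and> L_family (Suc L) c x y \<and> card c = n"
proof -
  obtain K :: nat where K: "\<And>x y. x \<in> X \<Longrightarrow> y \<in> X \<Longrightarrow> \<exists>g\<in>carrier G. d (\<phi> g x) y \<le> real K"
    using coarsely_transitive by blast
  \<comment> \<open>\<open>A * L\<close> exceeds the length \<open>2 (8 L + K + 18) + 1\<close> of a block for every \<open>L \<ge> 1\<close>.\<close>
  define A where "A = real (2 * K + 54)"
  obtain L x y where xy: "x \<in> X" "y \<in> X" and big: "A * real (Suc L) ^ 2 < real (curtain_dist X d (Suc L) x y)"
    using D_bounded[of A] unb by (meson not_le)
  have "A * real (Suc L) \<le> A * real (Suc L) ^ 2" 
    by (intro mult_left_mono) (auto simp: A_def power2_eq_square)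
  moreover have "real (2 * (8 * Suc L + K + 18) + 1) + 1 \<le> A * real (Suc L)"
    by (simp add: A_def algebra_simps)
  ultimately have bigger: "2 * (8 * Suc L + K + 18) + 1 + 1 < curtain_dist X d (Suc L) x y"
    using big by linarith
  obtain c where c: "L_family (Suc L) c x y" "curtain_dist X d (Suc L) x y = (if x = y then 0 else 1 + card c)"
    using L_family_attained .
  have card: "2 * (8 * Suc L + K + 18) + 1 \<le> card c" using bigger c(2) by (auto split: if_splits)
  have "\<exists>c u v. u \<in> X \<and> v \<in> X \<and> L_family (Suc L) c u v \<and> card c = n" for n
    by (rule block_growth[of "\<phi> ` carrier G" K, OF _ _ c(1) card xy]) (use act_isometry K in auto)
  thus thesis by (rule that)
qed

text \<open>Passing to a conjugate of \<open>g\<close> changes neither the bound on its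
  \<open>D\<close>-displacement nor, therefore, the bound that \<open>displacement_bound\<close> gives at
  the point \<open>p\<close>.\<close>

lemma kernel_superset:
  assumes unb: "\<not> Metric_space.mbounded X D X"
  shows "coarse_kernel G X D \<phi> \<subseteq> coarse_kernel G X d \<phi>"
proof
  fix g assume "g \<in> coarse_kernel G X D \<phi>"
  then obtain C where g: "g \<in> carrier G" and C: "\<And>z. z \<in> X \<Longrightarrow> D (\<phi> g z) z \<le> C"
    unfolding coarse_kernel_def by blast
  obtain K :: nat where K: "\<And>x y. x \<in> X \<Longrightarrow> y \<in> X \<Longrightarrow> \<exists>g\<in>carrier G. d (\<phi> g x) y \<le> real K"
    using coarsely_transitive by blast
  obtain L where L: "\<And>n. \<exists>c x y. x \<in> X \<and> y \<in> X \<and> L_family (Suc L) c x y \<and> card c = n"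
    using unbounded_imp_long_chains[OF unb] by blast
  obtain T :: nat where T: "C / w (Suc L) \<le> real T" using real_arch_simple by blast
  obtain c x y where c: "L_family (Suc L) c x y" "4 * T + 11 \<le> card c" "x \<in> X" "y \<in> X"
    using L[of "4 * T + 11"] by (metis order_refl)
  obtain p B where p: "p \<in> X" and
    B: "\<And>\<psi>. isometry \<psi> \<Longrightarrow> (\<And>z. z \<in> X \<Longrightarrow> curtain_dist X d (Suc L) (\<psi> z) z \<le> T) \<Longrightarrow> d (\<psi> p) p \<le> B"
    using displacement_bound[OF c] by blast
  have "d (\<phi> (inv a \<otimes> g \<otimes> a) p) p \<le> B" if a: "a \<in> carrier G" for a
  proof (rule B)
    show "isometry (\<phi> (inv a \<otimes> g \<otimes> a))" using a g by (intro act_isometry) simp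
    fix z assume z: "z \<in> X"
    have az: "\<phi> a z \<in> X" "\<phi> g (\<phi> a z) \<in> X" using a g z act_in by auto
    have e: "\<phi> (inv a \<otimes> g \<otimes> a) z = \<phi> (inv a) (\<phi> g (\<phi> a z))" using a g z az by (simp add: act_mult)
    have "D (\<phi> (inv a) (\<phi> g (\<phi> a z))) (\<phi> (inv a) (\<phi> a z)) = D (\<phi> g (\<phi> a z)) (\<phi> a z)"
      using a az by (intro D_isometry act_isometry) auto
    hence "D (\<phi> (inv a \<otimes> g \<otimes> a) z) z \<le> C" using C[OF az(1)] act_inv[OF a z] e by simp
    hence "w (Suc L) * real (curtain_dist X d (Suc L) (\<phi> (inv a \<otimes> g \<otimes> a) z) z) \<le> C"
      using D_ge order_trans by blast
    hence "real (curtain_dist X d (Suc L) (\<phi> (inv a \<otimes> g \<otimes> a) z) z) \<le> C / w (Suc L)"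
      using weight_pos[of L] by (simp add: field_simps)
    thus "curtain_dist X d (Suc L) (\<phi> (inv a \<otimes> g \<otimes> a) z) z \<le> T" using T by linarith
  qed
  thus "g \<in> coarse_kernel G X d \<phi>" using displacement_via_conjugates[OF K p g] by blast
qed

lemma bounded_kernel:
  assumes "Metric_space.mbounded X D X" shows "coarse_kernel G X D \<phi> = carrier G"
proof -
  obtain B where B: "\<And>x y. x \<in> X \<Longrightarrow> y \<in> X \<Longrightarrow> D x y \<le> B" using assms D_bounded_iff by blast
  have "g \<in> coarse_kernel G X D \<phi>" if g: "g \<in> carrier G" for g
  proof -
    have "\<forall>z\<in>X. D (\<phi> g z) z \<le> max 1 B" using B act_in[OF g] by (simp add: le_max_iff_disj)
    moreover have "0 < max 1 B" by linarith
    ultimately show ?thesis unfolding coarse_kernel_def using g by blast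
  qed
  thus ?thesis by (auto simp: coarse_kernel_def)
qed

end

theorem corollary1p6:
  fixes G :: "('g, 'm) monoid_scheme" and X :: "'a set" and d :: "'a \<Rightarrow> 'a \<Rightarrow> real"
    and \<phi> :: "'g \<Rightarrow> 'a \<Rightarrow> 'a" and w :: "nat \<Rightarrow> real"
  assumes "group G" and "CAT0_space X d" and "geometric_action G X d \<phi>"
    and "admissible_weights w"
  shows "let D = curtain_model_dist X d w;
             G\<^sub>X = coarse_kernel G X d \<phi>;
             G\<^sub>X\<^sub>D = coarse_kernel G X D \<phi>;
             case1 = (\<not> Metric_space.mbounded X D X \<and> G\<^sub>X = G\<^sub>X\<^sub>D);
             case2 = (Metric_space.mbounded X D X \<and> finite_index G (group_center G) \<and>
                      G\<^sub>X = carrier G \<and> carrier G = G\<^sub>X\<^sub>D);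
             case3 = (Metric_space.mbounded X D X \<and> \<not> finite_index G (group_center G) \<and>
                      G\<^sub>X \<noteq> G\<^sub>X\<^sub>D)
         in (case1 \<or> case2 \<or> case3) \<and>
            \<not> (case1 \<and> case2) \<and> \<not> (case1 \<and> case3) \<and> \<not> (case2 \<and> case3)"
proof -
  interpret geometric_curtain_model X d G \<phi> w
    using assms unfolding geometric_curtain_model_def geometric_cat0_def geometric_cat0_axioms_def
      cat0_space_def cat0_space_axioms_def curtain_model_def curtain_model_axioms_def
    by (simp add: CAT0_space_def)
  show ?thesis
  proof (cases "Metric_space.mbounded X D X")
    case True
    thus ?thesis
      using bounded_kernel[OF True] finite_index_center_imp_kernel kernel_imp_finite_index_center
      unfolding Let_def by metis
  next
    case False
    thus ?thesis using kernel_subset kernel_superset[OF False] unfolding Let_def by blast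
  qed
qed

end
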